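(* Let $\Theta,\mathcal X$ be measurable spaces, $P$ a transition probability kernel from $\Theta$ to $\mathcal X$ (write $P_\theta=P(\cdot|\theta)$), and $c,h:\Theta\to\mathbb R$ functions. Let $$\Pi=\Big\{\pi\in\mathcal P(\Theta):\int c(\theta)\,\pi(d\theta)\le 1\Big\},\qquad T(\pi)=\int h(\theta)\,\pi(d\theta).$$ Suppose that: (A1) the functional $\pi\mapsto T(\pi)$ is affine on $\Pi$; (A2) the set $\Pi$ is convex; (A3) there exists a vector space $\mathcal F$ of functions on $\mathcal X$ such that $\mathcal F$ contains constants and is dense in $L_2(\mathcal X,\pi P)$ for every $\pi\in\Pi$; (A4) there exists a topology on $\Pi$ such that $\Pi$ is compact and $T(\pi)$, $\pi Pf$ and $\pi P(f^2)$ are continuous in $\pi\in\Pi$ for all $f\in\mathcal F$. Then for every $n\ge1$, $$R^*_{\rm det}(n)\le \delta_{\chi^2}\Big(\frac1{\sqrt n}\Big)^2,$$ achieved by an estimator of the form $\hat T=\frac1n\sum_{i=1}^n g(X_i)$ for some $g\in\mathcal F$. Furthermore, suppose in addition that: (A5) $K_V=\sup_{\pi\in\Pi}\mathrm{Var}_{\theta\sim\pi}[h(\theta)]<\infty$; (A6) $c\ge 0$ and there exists $\theta_0\in\Theta$ with $c(\theta_0)=0$. Then $$R^*_{\rm det}(n)\ge\frac1{2400}\,\delta_{\chi^2}\Big(\frac1{\sqrt n}\Big)^2-\frac{K_V}{2n}.$$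
   Context: $\mathcal P(\Theta)$ is the set of probability measures on $\Theta$. For $\pi\in\mathcal P(\Theta)$, $\pi P=\int_\Theta P_\theta\,\pi(d\theta)$, and $\pi Pf$ is the expectation of $f$ under $\pi P$. Deterministic setting: $\boldsymbol\theta=(\theta_1,\dots,\theta_n)\in\Theta^n$ is an unknown deterministic vector with $\frac1n\sum_{i=1}^n c(\theta_i)\le1$, equivalently its empirical distribution $\pi_{\boldsymbol\theta}=\frac1n\sum_{i=1}^n\delta_{\theta_i}$ lies in $\Pi$. The observations $X_1,\dots,X_n$ are independent with $X_i\sim P_{\theta_i}$. The target is $T(\pi_{\boldsymbol\theta})=\frac1n\sum_{i=1}^n h(\theta_i)$, and the minimax quadratic risk is $$R^*_{\rm det}(n)=\inf_{\hat T}\ \sup_{\boldsymbol\theta\in\Theta^n:\ \pi_{\boldsymbol\theta}\in\Pi}\mathbb E_{\boldsymbol\theta}\big[|\hat T(X_1,\dots,X_n)-T(\pi_{\boldsymbol\theta})|^2\big].$$ The $\chi^2$-modulus of continuity is $$\delta_{\chi^2}(t)=\sup\{T(\pi')-T(\pi):\ \chi^2(\pi'P\|\pi P)\le t^2,\ \pi,\pi'\in\Pi\},$$ where $\chi^2(F\|G)=\int dG\,(dF/dG)^2-1$ if $F\ll G$ and $\infty$ otherwise. *)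

theory Defs
  imports "HOL-Probability.Probability"
begin

text \<open>
  Throughout, \<open>\<Theta>\<close> and \<open>\<X>\<close> are measurable spaces, represented by measures of which only the
  carrier and the sigma-algebra are used.  The set of probability measures on \<open>\<Theta>\<close> is
  \<^term>\<open>space (prob_algebra \<Theta>)\<close>, a transition probability kernel is a measurable map
  \<open>P \<in> \<Theta> \<rightarrow>\<^sub>M prob_algebra \<X>\<close>, and the mixture \<open>\<pi>P\<close> is the Giry bind \<open>\<pi> \<bind> P\<close>.
\<close>

definition prior_set :: "'a measure \<Rightarrow> ('a \<Rightarrow> real) \<Rightarrow> 'a measure set" where
  "prior_set \<Theta> c =
     {\<pi> \<in> space (prob_algebra \<Theta>). integrable \<pi> c \<and> (\<integral>\<theta>. c \<theta> \<partial>\<pi>) \<le> 1}"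

definition target :: "('a \<Rightarrow> real) \<Rightarrow> 'a measure \<Rightarrow> real" where
  "target h \<pi> = (\<integral>\<theta>. h \<theta> \<partial>\<pi>)"

definition mix_measure :: "real \<Rightarrow> 'a measure \<Rightarrow> 'a measure \<Rightarrow> 'a measure" where
  "mix_measure u \<pi> \<pi>' = measure_of (space \<pi>) (sets \<pi>)
     (\<lambda>A. ennreal u * emeasure \<pi> A + ennreal (1 - u) * emeasure \<pi>' A)"

definition convex_measures :: "'a measure set \<Rightarrow> bool" where
  "convex_measures S \<longleftrightarrow> (\<forall>\<pi>\<in>S. \<forall>\<pi>'\<in>S. \<forall>u\<in>{0..1}. mix_measure u \<pi> \<pi>' \<in> S)"

definition affine_functional_on :: "'a measure set \<Rightarrow> ('a measure \<Rightarrow> real) \<Rightarrow> bool" where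
  "affine_functional_on S T \<longleftrightarrow>
     (\<forall>\<pi>\<in>S. \<forall>\<pi>'\<in>S. \<forall>u\<in>{0..1}. T (mix_measure u \<pi> \<pi>') = u * T \<pi> + (1 - u) * T \<pi>')"

definition function_space :: "('b \<Rightarrow> real) set \<Rightarrow> bool" where
  "function_space F \<longleftrightarrow>
     (\<lambda>x. 0) \<in> F \<and>
     (\<forall>f\<in>F. \<forall>g\<in>F. (\<lambda>x. f x + g x) \<in> F) \<and>
     (\<forall>a. \<forall>f\<in>F. (\<lambda>x. a * f x) \<in> F)"

definition L2_functions :: "'b measure \<Rightarrow> ('b \<Rightarrow> real) set" where
  "L2_functions M = {f \<in> borel_measurable M. integrable M (\<lambda>x. (f x)\<^sup>2)}"

definition dense_in_L2 :: "('b \<Rightarrow> real) set \<Rightarrow> 'b measure \<Rightarrow> bool" where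
  "dense_in_L2 F M \<longleftrightarrow>
     F \<subseteq> L2_functions M \<and>
     (\<forall>\<phi>\<in>L2_functions M. \<forall>e>0. \<exists>f\<in>F. sqrt (\<integral>x. (\<phi> x - f x)\<^sup>2 \<partial>M) < e)"

text \<open>\<^term>\<open>RN_deriv G F\<close> is the density of \<open>F\<close> with respect to \<open>G\<close>.\<close>

definition chi2_divergence :: "'b measure \<Rightarrow> 'b measure \<Rightarrow> ereal" where
  "chi2_divergence F G =
     (if absolutely_continuous G F
      then enn2ereal (\<integral>\<^sup>+x. (RN_deriv G F x)\<^sup>2 \<partial>G) - 1 else \<infinity>)"

definition chi2_modulus ::
  "'a measure \<Rightarrow> ('a \<Rightarrow> 'b measure) \<Rightarrow> ('a \<Rightarrow> real) \<Rightarrow> ('a \<Rightarrow> real) \<Rightarrow> real \<Rightarrow> ereal" where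
  "chi2_modulus \<Theta> P c h t =
     Sup {ereal (target h \<pi>' - target h \<pi>) | \<pi> \<pi>'.
       \<pi> \<in> prior_set \<Theta> c \<and> \<pi>' \<in> prior_set \<Theta> c \<and>
       chi2_divergence (\<pi>' \<bind> P) (\<pi> \<bind> P) \<le> ereal (t\<^sup>2)}"

definition empirical_measure :: "'a measure \<Rightarrow> nat \<Rightarrow> (nat \<Rightarrow> 'a) \<Rightarrow> 'a measure" where
  "empirical_measure \<Theta> n \<theta> = measure_of (space \<Theta>) (sets \<Theta>)
     (\<lambda>A. ennreal (1 / real n) * (\<Sum>i<n. emeasure (return \<Theta> (\<theta> i)) A))"

definition parameter_vectors :: "'a measure \<Rightarrow> ('a \<Rightarrow> real) \<Rightarrow> nat \<Rightarrow> (nat \<Rightarrow> 'a) set" where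
  "parameter_vectors \<Theta> c n =
     {\<theta> \<in> {..<n} \<rightarrow>\<^sub>E space \<Theta>. empirical_measure \<Theta> n \<theta> \<in> prior_set \<Theta> c}"

text \<open>
  The joint law of independent \<open>X\<^sub>i \<sim> P (\<theta> i)\<close> is the product measure.  The risk is an extended
  nonnegative integral, so that an estimator without second moment has infinite risk.
\<close>

definition quadratic_risk ::
  "'a measure \<Rightarrow> ('a \<Rightarrow> 'b measure) \<Rightarrow> ('a \<Rightarrow> real) \<Rightarrow> nat \<Rightarrow>
   ((nat \<Rightarrow> 'b) \<Rightarrow> real) \<Rightarrow> (nat \<Rightarrow> 'a) \<Rightarrow> ennreal" where
  "quadratic_risk \<Theta> P h n T_hat \<theta> =
     (\<integral>\<^sup>+x. ennreal (\<bar>T_hat x - target h (empirical_measure \<Theta> n \<theta>)\<bar>\<^sup>2)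
        \<partial>PiM {..<n} (\<lambda>i. P (\<theta> i)))"

definition worst_case_risk ::
  "'a measure \<Rightarrow> ('a \<Rightarrow> 'b measure) \<Rightarrow> ('a \<Rightarrow> real) \<Rightarrow> ('a \<Rightarrow> real) \<Rightarrow> nat \<Rightarrow>
   ((nat \<Rightarrow> 'b) \<Rightarrow> real) \<Rightarrow> ennreal" where
  "worst_case_risk \<Theta> P c h n T_hat =
     (SUP \<theta>\<in>parameter_vectors \<Theta> c n. quadratic_risk \<Theta> P h n T_hat \<theta>)"

definition estimators :: "'b measure \<Rightarrow> nat \<Rightarrow> ((nat \<Rightarrow> 'b) \<Rightarrow> real) set" where
  "estimators \<X> n = borel_measurable (PiM {..<n} (\<lambda>_. \<X>))"

definition minimax_risk_det ::
  "'a measure \<Rightarrow> 'b measure \<Rightarrow> ('a \<Rightarrow> 'b measure) \<Rightarrow> ('a \<Rightarrow> real) \<Rightarrow> ('a \<Rightarrow> real) \<Rightarrow>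
   nat \<Rightarrow> ennreal" where
  "minimax_risk_det \<Theta> \<X> P c h n =
     (INF T_hat\<in>estimators \<X> n. worst_case_risk \<Theta> P c h n T_hat)"

definition prior_variance :: "('a \<Rightarrow> real) \<Rightarrow> 'a measure \<Rightarrow> ennreal" where
  "prior_variance h \<pi> = (\<integral>\<^sup>+\<theta>. ennreal ((h \<theta> - target h \<pi>)\<^sup>2) \<partial>\<pi>)"

definition max_prior_variance ::
  "'a measure \<Rightarrow> ('a \<Rightarrow> real) \<Rightarrow> ('a \<Rightarrow> real) \<Rightarrow> ennreal" where
  "max_prior_variance \<Theta> c h = (SUP \<pi>\<in>prior_set \<Theta> c. prior_variance h \<pi>)"


text \<open>
  The set functions above are countably additive, and the constraint and the target at an
  empirical distribution are the usual averages.
\<close>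

lemma emeasure_mix_measure:
  assumes "sets \<pi>' = sets \<pi>" "A \<in> sets \<pi>"
  shows "emeasure (mix_measure u \<pi> \<pi>') A =
    ennreal u * emeasure \<pi> A + ennreal (1 - u) * emeasure \<pi>' A"
proof -
  have "(\<lambda>A. ennreal u * emeasure \<pi> A + ennreal (1 - u) * emeasure \<pi>' A) A =
    emeasure (mix_measure u \<pi> \<pi>') A"
  proof (rule emeasure_measure_of[symmetric, OF mix_measure_def])
    show "sets \<pi> \<subseteq> Pow (space \<pi>)" by (rule sets.space_closed)
    show "A \<in> sets (mix_measure u \<pi> \<pi>')" using assms(2) by (simp add: mix_measure_def)
    show "positive (sets (mix_measure u \<pi> \<pi>'))
        (\<lambda>A. ennreal u * emeasure \<pi> A + ennreal (1 - u) * emeasure \<pi>' A)"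
      by (simp add: positive_def)
    show "countably_additive (sets (mix_measure u \<pi> \<pi>'))
        (\<lambda>A. ennreal u * emeasure \<pi> A + ennreal (1 - u) * emeasure \<pi>' A)"
    proof (rule countably_additiveI)
      fix B :: "nat \<Rightarrow> 'a set"
      assume B: "range B \<subseteq> sets (mix_measure u \<pi> \<pi>')" "disjoint_family B"
      then have "range B \<subseteq> sets \<pi>" "range B \<subseteq> sets \<pi>'"
        using assms(1) by (simp_all add: mix_measure_def)
      then show "(\<Sum>i. ennreal u * emeasure \<pi> (B i) + ennreal (1 - u) * emeasure \<pi>' (B i)) =
        ennreal u * emeasure \<pi> (\<Union>i. B i) + ennreal (1 - u) * emeasure \<pi>' (\<Union>i. B i)"
        using B(2) by (simp add: suminf_add[symmetric] suminf_emeasure)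
    qed
  qed
  then show ?thesis by simp
qed

lemma empirical_measure_eq_distr:
  assumes "0 < n" "\<theta> \<in> {..<n} \<rightarrow> space \<Theta>"
  shows "empirical_measure \<Theta> n \<theta> = distr (uniform_count_measure {..<n}) \<Theta> \<theta>"
proof -
  let ?D = "distr (uniform_count_measure {..<n}) \<Theta> \<theta>"
  have m: "\<theta> \<in> uniform_count_measure {..<n} \<rightarrow>\<^sub>M \<Theta>"
    using assms(2) by (auto simp: measurable_def sets_uniform_count_measure
        space_uniform_count_measure)
  have e: "emeasure ?D A =
      ennreal (1 / real n) * (\<Sum>i<n. emeasure (return \<Theta> (\<theta> i)) A)" if A: "A \<in> sets \<Theta>" for A
  proof -
    let ?B = "\<theta> -` A \<inter> {..<n}"
    have "(\<Sum>i<n. emeasure (return \<Theta> (\<theta> i)) A) = (\<Sum>i<n. indicator ?B i)"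
      using A by (intro sum.cong) (auto simp: indicator_def)
    also have "\<dots> = of_nat (card ?B)"
      by (simp add: indicator_def sum.If_cases Int_def conj_commute)
    finally have s: "(\<Sum>i<n. emeasure (return \<Theta> (\<theta> i)) A) = ennreal (real (card ?B))"
      by (simp add: ennreal_of_nat_eq_real_of_nat)
    have "emeasure ?D A = ennreal (real (card ?B) / real n)"
      using A m assms(1)
      by (simp add: emeasure_distr space_uniform_count_measure emeasure_uniform_count_measure)
    then show ?thesis
      by (simp add: s ennreal_mult[symmetric])
  qed
  have "?D = measure_of (space ?D) (sets ?D) (emeasure ?D)"
    by (rule measure_of_of_measure[symmetric])
  also have "\<dots> = empirical_measure \<Theta> n \<theta>"
    unfolding empirical_measure_def space_distr sets_distr
    by (intro measure_of_eq sets.space_closed) (simp add: e sets.sigma_sets_eq)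
  finally show ?thesis ..
qed

lemma integral_empirical_measure:
  assumes "0 < n" "\<theta> \<in> {..<n} \<rightarrow> space \<Theta>" "f \<in> borel_measurable \<Theta>"
  shows "integrable (empirical_measure \<Theta> n \<theta>) f"
    and "(\<integral>x. f x \<partial>empirical_measure \<Theta> n \<theta>) = (\<Sum>i<n. f (\<theta> i) :: real) / real n"
proof -
  have m: "\<theta> \<in> uniform_count_measure {..<n} \<rightarrow>\<^sub>M \<Theta>"
    using assms(2) by (auto simp: measurable_def sets_uniform_count_measure
        space_uniform_count_measure)
  show "integrable (empirical_measure \<Theta> n \<theta>) f"
    unfolding empirical_measure_eq_distr[OF assms(1,2)]
    using assms m by (simp add: integrable_distr_eq uniform_count_measure_def
        integrable_point_measure_finite)
  show "(\<integral>x. f x \<partial>empirical_measure \<Theta> n \<theta>) = (\<Sum>i<n. f (\<theta> i)) / real n"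
    unfolding empirical_measure_eq_distr[OF assms(1,2)]
    using assms m by (simp add: integral_distr uniform_count_measure_def
        lebesgue_integral_point_measure_finite sum_divide_distrib)
qed

lemma target_empirical_measure:
  assumes "0 < n" "\<theta> \<in> {..<n} \<rightarrow> space \<Theta>" "h \<in> borel_measurable \<Theta>"
  shows "target h (empirical_measure \<Theta> n \<theta>) = (\<Sum>i<n. h (\<theta> i)) / real n"
  unfolding target_def by (rule integral_empirical_measure(2)[OF assms])

lemma empirical_measure_in_prior_set_iff:
  assumes "0 < n" "\<theta> \<in> {..<n} \<rightarrow> space \<Theta>" "c \<in> borel_measurable \<Theta>"
  shows "empirical_measure \<Theta> n \<theta> \<in> prior_set \<Theta> c \<longleftrightarrow> (\<Sum>i<n. c (\<theta> i)) / real n \<le> 1"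
proof -
  have m: "\<theta> \<in> uniform_count_measure {..<n} \<rightarrow>\<^sub>M \<Theta>"
    using assms(2) by (auto simp: measurable_def sets_uniform_count_measure
        space_uniform_count_measure)
  have "prob_space (uniform_count_measure {..<n})"
    using assms(1) by (intro prob_space_uniform_count_measure) auto
  then have "empirical_measure \<Theta> n \<theta> \<in> space (prob_algebra \<Theta>)"
    unfolding empirical_measure_eq_distr[OF assms(1,2)] space_prob_algebra
    using prob_space.prob_space_distr m by auto
  then show ?thesis
    by (simp add: prior_set_def integral_empirical_measure[OF assms])
qed

end

theory Submission
  imports Defs
begin

text \<open>
  Upper bound.  At \<open>\<theta>\<close> the risk of the linear estimator built from \<open>g\<close> is at most
  \<open>(T \<pi> - \<pi>Pg)\<^sup>2 + Var\<^bsub>\<pi>P\<^esub>(g) / n\<close> with \<open>\<pi>\<close> the empirical measure of \<open>\<theta>\<close>.  Put \<open>t = 1 / \<surd>n\<close>.  A minimax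
  argument over pairs of priors produces \<open>g \<in> F\<close> with \<open>\<kappa> |T \<pi> - \<pi>Pg| + t sd\<^bsub>\<pi>P\<^esub>(g) \<le> \<delta>(t) + \<epsilon>\<close> for all
  \<open>\<pi> \<in> \<Pi>\<close>: for a pair on which the infimum over \<open>g\<close> is finite, the dual description of the
  chi-squared divergence bounds the gap of \<open>T\<close> between one member and a near-even mixture.
  Since \<open>F\<close> is only dense, the infimum need not be attained.  The bound \<open>\<delta>(t)\<^sup>2\<close> is reached
  nevertheless: the inflation \<open>\<kappa> = 1 + t / 4\<close> leaves room where the bias dominates, and shrinking
  \<open>g\<close> slightly towards a constant gains where the variance dominates.

  Lower bound.  Le Cam's two-point method for the products of the priors \<open>(\<pi> + 3 \<delta>\<^bsub>\<theta>0\<^esub>) / 4\<close>, which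
  violate the constraint with probability at most \<open>1 / 4\<close>.
\<close>

subsection \<open>A minimax theorem\<close>

text \<open>Why pairs of priors: |T \<pi> - \<pi>Pg| is convex in \<pi>, so bias plus deviation is
  not concave in \<pi>. Giving each sign of the bias its own prior restores concavity. The sum of
  the two signed objectives does not change when a constant is added to g, and a constant chosen
  afterwards equalises the two suprema. Why an unattained infimum can still give \<delta>(t)^2:
  near-optimality confines the pair (|bias|, t sd) to a triangle, whereas the risk bound only asks
  for a disc of radius \<delta>(t), so only the corners on the axes matter. The inflation pulls the
  bias corner inside by order t. Shrinking g by a fraction of order t^2 pulls the other corner
  inside by order t^2; its price, a bias of order t \<delta>(t), is affordable at both corners,
  because the range of T on \<Pi> is at most 2 \<delta>(t) / t. Why the lower bound survives
  dilution: weight 1/4 divides the gap of T by 4, but lowers the chi-squared divergence by at least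
  the same factor.\<close>

lemma weighted_le_of_convexlike:
  fixes f1 f2 :: "'x \<Rightarrow> real"
  assumes conc: "\<And>x y u. x \<in> X \<Longrightarrow> y \<in> X \<Longrightarrow> u \<in> {0..1} \<Longrightarrow>
      \<exists>z\<in>X. f1 z \<ge> u * f1 x + (1 - u) * f1 y \<and> f2 z \<ge> u * f2 x + (1 - u) * f2 y"
    and le: "\<And>x. x \<in> X \<Longrightarrow> f1 x \<le> c \<or> f2 x \<le> c"
  shows "\<exists>u\<in>{0..1}. \<forall>x\<in>X. u * f1 x + (1 - u) * f2 x \<le> c"
proof -
  \<comment> \<open>The downward closure of the joint range: the hypothesis gives only a point
    \<open>z\<close> above the average, and passing to everything below turns this into convexity.
    The closure misses the open quadrant \<open>T\<close>, and the normal of a separating line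
    supplies the weights.\<close>
  define S where "S = {(a, b). \<exists>x\<in>X. a \<le> f1 x \<and> b \<le> f2 x}"
  define T where "T = {c<..} \<times> {c<..}"
  show ?thesis
  proof (cases "X = {}")
    case True
    then show ?thesis by (intro bexI[of _ 0]) auto
  next
    case False
    have "convex S"
    proof (rule convexI)
      fix p q :: "real \<times> real" and u v :: real
      assume p: "p \<in> S" and q: "q \<in> S" and uv: "0 \<le> u" "0 \<le> v" "u + v = 1"
      obtain x where x: "x \<in> X" "fst p \<le> f1 x" "snd p \<le> f2 x" using p by (auto simp: S_def)
      obtain y where y: "y \<in> X" "fst q \<le> f1 y" "snd q \<le> f2 y" using q by (auto simp: S_def)
      obtain z where z: "z \<in> X" "f1 z \<ge> u * f1 x + (1 - u) * f1 y"
          "f2 z \<ge> u * f2 x + (1 - u) * f2 y"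
        using conc[OF x(1) y(1), of u] uv by auto
      have v: "v = 1 - u" using uv by simp
      have "u * fst p + v * fst q \<le> f1 z" "u * snd p + v * snd q \<le> f2 z"
        using z x y uv unfolding v
        by (meson add_mono mult_left_mono order_trans v uv diff_ge_0_iff_ge)+
      then show "u *\<^sub>R p + v *\<^sub>R q \<in> S"
        using z(1) by (auto simp: S_def case_prod_beta)
    qed
    moreover have "convex T" unfolding T_def by (intro convex_Times convex_real_interval)
    moreover have "S \<noteq> {}" using False by (auto simp: S_def)
    moreover have "(c + 1, c + 1) \<in> T" by (auto simp: T_def)
    moreover have "S \<inter> T = {}" using le by (force simp: S_def T_def)
    ultimately obtain a b where ab: "a \<noteq> 0" "\<And>p. p \<in> S \<Longrightarrow> a \<bullet> p \<le> b" "\<And>p. p \<in> T \<Longrightarrow> b \<le> a \<bullet> p"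
      using separating_hyperplane_sets[of S T] by blast
    obtain a1 a2 where a: "a = (a1, a2)" by (cases a)
    have T: "b \<le> a1 * r + a2 * s" if "r > c" "s > c" for r s
      using ab(3)[of "(r, s)"] that by (simp add: T_def a)
    \<comment> \<open>The corner lies on the boundary of \<open>T\<close>, so the inequality there
      is a limit of those along the diagonal.\<close>
    have lim: "b \<le> a1 * c + a2 * c"
    proof (rule field_le_epsilon)
      fix e :: real assume e: "e > 0"
      define d where "d = e / (\<bar>a1\<bar> + \<bar>a2\<bar> + 1)"
      have d: "d > 0" using e by (simp add: d_def)
      have "b \<le> a1 * (c + d) + a2 * (c + d)" using T[of "c + d" "c + d"] d by simp
      also have "\<dots> \<le> a1 * c + a2 * c + (\<bar>a1\<bar> + \<bar>a2\<bar> + 1) * d"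
      proof -
        have "a1 * d \<le> \<bar>a1\<bar> * d" "a2 * d \<le> \<bar>a2\<bar> * d"
          using d by (auto intro!: mult_right_mono)
        then show ?thesis using d unfolding distrib_left distrib_right by linarith
      qed
      also have "(\<bar>a1\<bar> + \<bar>a2\<bar> + 1) * d = e" by (simp add: d_def)
      finally show "b \<le> a1 * c + a2 * c + e" .
    qed
    \<comment> \<open>The quadrant is unbounded in both directions, so a negative coefficient would
      push the linear form below \<open>b\<close>; each witness \<open>r\<close> is large enough for
      that.\<close>
    have nn: "a1 \<ge> 0" "a2 \<ge> 0"
    proof -
      obtain x where x: "x \<in> X" using False by blast
      have S: "a1 * r + a2 * s \<le> b" if "r \<le> f1 x" "s \<le> f2 x" for r s
        using ab(2)[of "(r, s)"] that x by (auto simp: S_def a)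
      show "a1 \<ge> 0"
      proof (rule ccontr)
        assume n: "\<not> a1 \<ge> 0"
        define r where "r = c + 1 + \<bar>b - a2 * (c + 1) - a1 * (c + 1)\<bar> / (- a1) + 1"
        have "\<bar>b - a2 * (c + 1) - a1 * (c + 1)\<bar> / (- a1) \<ge> 0"
          using n by (intro divide_nonneg_pos) auto
        then have "r > c" by (simp add: r_def)
        then have "b \<le> a1 * r + a2 * (c + 1)" by (intro T) auto
        moreover have "a1 * r = a1 * (c + 1) - \<bar>b - a2 * (c + 1) - a1 * (c + 1)\<bar> + a1"
          using n by (simp add: r_def field_simps)
        ultimately show False using n by linarith
      qed
      show "a2 \<ge> 0"
      proof (rule ccontr)
        assume n: "\<not> a2 \<ge> 0"
        define r where "r = c + 1 + \<bar>b - a2 * (c + 1) - a1 * (c + 1)\<bar> / (- a2) + 1"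
        have "\<bar>b - a2 * (c + 1) - a1 * (c + 1)\<bar> / (- a2) \<ge> 0"
          using n by (intro divide_nonneg_pos) auto
        then have "r > c" by (simp add: r_def)
        then have "b \<le> a1 * (c + 1) + a2 * r" by (intro T) auto
        moreover have "a2 * r = a2 * (c + 1) - \<bar>b - a2 * (c + 1) - a1 * (c + 1)\<bar> + a2"
          using n by (simp add: r_def field_simps)
        ultimately show False using n by linarith
      qed
    qed
    have pos: "a1 + a2 > 0" using nn ab(1) a by (auto simp: zero_prod_def less_le)
    define u where "u = a1 / (a1 + a2)"
    have u: "u \<in> {0..1}" "1 - u = a2 / (a1 + a2)"
      using nn pos by (auto simp: u_def field_simps)
    have "u * f1 x + (1 - u) * f2 x \<le> c" if "x \<in> X" for x
    proof -
      have "a1 * f1 x + a2 * f2 x \<le> b" using ab(2)[of "(f1 x, f2 x)"] that by (auto simp: S_def a)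
      then have "(a1 * f1 x + a2 * f2 x) / (a1 + a2) \<le> c"
        using lim pos by (simp add: divide_le_eq algebra_simps)
      then show ?thesis unfolding u(2) by (simp add: u_def add_divide_distrib)
    qed
    then show ?thesis using u by blast
  qed
qed

text \<open>Induction on the number of functions needed. Points with
  \<open>\<Phi> x k \<le> b\<close> are handled by \<open>k\<close>; the others form a strict
  superlevel set, which inherits the concavity hypothesis, and there one \<open>g\<close> suffices
  by induction. On all of \<open>X\<close> one of \<open>g\<close> and \<open>k\<close> is then at
  most \<open>b\<close>, and the case of two functions followed by convexity merges them. Convexity
  is stated on the fixed set \<open>Y\<close> and stays outside the induction, while
  \<open>X\<close> shrinks.\<close>

lemma finite_minimax_convexlike:
  fixes \<Phi> :: "'x \<Rightarrow> 'g \<Rightarrow> real"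
  assumes "finite I" "I \<noteq> {}" "I \<subseteq> G"
    and "\<And>x y u. x \<in> X \<Longrightarrow> y \<in> X \<Longrightarrow> u \<in> {0..1} \<Longrightarrow>
      \<exists>z\<in>X. \<forall>g\<in>G. \<Phi> z g \<ge> u * \<Phi> x g + (1 - u) * \<Phi> y g"
    and conv: "\<And>g k u. g \<in> G \<Longrightarrow> k \<in> G \<Longrightarrow> u \<in> {0..1} \<Longrightarrow>
      \<exists>l\<in>G. \<forall>x\<in>Y. \<Phi> x l \<le> u * \<Phi> x g + (1 - u) * \<Phi> x k"
    and "X \<subseteq> Y"
    and "\<And>x. x \<in> X \<Longrightarrow> \<exists>g\<in>I. \<Phi> x g \<le> b"
  shows "\<exists>g\<in>G. \<forall>x\<in>X. \<Phi> x g \<le> b"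
  using assms(1-4,6-)
proof (induction I arbitrary: X rule: finite_ne_induct)
  case (singleton g)
  then show ?case by (intro bexI[of _ g]) auto
next
  case (insert k I)
  let ?X = "{x \<in> X. \<Phi> x k > b}"
  have k: "k \<in> G" using insert by auto
  have "\<exists>g\<in>G. \<forall>x\<in>?X. \<Phi> x g \<le> b"
  proof (rule insert.IH)
    show "I \<subseteq> G" "?X \<subseteq> Y" using insert by auto
    show "\<exists>g\<in>I. \<Phi> x g \<le> b" if "x \<in> ?X" for x
      using insert.prems(4)[of x] that by auto
    fix x y and u :: real assume xy: "x \<in> ?X" "y \<in> ?X" "u \<in> {0..1}"
    then obtain z where z: "z \<in> X" "\<forall>g\<in>G. \<Phi> z g \<ge> u * \<Phi> x g + (1 - u) * \<Phi> y g"
      using insert.prems(2)[of x y u] by auto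
    have "\<Phi> z k > b"
    proof -
      have "u * b + (1 - u) * b < u * \<Phi> x k + (1 - u) * \<Phi> y k"
        using xy by (cases "u = 0") (auto intro!: add_less_le_mono mult_left_mono)
      then have "b < u * \<Phi> x k + (1 - u) * \<Phi> y k" by (simp add: algebra_simps)
      also have "\<dots> \<le> \<Phi> z k" using z k by auto
      finally show ?thesis .
    qed
    then show "\<exists>z\<in>?X. \<forall>g\<in>G. \<Phi> z g \<ge> u * \<Phi> x g + (1 - u) * \<Phi> y g"
      using z by auto
  qed
  then obtain g where g: "g \<in> G" "\<forall>x\<in>?X. \<Phi> x g \<le> b" by auto
  have "\<exists>u\<in>{0..1}. \<forall>x\<in>X. u * \<Phi> x g + (1 - u) * \<Phi> x k \<le> b"
  proof (rule weighted_le_of_convexlike)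
    fix x y and u :: real assume "x \<in> X" "y \<in> X" "u \<in> {0..1}"
    from insert.prems(2)[OF this] show "\<exists>z\<in>X. \<Phi> z g \<ge> u * \<Phi> x g + (1 - u) * \<Phi> y g \<and>
        \<Phi> z k \<ge> u * \<Phi> x k + (1 - u) * \<Phi> y k"
      using g k by blast
  next
    fix x assume "x \<in> X"
    then show "\<Phi> x g \<le> b \<or> \<Phi> x k \<le> b"
      using g(2) by force
  qed
  then obtain u where u: "u \<in> {0..1}" "\<forall>x\<in>X. u * \<Phi> x g + (1 - u) * \<Phi> x k \<le> b" by blast
  obtain l where "l \<in> G" "\<forall>x\<in>Y. \<Phi> x l \<le> u * \<Phi> x g + (1 - u) * \<Phi> x k"
    using conv[OF g(1) k u(1)] by blast
  then show ?case using u(2) insert.prems(3) by (meson order_trans subsetD)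
qed

text \<open>Compactness reduces this to finitely many functions: the strict inequality in the last
  hypothesis makes the sets on which a given \<open>g\<close> succeeds open.\<close>

lemma minimax_convexlike:
  fixes \<Phi> :: "'x \<Rightarrow> 'g \<Rightarrow> real"
  assumes compact: "compact_space \<tau>" and ne: "G \<noteq> {}"
    and cont: "\<And>g. g \<in> G \<Longrightarrow> continuous_map \<tau> euclideanreal (\<lambda>x. \<Phi> x g)"
    and conc: "\<And>x y u. x \<in> topspace \<tau> \<Longrightarrow> y \<in> topspace \<tau> \<Longrightarrow> u \<in> {0..1} \<Longrightarrow>
      \<exists>z\<in>topspace \<tau>. \<forall>g\<in>G. \<Phi> z g \<ge> u * \<Phi> x g + (1 - u) * \<Phi> y g"
    and conv: "\<And>g k u. g \<in> G \<Longrightarrow> k \<in> G \<Longrightarrow> u \<in> {0..1} \<Longrightarrow>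
      \<exists>l\<in>G. \<forall>x\<in>topspace \<tau>. \<Phi> x l \<le> u * \<Phi> x g + (1 - u) * \<Phi> x k"
    and less: "\<And>x. x \<in> topspace \<tau> \<Longrightarrow> \<exists>g\<in>G. \<Phi> x g < b"
  shows "\<exists>g\<in>G. \<forall>x\<in>topspace \<tau>. \<Phi> x g \<le> b"
proof -
  define U where "U g = {x \<in> topspace \<tau>. \<Phi> x g \<in> {..<b}}" for g
  have op: "openin \<tau> (U g)" if "g \<in> G" for g
    unfolding U_def using cont[OF that] by (rule openin_continuous_map_preimage) simp
  have "\<exists>\<F>. finite \<F> \<and> \<F> \<subseteq> U ` G \<and> topspace \<tau> \<subseteq> \<Union>\<F>"
    using compact unfolding compact_space_alt
    by (rule allE[of _ "U ` G"]) (use op less in \<open>auto simp: U_def\<close>)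
  then obtain I where I: "finite I" "I \<subseteq> G" "topspace \<tau> \<subseteq> (\<Union>g\<in>I. U g)"
    by (metis finite_subset_image)
  \<comment> \<open>\<open>g0\<close> keeps the finite index set nonempty even if the space is
    empty.\<close>
  obtain g0 where g0: "g0 \<in> G" using ne by blast
  show ?thesis
  proof (rule finite_minimax_convexlike[where I = "insert g0 I" and Y = "topspace \<tau>"])
    show "\<exists>g\<in>insert g0 I. \<Phi> x g \<le> b" if "x \<in> topspace \<tau>" for x
      using I(3) that by (fastforce simp: U_def)
  qed (use I g0 conc conv in auto)
qed

subsection \<open>Square-integrable functions\<close>

lemma L2_functions_mult_integrable:
  assumes "f \<in> L2_functions M" "g \<in> L2_functions M"
  shows "integrable M (\<lambda>x. f x * g x)"
proof (rule Bochner_Integration.integrable_bound)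
  show "integrable M (\<lambda>x. (f x)\<^sup>2 + (g x)\<^sup>2)" using assms by (auto simp: L2_functions_def)
  show "(\<lambda>x. f x * g x) \<in> borel_measurable M" using assms by (auto simp: L2_functions_def)
  have "\<bar>f x * g x\<bar> \<le> (f x)\<^sup>2 + (g x)\<^sup>2" for x
  proof -
    have "0 \<le> (\<bar>f x\<bar> - \<bar>g x\<bar>)\<^sup>2" "0 \<le> \<bar>f x\<bar> * \<bar>g x\<bar>" by auto
    then show ?thesis unfolding power2_diff abs_mult power2_abs by linarith
  qed
  then show "AE x in M. norm (f x * g x) \<le> norm ((f x)\<^sup>2 + (g x)\<^sup>2)" by simp
qed

lemma L2_functions_lincomb:
  assumes f: "f \<in> L2_functions M" and g: "g \<in> L2_functions M"
  shows "(\<lambda>x. a * f x + b * g x) \<in> L2_functions M"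
proof -
  have "(\<lambda>x. (a * f x + b * g x)\<^sup>2) =
      (\<lambda>x. a\<^sup>2 * (f x)\<^sup>2 + (2 * a * b) * (f x * g x) + b\<^sup>2 * (g x)\<^sup>2)"
    by (auto simp: power2_eq_square algebra_simps)
  then show ?thesis
    using f g L2_functions_mult_integrable[OF f g] by (auto simp: L2_functions_def)
qed

lemma (in finite_measure) const_L2_functions: "(\<lambda>x. a) \<in> L2_functions M"
  by (simp add: L2_functions_def)

lemma (in finite_measure) L2_functions_integrable:
  "f \<in> L2_functions M \<Longrightarrow> integrable M f"
  using L2_functions_mult_integrable[OF _ const_L2_functions[of 1]] by simp

lemma integral_square_lincomb:
  assumes f: "f \<in> L2_functions M" and g: "g \<in> L2_functions M"
  shows "(\<integral>x. (a * f x + b * g x)\<^sup>2 \<partial>M) =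
    a\<^sup>2 * (\<integral>x. (f x)\<^sup>2 \<partial>M) + 2 * a * b * (\<integral>x. f x * g x \<partial>M) + b\<^sup>2 * (\<integral>x. (g x)\<^sup>2 \<partial>M)"
proof -
  have "(\<lambda>x. (a * f x + b * g x)\<^sup>2) =
      (\<lambda>x. a\<^sup>2 * (f x)\<^sup>2 + (2 * a * b) * (f x * g x) + b\<^sup>2 * (g x)\<^sup>2)"
    by (auto simp: power2_eq_square algebra_simps)
  then show ?thesis
    using f g L2_functions_mult_integrable[OF f g] by (simp add: L2_functions_def)
qed

definition L2_norm :: "'b measure \<Rightarrow> ('b \<Rightarrow> real) \<Rightarrow> real" where
  "L2_norm M f = sqrt (\<integral>x. (f x)\<^sup>2 \<partial>M)"

lemma L2_norm_nonneg: "0 \<le> L2_norm M f"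
  by (simp add: L2_norm_def)

lemma L2_norm_power2: "(L2_norm M f)\<^sup>2 = (\<integral>x. (f x)\<^sup>2 \<partial>M)"
  by (simp add: L2_norm_def)

lemma L2_Cauchy_Schwarz:
  assumes f: "f \<in> L2_functions M" and g: "g \<in> L2_functions M"
  shows "\<bar>\<integral>x. f x * g x \<partial>M\<bar> \<le> L2_norm M f * L2_norm M g"
proof -
  define A B C where "A = (\<integral>x. (f x)\<^sup>2 \<partial>M)" and "B = (\<integral>x. (g x)\<^sup>2 \<partial>M)"
    and "C = (\<integral>x. f x * g x \<partial>M)"
  have nn: "A \<ge> 0" "B \<ge> 0" by (simp_all add: A_def B_def)
  have q: "a\<^sup>2 * A + 2 * a * b * C + b\<^sup>2 * B \<ge> 0" for a b
    unfolding A_def B_def C_def integral_square_lincomb[OF f g, symmetric] by simp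
  \<comment> \<open>The quadratic form is evaluated at \<open>B\<close> and \<open>- C\<close>,
    which says nothing if \<open>B = 0\<close>; in that case the form is affine in \<open>b\<close>
    for \<open>a = 1\<close>, so its slope must vanish.\<close>
  have "C\<^sup>2 \<le> A * B"
  proof (cases "B = 0")
    case True
    have "C = 0"
    proof (rule ccontr)
      assume "C \<noteq> 0"
      then have "2 * (- (A + 1) / (2 * C)) * C = - (A + 1)" by simp
      then show False using q[of 1 "- (A + 1) / (2 * C)"] True by simp
    qed
    then show ?thesis using nn by simp
  next
    case False
    have "B * (A * B - C\<^sup>2) \<ge> 0" using q[of B "- C"]
      by (simp add: power2_eq_square algebra_simps)
    then show ?thesis using False nn by (simp add: zero_le_mult_iff)
  qed
  then have "sqrt (C\<^sup>2) \<le> sqrt (A * B)" by (rule real_sqrt_le_mono)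
  then show ?thesis by (simp add: real_sqrt_mult L2_norm_def A_def B_def C_def)
qed

lemma L2_norm_lincomb:
  assumes f: "f \<in> L2_functions M" and g: "g \<in> L2_functions M"
  shows "L2_norm M (\<lambda>x. a * f x + b * g x) \<le> \<bar>a\<bar> * L2_norm M f + \<bar>b\<bar> * L2_norm M g"
proof (rule power2_le_imp_le)
  have "a * b * (\<integral>x. f x * g x \<partial>M) \<le> \<bar>a * b * (\<integral>x. f x * g x \<partial>M)\<bar>" by simp
  also have "\<dots> \<le> \<bar>a\<bar> * \<bar>b\<bar> * (L2_norm M f * L2_norm M g)"
    using L2_Cauchy_Schwarz[OF f g] by (simp add: abs_mult mult_left_mono)
  finally show "(L2_norm M (\<lambda>x. a * f x + b * g x))\<^sup>2 \<le>
      (\<bar>a\<bar> * L2_norm M f + \<bar>b\<bar> * L2_norm M g)\<^sup>2"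
    unfolding L2_norm_power2 integral_square_lincomb[OF f g]
    by (simp add: power2_sum power_mult_distrib L2_norm_power2 algebra_simps)
qed (simp add: L2_norm_nonneg)

text \<open>Written through the two moments whose continuity in the prior is available. For
  square-integrable functions on a probability space it is the norm of the centred function.\<close>

definition std_dev :: "'b measure \<Rightarrow> ('b \<Rightarrow> real) \<Rightarrow> real" where
  "std_dev M f = sqrt ((\<integral>x. (f x)\<^sup>2 \<partial>M) - (\<integral>x. f x \<partial>M)\<^sup>2)"

lemma (in prob_space) std_dev_eq_L2_norm:
  assumes f: "f \<in> L2_functions M"
  shows "std_dev M f = L2_norm M (\<lambda>x. f x - expectation f)"
proof -
  have "(\<integral>x. (f x - expectation f)\<^sup>2 \<partial>M) = (\<integral>x. (f x)\<^sup>2 \<partial>M) - (expectation f)\<^sup>2"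
    using integral_square_lincomb[OF f const_L2_functions[of "expectation f"], of 1 "-1"]
      L2_functions_integrable[OF f]
    by (simp add: prob_space power2_eq_square)
  then show ?thesis by (simp add: std_dev_def L2_norm_def)
qed

lemma (in prob_space) std_dev_power2:
  assumes f: "f \<in> L2_functions M"
  shows "(std_dev M f)\<^sup>2 = (\<integral>x. (f x)\<^sup>2 \<partial>M) - (expectation f)\<^sup>2"
  unfolding std_dev_eq_L2_norm[OF f] L2_norm_power2
  using integral_square_lincomb[OF f const_L2_functions[of "expectation f"], of 1 "-1"]
    L2_functions_integrable[OF f]
  by (simp add: prob_space power2_eq_square)

lemma (in prob_space) std_dev_nonneg:
  "f \<in> L2_functions M \<Longrightarrow> 0 \<le> std_dev M f"
  by (simp add: std_dev_eq_L2_norm L2_norm_nonneg)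

lemma std_dev_le_L2_norm: "std_dev M f \<le> L2_norm M f"
  by (simp add: std_dev_def L2_norm_def)

text \<open>Centring is linear, so the triangle inequality of the norm carries over. This is the
  convexity of the minimax objective in the estimator.\<close>

lemma (in prob_space) std_dev_lincomb:
  assumes f: "f \<in> L2_functions M" and g: "g \<in> L2_functions M"
  shows "std_dev M (\<lambda>x. a * f x + b * g x) \<le> \<bar>a\<bar> * std_dev M f + \<bar>b\<bar> * std_dev M g"
proof -
  have c: "(\<lambda>x. f x - expectation f) \<in> L2_functions M" if "f \<in> L2_functions M" for f
    using L2_functions_lincomb[OF that const_L2_functions[of "expectation f"], of 1 "-1"] by simp
  have "std_dev M (\<lambda>x. a * f x + b * g x) =
      L2_norm M (\<lambda>x. a * (f x - expectation f) + b * (g x - expectation g))"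
    using f g
    by (simp add: std_dev_eq_L2_norm L2_functions_lincomb L2_functions_integrable algebra_simps)
  also have "\<dots> \<le> \<bar>a\<bar> * std_dev M f + \<bar>b\<bar> * std_dev M g"
    unfolding std_dev_eq_L2_norm[OF f] std_dev_eq_L2_norm[OF g]
    by (intro L2_norm_lincomb c f g)
  finally show ?thesis .
qed

lemma (in prob_space) std_dev_add_const:
  assumes f: "f \<in> L2_functions M"
  shows "std_dev M (\<lambda>x. a * f x + b) = \<bar>a\<bar> * std_dev M f"
proof -
  have l: "(\<lambda>x. a * f x + b) \<in> L2_functions M"
    using L2_functions_lincomb[OF f const_L2_functions[of b], of a 1] by simp
  have "std_dev M (\<lambda>x. a * f x + b) = L2_norm M (\<lambda>x. a * (f x - expectation f))"
    unfolding std_dev_eq_L2_norm[OF l]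
    using f by (simp add: L2_functions_integrable algebra_simps prob_space)
  also have "\<dots> = \<bar>a\<bar> * std_dev M f"
    by (simp add: std_dev_eq_L2_norm[OF f] L2_norm_def power_mult_distrib real_sqrt_mult)
  finally show ?thesis .
qed

subsection \<open>Mixtures\<close>

lemma sets_mix_measure[simp, measurable_cong]: "sets (mix_measure u M N) = sets M"
  by (simp add: mix_measure_def sets.sets_measure_of_eq)

lemma space_mix_measure[simp]: "space (mix_measure u M N) = space M"
  by (simp add: mix_measure_def)

lemma nn_integral_mix_measure:
  assumes N: "sets N = sets M" and f: "f \<in> borel_measurable M"
  shows "(\<integral>\<^sup>+x. f x \<partial>mix_measure u M N) =
    ennreal u * (\<integral>\<^sup>+x. f x \<partial>M) + ennreal (1 - u) * (\<integral>\<^sup>+x. f x \<partial>N)"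
  using f
proof induct
  case (cong f g)
  have "space N = space M" using N by (rule sets_eq_imp_space_eq)
  then have "(\<integral>\<^sup>+x. f x \<partial>mix_measure u M N) = (\<integral>\<^sup>+x. g x \<partial>mix_measure u M N)"
      "(\<integral>\<^sup>+x. f x \<partial>M) = (\<integral>\<^sup>+x. g x \<partial>M)" "(\<integral>\<^sup>+x. f x \<partial>N) = (\<integral>\<^sup>+x. g x \<partial>N)"
    using cong(3) by (auto intro!: nn_integral_cong)
  then show ?case using cong(4) by simp
next
  case (set A)
  then show ?case using N by (simp add: emeasure_mix_measure)
next
  case (mult g c)
  note [measurable] = mult(2) and [measurable_cong] = N
  have [measurable]: "g \<in> borel_measurable N" by measurable
  show ?case using mult by (simp add: nn_integral_cmult algebra_simps)
next
  case (add g k)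
  note [measurable] = add(1,4) and [measurable_cong] = N
  have [measurable]: "g \<in> borel_measurable N" "k \<in> borel_measurable N" by measurable
  show ?case using add by (simp add: nn_integral_add algebra_simps)
next
  case (seq U)
  note [measurable] = seq(1) and [measurable_cong] = N
  have [measurable]: "U i \<in> borel_measurable N" for i by measurable
  have m: "mono (\<lambda>i. ennreal u * (\<integral>\<^sup>+x. U i x \<partial>M))" "mono (\<lambda>i. ennreal (1 - u) * (\<integral>\<^sup>+x. U i x \<partial>N))"
    using \<open>incseq U\<close> by (auto simp: mono_def le_fun_def intro!: mult_left_mono nn_integral_mono)
  have "(\<integral>\<^sup>+x. (SUP i. U i) x \<partial>mix_measure u M N) =
      (SUP i. \<integral>\<^sup>+x. U i x \<partial>mix_measure u M N)"
    unfolding SUP_apply using seq by (intro nn_integral_monotone_convergence_SUP) simp_all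
  also have "\<dots> = (SUP i. ennreal u * (\<integral>\<^sup>+x. U i x \<partial>M) + ennreal (1 - u) * (\<integral>\<^sup>+x. U i x \<partial>N))"
    using seq by simp
  also have "\<dots> = (SUP i. ennreal u * (\<integral>\<^sup>+x. U i x \<partial>M)) + (SUP i. ennreal (1 - u) * (\<integral>\<^sup>+x. U i x \<partial>N))"
    using m by (intro ennreal_SUP_add)
  also have "\<dots> = ennreal u * (\<integral>\<^sup>+x. (SUP i. U i) x \<partial>M) + ennreal (1 - u) * (\<integral>\<^sup>+x. (SUP i. U i) x \<partial>N)"
    unfolding SUP_apply using seq
    by (simp add: nn_integral_monotone_convergence_SUP SUP_mult_left_ennreal)
  finally show ?case .
qed

lemma integral_mix_measure:
  fixes f :: "'b \<Rightarrow> real"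
  assumes N: "sets N = sets M" and u: "u \<in> {0..1}"
    and f: "integrable M f" "integrable N f"
  shows "(\<integral>x. f x \<partial>mix_measure u M N) = u * (\<integral>x. f x \<partial>M) + (1 - u) * (\<integral>x. f x \<partial>N)"
proof -
  have [measurable]: "f \<in> borel_measurable M" using f by auto
  let ?p = "\<lambda>L. enn2real (\<integral>\<^sup>+x. ennreal (f x) \<partial>L)" and ?n = "\<lambda>L. enn2real (\<integral>\<^sup>+x. ennreal (- f x) \<partial>L)"
  have fin: "(\<integral>\<^sup>+x. ennreal (f x) \<partial>L) < \<infinity>" "(\<integral>\<^sup>+x. ennreal (- f x) \<partial>L) < \<infinity>" if "integrable L f" for L
    using that by (auto simp: real_integrable_def less_top)
  have 1: "integrable (mix_measure u M N) f"
    using fin[OF f(1)] fin[OF f(2)]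
    by (auto simp: real_integrable_def nn_integral_mix_measure[OF N] ennreal_mult_eq_top_iff
        less_top[symmetric])
  have e: "enn2real (ennreal u * a + ennreal (1 - u) * b) = u * enn2real a + (1 - u) * enn2real b"
    if "a < \<infinity>" "b < \<infinity>" for a b
    using that u by (cases a; cases b) (auto simp: ennreal_mult[symmetric] ennreal_plus[symmetric]
        simp del: ennreal_plus)
  show "(\<integral>x. f x \<partial>mix_measure u M N) = u * (\<integral>x. f x \<partial>M) + (1 - u) * (\<integral>x. f x \<partial>N)"
    using fin[OF f(1)] fin[OF f(2)]
    unfolding real_lebesgue_integral_def[OF 1] real_lebesgue_integral_def[OF f(1)]
      real_lebesgue_integral_def[OF f(2)]
    by (simp add: nn_integral_mix_measure[OF N] e algebra_simps)
qed

text \<open>Linearity of \<pi>P in \<pi>: a segment of priors becomes a segment of observation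
  laws.\<close>

lemma bind_mix_measure:
  assumes N: "sets N = sets M" and M: "space M \<noteq> {}" and P: "P \<in> M \<rightarrow>\<^sub>M subprob_algebra S"
  shows "mix_measure u M N \<bind> P = mix_measure u (M \<bind> P) (N \<bind> P)"
proof -
  have sp: "space N = space M" using N by (rule sets_eq_imp_space_eq)
  have P': "P \<in> N \<rightarrow>\<^sub>M subprob_algebra S" "P \<in> mix_measure u M N \<rightarrow>\<^sub>M subprob_algebra S"
    using P N by (simp_all cong: measurable_cong_sets)
  have s: "sets (M \<bind> P) = sets S" "sets (N \<bind> P) = sets S" "sets (mix_measure u M N \<bind> P) = sets S"
    using P P' M sp by (auto intro!: sets_bind_measurable)
  show ?thesis
  proof (rule measure_eqI)
    show "sets (mix_measure u M N \<bind> P) = sets (mix_measure u (M \<bind> P) (N \<bind> P))"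
      using s by simp
    fix A assume "A \<in> sets (mix_measure u M N \<bind> P)"
    then have A: "A \<in> sets S" using s by simp
    have m: "(\<lambda>x. emeasure (P x) A) \<in> borel_measurable M"
      using measurable_compose[OF P measurable_emeasure_subprob_algebra[OF A]] .
    show "emeasure (mix_measure u M N \<bind> P) A = emeasure (mix_measure u (M \<bind> P) (N \<bind> P)) A"
      using A s M sp by (simp add: emeasure_bind[OF _ P'(2) A] emeasure_bind[OF _ P'(1) A]
          emeasure_bind[OF _ P A] emeasure_mix_measure nn_integral_mix_measure[OF N m])
  qed
qed

subsection \<open>The chi-squared divergence\<close>

text \<open>Densities are unique almost everywhere, so any real-valued one may replace
  \<open>RN_deriv\<close>; square integrability lets the extended integral be read as a real
  one.\<close>

lemma chi2_divergence_density:
  assumes Q: "prob_space Q" and N: "prob_space N" and D: "D \<in> borel_measurable Q" "\<And>x. 0 \<le> D x"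
    and eq: "N = density Q (\<lambda>x. ennreal (D x))" and sq: "integrable Q (\<lambda>x. (D x)\<^sup>2)"
  shows "chi2_divergence N Q = ereal ((\<integral>x. (D x)\<^sup>2 \<partial>Q) - 1)"
proof -
  interpret N: prob_space N by fact
  have ac: "absolutely_continuous Q N"
    unfolding absolutely_continuous_def
  proof
    fix A assume A: "A \<in> null_sets Q"
    have "AE x in Q. x \<in> A \<longrightarrow> ennreal (D x) = 0" using AE_not_in[OF A] by eventually_elim auto
    then show "A \<in> null_sets N" using A D unfolding eq by (subst null_sets_density_iff) auto
  qed
  have "AE x in Q. ennreal (D x) = RN_deriv Q N x"
    using D eq N.sigma_finite_measure by (intro RN_deriv_unique_sigma_finite) auto
  then have "(\<integral>\<^sup>+x. (RN_deriv Q N x)\<^sup>2 \<partial>Q) = (\<integral>\<^sup>+x. ennreal ((D x)\<^sup>2) \<partial>Q)"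
    by (intro nn_integral_cong_AE) (auto simp: ennreal_power[OF D(2), symmetric])
  also have "\<dots> = ennreal (\<integral>x. (D x)\<^sup>2 \<partial>Q)"
    by (intro nn_integral_eq_integral sq) simp
  finally show ?thesis
    using ac by (simp add: chi2_divergence_def one_ereal_def)
qed

text \<open>A finite bound forces absolute continuity, since the divergence is infinite otherwise,
  and bounds the second moment of the density.\<close>

lemma chi2_divergence_leE:
  assumes Q: "prob_space Q" and N: "prob_space N" and sets: "sets N = sets Q"
    and le: "chi2_divergence N Q \<le> ereal r"
  obtains D where "D \<in> borel_measurable Q" "\<And>x. 0 \<le> D x" "N = density Q (\<lambda>x. ennreal (D x))"
    "integrable Q (\<lambda>x. (D x)\<^sup>2)" "(\<integral>x. (D x)\<^sup>2 \<partial>Q) \<le> 1 + r"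
proof -
  interpret Q: prob_space Q by fact
  interpret N: prob_space N by fact
  have ac: "absolutely_continuous Q N"
    using le by (auto simp: chi2_divergence_def split: if_splits)
  obtain D where D: "D \<in> borel_measurable Q" "AE x in Q. RN_deriv Q N x = ennreal (D x)"
      "\<And>x. 0 \<le> D x"
    using Q.real_RN_deriv[OF N.finite_measure_axioms ac sets] by metis
  have eq: "N = density Q (\<lambda>x. ennreal (D x))"
    using Q.density_RN_deriv[OF ac sets] density_cong[OF _ _ D(2)] D(1) by auto
  have "(\<integral>\<^sup>+x. (RN_deriv Q N x)\<^sup>2 \<partial>Q) = (\<integral>\<^sup>+x. ennreal ((D x)\<^sup>2) \<partial>Q)"
    using D by (intro nn_integral_cong_AE) (auto simp: ennreal_power)
  then have l: "enn2ereal (\<integral>\<^sup>+x. ennreal ((D x)\<^sup>2) \<partial>Q) - 1 \<le> ereal r"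
    using le ac by (simp add: chi2_divergence_def)
  then have fin: "(\<integral>\<^sup>+x. ennreal ((D x)\<^sup>2) \<partial>Q) < \<infinity>"
    by (cases "\<integral>\<^sup>+x. ennreal ((D x)\<^sup>2) \<partial>Q") auto
  have sq: "integrable Q (\<lambda>x. (D x)\<^sup>2)"
    using fin D(1) by (auto simp: integrable_iff_bounded)
  have "(\<integral>\<^sup>+x. ennreal ((D x)\<^sup>2) \<partial>Q) = ennreal (\<integral>x. (D x)\<^sup>2 \<partial>Q)"
    by (intro nn_integral_eq_integral sq) simp
  then have "(\<integral>x. (D x)\<^sup>2 \<partial>Q) \<le> 1 + r"
    using l by (simp add: one_ereal_def)
  then show ?thesis using that D eq sq by blast
qed

lemma integral_density_eq_1:
  assumes N: "prob_space N" and D: "D \<in> borel_measurable Q" "\<And>x. 0 \<le> D x"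
    and eq: "N = density Q (\<lambda>x. ennreal (D x))"
  shows "integrable Q D" "(\<integral>x. D x \<partial>Q) = 1"
proof -
  interpret N: prob_space N by fact
  have "emeasure N (space N) = (\<integral>\<^sup>+x. ennreal (D x) \<partial>Q)"
    using D unfolding eq by (subst emeasure_density) (auto intro!: nn_integral_cong)
  then have 1: "(\<integral>\<^sup>+x. ennreal (D x) \<partial>Q) = ennreal 1"
    by (simp add: N.emeasure_space_1)
  have "has_bochner_integral Q D 1"
    by (rule has_bochner_integral_nn_integral[OF D(1) _ _ 1]) (use D in auto)
  then show "integrable Q D" "(\<integral>x. D x \<partial>Q) = 1"
    by (auto simp: has_bochner_integral_iff)
qed

text \<open>By density of \<open>F\<close>, testing against \<open>F\<close> determines the norm of the centred density \<open>dN/dQ - 1\<close>.\<close>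

lemma chi2_divergence_le_of_dense:
  assumes Q: "prob_space Q" and N: "prob_space N" and sets: "sets N = sets Q"
    and dense: "dense_in_L2 F Q"
    and dom: "\<And>f. f \<in> borel_measurable Q \<Longrightarrow> (\<integral>\<^sup>+x. f x \<partial>N) \<le> ennreal C * (\<integral>\<^sup>+x. f x \<partial>Q)"
    and t: "0 \<le> t"
    and test: "\<And>g. g \<in> F \<Longrightarrow> \<bar>(\<integral>x. g x \<partial>N) - (\<integral>x. g x \<partial>Q)\<bar> \<le> t * L2_norm Q g"
  shows "chi2_divergence N Q \<le> ereal (t\<^sup>2)"
proof -
  interpret Q: prob_space Q by fact
  interpret N: prob_space N by fact
  have ac: "absolutely_continuous Q N"
    unfolding absolutely_continuous_def
  proof
    fix A assume A: "A \<in> null_sets Q"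
    then have "A \<in> sets Q" "emeasure Q A = 0" by auto
    moreover have "emeasure N A \<le> ennreal C * emeasure Q A"
      using dom[of "indicator A"] A sets by auto
    ultimately show "A \<in> null_sets N" using sets by auto
  qed
  obtain D where D: "D \<in> borel_measurable Q" "AE x in Q. RN_deriv Q N x = ennreal (D x)"
      "\<And>x. 0 \<le> D x"
    using Q.real_RN_deriv[OF N.finite_measure_axioms ac sets] by metis
  have eq: "N = density Q (\<lambda>x. ennreal (D x))"
    using Q.density_RN_deriv[OF ac sets] density_cong[OF _ _ D(2)] D(1) by auto
  note D1 = integral_density_eq_1[OF N D(1) D(3) eq]
  \<comment> \<open>Domination makes \<open>D\<close> square integrable before the divergence is
    known to be finite: the integral of \<open>D\<close> under \<open>N\<close> is that of its
    square under \<open>Q\<close>.\<close>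
  have "(\<integral>\<^sup>+x. ennreal (D x) \<partial>N) \<le> ennreal C * (\<integral>\<^sup>+x. ennreal (D x) \<partial>Q)"
    using D by (intro dom) auto
  also have "(\<integral>\<^sup>+x. ennreal (D x) \<partial>Q) = 1"
    using D1 D by (simp add: nn_integral_eq_integral)
  finally have "(\<integral>\<^sup>+x. ennreal (D x) \<partial>N) < \<infinity>" by (simp add: le_less_trans less_top)
  moreover have "(\<integral>\<^sup>+x. ennreal (D x) \<partial>N) = (\<integral>\<^sup>+x. ennreal ((D x)\<^sup>2) \<partial>Q)"
    using D unfolding eq
    by (simp add: nn_integral_density power2_eq_square ennreal_mult)
  ultimately have sq: "integrable Q (\<lambda>x. (D x)\<^sup>2)"
    using D(1) by (auto simp: integrable_iff_bounded)
  have DL: "D \<in> L2_functions Q" using D sq by (simp add: L2_functions_def)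
  define E where "E x = D x - 1" for x
  have EL: "E \<in> L2_functions Q"
    using L2_functions_lincomb[OF DL Q.const_L2_functions[of 1], of 1 "-1"]
    by (simp add: E_def[abs_def])
  let ?n = "L2_norm Q"
  have "?n E \<le> t"
  proof (rule ccontr)
    assume "\<not> ?n E \<le> t"
    then have gt: "?n E > t" by simp
    then have pos: "?n E > 0" using t by simp
    \<comment> \<open>A \<open>g\<close> within \<open>e\<close> of \<open>E\<close> nearly attains
      equality in Cauchy-Schwarz. The resulting error \<open>e * (t + ?n E)\<close> is half of the
      excess \<open>?n E * (?n E - t)\<close>, so a contradiction remains.\<close>
    define e where "e = ?n E * (?n E - t) / (2 * (t + ?n E))"
    have e: "e > 0" using gt pos t by (simp add: e_def)
    obtain g where g: "g \<in> F" "sqrt (\<integral>x. (E x - g x)\<^sup>2 \<partial>Q) < e"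
      using dense EL e unfolding dense_in_L2_def by blast
    have gL: "g \<in> L2_functions Q" using g(1) dense by (auto simp: dense_in_L2_def)
    have dL: "(\<lambda>x. E x - g x) \<in> L2_functions Q"
      using L2_functions_lincomb[OF EL gL, of 1 "-1"] by simp
    have d: "?n (\<lambda>x. E x - g x) < e" using g(2) by (simp add: L2_norm_def)
    have ng: "?n g \<le> ?n E + e"
      using L2_norm_lincomb[OF EL dL, of 1 "-1"] d by simp
    have "(\<integral>x. g x \<partial>N) = (\<integral>x. D x * g x \<partial>Q)"
      using gL D unfolding eq by (subst integral_density) (auto simp: L2_functions_def)
    moreover have "(\<integral>x. g x * E x \<partial>Q) = (\<integral>x. D x * g x \<partial>Q) - (\<integral>x. g x \<partial>Q)"
      using L2_functions_mult_integrable[OF DL gL] Q.L2_functions_integrable[OF gL]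
      by (simp add: E_def algebra_simps)
    ultimately have "(\<integral>x. g x * E x \<partial>Q) \<le> t * ?n g"
      using test[OF g(1)] by simp
    moreover have "(\<integral>x. (E x - g x) * E x \<partial>Q) \<le> ?n (\<lambda>x. E x - g x) * ?n E"
      using L2_Cauchy_Schwarz[OF dL EL] by simp
    moreover have "(?n E)\<^sup>2 = (\<integral>x. g x * E x \<partial>Q) + (\<integral>x. (E x - g x) * E x \<partial>Q)"
      unfolding L2_norm_power2
      using L2_functions_mult_integrable[OF gL EL] L2_functions_mult_integrable[OF dL EL]
      by (subst Bochner_Integration.integral_add[symmetric])
        (auto simp: algebra_simps power2_eq_square)
    ultimately have "(?n E)\<^sup>2 \<le> t * ?n g + ?n (\<lambda>x. E x - g x) * ?n E" by linarith
    also have "\<dots> \<le> t * (?n E + e) + e * ?n E"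
      using ng d t pos by (intro add_mono mult_left_mono mult_right_mono) auto
    also have "\<dots> = t * ?n E + e * (t + ?n E)" by (simp add: algebra_simps)
    also have "e * (t + ?n E) = ?n E * (?n E - t) / 2"
      using t pos by (simp add: e_def field_simps)
    finally have "?n E * (?n E - t) \<le> 0"
      by (simp add: power2_eq_square field_simps)
    then show False using gt pos by (simp add: mult_le_0_iff)
  qed
  then have "(?n E)\<^sup>2 \<le> t\<^sup>2" by (rule power_mono) (rule L2_norm_nonneg)
  moreover have "(?n E)\<^sup>2 = (\<integral>x. (D x)\<^sup>2 \<partial>Q) - 1"
    using integral_square_lincomb[OF DL Q.const_L2_functions[of 1], of 1 "-1"] D1
    by (simp add: L2_norm_power2 E_def Q.prob_space)
  ultimately show ?thesis
    using chi2_divergence_density[OF Q N D(1,3) eq sq] by simp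
qed

subsection \<open>The modulus of continuity\<close>

locale compact_experiment =
  fixes \<Theta> :: "'a measure" and \<X> :: "'b measure"
    and P :: "'a \<Rightarrow> 'b measure"
    and c h :: "'a \<Rightarrow> real"
    and F :: "('b \<Rightarrow> real) set"
    and \<tau> :: "'a measure topology"
  assumes kernel: "P \<in> \<Theta> \<rightarrow>\<^sub>M prob_algebra \<X>"
    and c_measurable: "c \<in> borel_measurable \<Theta>"
    and h_measurable: "h \<in> borel_measurable \<Theta>"
    and h_integrable: "\<And>\<pi>. \<pi> \<in> prior_set \<Theta> c \<Longrightarrow> integrable \<pi> h"
    and affine: "affine_functional_on (prior_set \<Theta> c) (target h)"
    and convex: "convex_measures (prior_set \<Theta> c)"
    and space_F: "function_space F"
    and const_F: "\<And>a. (\<lambda>x. a) \<in> F"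
    and dense_F: "\<And>\<pi>. \<pi> \<in> prior_set \<Theta> c \<Longrightarrow> dense_in_L2 F (\<pi> \<bind> P)"
    and topspace: "topspace \<tau> = prior_set \<Theta> c"
    and compact: "compact_space \<tau>"
    and cont_target: "continuous_map \<tau> euclideanreal (target h)"
    and cont_mean: "\<And>f. f \<in> F \<Longrightarrow> continuous_map \<tau> euclideanreal (\<lambda>\<pi>. \<integral>x. f x \<partial>(\<pi> \<bind> P))"
    and cont_square:
      "\<And>f. f \<in> F \<Longrightarrow> continuous_map \<tau> euclideanreal (\<lambda>\<pi>. \<integral>x. (f x)\<^sup>2 \<partial>(\<pi> \<bind> P))"
begin

abbreviation "priors \<equiv> prior_set \<Theta> c"
abbreviation "T \<equiv> target h"
abbreviation "law \<pi> \<equiv> \<pi> \<bind> P"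
abbreviation "mean \<pi> g \<equiv> (\<integral>x. g x \<partial>(\<pi> \<bind> P))"
abbreviation "sd \<pi> g \<equiv> std_dev (\<pi> \<bind> P) g"

text \<open>Agrees with the extended value exactly when \<Pi> is nonempty: T is then bounded, being
  continuous on a compact space, while the supremum over no pairs is minus infinity.\<close>

definition modulus :: "real \<Rightarrow> real" where
  "modulus t = real_of_ereal (chi2_modulus \<Theta> P c h t)"

lemma F_lincomb: "f \<in> F \<Longrightarrow> g \<in> F \<Longrightarrow> (\<lambda>x. a * f x + b * g x) \<in> F"
  using space_F unfolding function_space_def by simp

lemma F_affine: "f \<in> F \<Longrightarrow> (\<lambda>x. a * f x + b) \<in> F"
  using F_lincomb[OF _ const_F[of b], of f a 1] by simp

lemma prior_in_prob_algebra: "\<pi> \<in> priors \<Longrightarrow> \<pi> \<in> space (prob_algebra \<Theta>)"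
  by (simp add: prior_set_def)

lemma
  assumes "\<pi> \<in> priors"
  shows prob_space_prior: "prob_space \<pi>" and sets_prior: "sets \<pi> = sets \<Theta>"
    and prob_space_law: "prob_space (law \<pi>)" and sets_law: "sets (law \<pi>) = sets \<X>"
  using prior_in_prob_algebra[OF assms] kernel
  by (auto simp: space_prob_algebra prob_space_bind' sets_bind')

lemma F_L2: "f \<in> F \<Longrightarrow> \<pi> \<in> priors \<Longrightarrow> f \<in> L2_functions (law \<pi>)"
  using dense_F by (auto simp: dense_in_L2_def)

lemma F_integrable: "f \<in> F \<Longrightarrow> \<pi> \<in> priors \<Longrightarrow> integrable (law \<pi>) f"
  using finite_measure.L2_functions_integrable F_L2 prob_space_law prob_space.finite_measure
  by blast

lemma mix_in_priors: "\<pi> \<in> priors \<Longrightarrow> \<pi>' \<in> priors \<Longrightarrow> u \<in> {0..1} \<Longrightarrow> mix_measure u \<pi> \<pi>' \<in> priors"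
  using convex by (auto simp: convex_measures_def)

lemma target_mix:
  "\<pi> \<in> priors \<Longrightarrow> \<pi>' \<in> priors \<Longrightarrow> u \<in> {0..1} \<Longrightarrow> T (mix_measure u \<pi> \<pi>') = u * T \<pi> + (1 - u) * T \<pi>'"
  using affine by (auto simp: affine_functional_on_def)

lemma law_mix:
  assumes "\<pi> \<in> priors" "\<pi>' \<in> priors"
  shows "law (mix_measure u \<pi> \<pi>') = mix_measure u (law \<pi>) (law \<pi>')"
proof (rule bind_mix_measure)
  show "sets \<pi>' = sets \<pi>" using assms by (simp add: sets_prior)
  show "space \<pi> \<noteq> {}" using prob_space.not_empty[OF prob_space_prior[OF assms(1)]] .
  show "P \<in> \<pi> \<rightarrow>\<^sub>M subprob_algebra \<X>"
    using measurable_prob_algebraD[OF kernel] sets_prior[OF assms(1)] by (simp cong: measurable_cong_sets)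
qed

lemma
  assumes "\<pi> \<in> priors" "\<pi>' \<in> priors" "u \<in> {0..1}" "g \<in> F"
  shows mean_mix: "mean (mix_measure u \<pi> \<pi>') g = u * mean \<pi> g + (1 - u) * mean \<pi>' g"
    and square_mix: "mean (mix_measure u \<pi> \<pi>') (\<lambda>x. (g x)\<^sup>2) =
      u * mean \<pi> (\<lambda>x. (g x)\<^sup>2) + (1 - u) * mean \<pi>' (\<lambda>x. (g x)\<^sup>2)"
  using assms F_integrable[OF assms(4)] F_L2[OF assms(4)]
  by (auto simp: law_mix sets_law L2_functions_def intro!: integral_mix_measure)

lemma sd_nonneg: "g \<in> F \<Longrightarrow> \<pi> \<in> priors \<Longrightarrow> 0 \<le> sd \<pi> g"
  using prob_space.std_dev_nonneg F_L2 prob_space_law by blast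

lemma sd_power2:
  "g \<in> F \<Longrightarrow> \<pi> \<in> priors \<Longrightarrow> (sd \<pi> g)\<^sup>2 = mean \<pi> (\<lambda>x. (g x)\<^sup>2) - (mean \<pi> g)\<^sup>2"
  using prob_space.std_dev_power2 F_L2 prob_space_law by blast

text \<open>The law of total variance; the last summand is the variance between the
  components.\<close>

lemma sd_mix_power2:
  assumes "\<pi> \<in> priors" "\<pi>' \<in> priors" "u \<in> {0..1}" "g \<in> F"
  shows "(sd (mix_measure u \<pi> \<pi>') g)\<^sup>2 =
    u * (sd \<pi> g)\<^sup>2 + (1 - u) * (sd \<pi>' g)\<^sup>2 + u * (1 - u) * (mean \<pi> g - mean \<pi>' g)\<^sup>2"
  unfolding sd_power2[OF assms(4) mix_in_priors[OF assms(1-3)]] sd_power2[OF assms(4,1)]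
    sd_power2[OF assms(4,2)] mean_mix[OF assms] square_mix[OF assms]
  by (simp add: power2_eq_square algebra_simps)

text \<open>Concavity in the prior, the other half of the saddle structure. By total variance the
  squares of the two sides differ by \<open>u * (1 - u)\<close> times the sum of the squared
  differences of the deviations and of the means.\<close>

lemma sd_mix_ge:
  assumes "\<pi> \<in> priors" "\<pi>' \<in> priors" "u \<in> {0..1}" "g \<in> F"
  shows "u * sd \<pi> g + (1 - u) * sd \<pi>' g \<le> sd (mix_measure u \<pi> \<pi>') g"
proof (rule power2_le_imp_le)
  have "0 \<le> u * (1 - u) * (sd \<pi> g - sd \<pi>' g)\<^sup>2" "0 \<le> u * (1 - u) * (mean \<pi> g - mean \<pi>' g)\<^sup>2"
    using assms(3) by auto
  then show "(u * sd \<pi> g + (1 - u) * sd \<pi>' g)\<^sup>2 \<le> (sd (mix_measure u \<pi> \<pi>') g)\<^sup>2"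
    unfolding sd_mix_power2[OF assms] by (simp add: power2_eq_square algebra_simps)
qed (use sd_nonneg mix_in_priors assms in auto)

lemma target_bounded: "\<exists>B. \<forall>\<pi>\<in>priors. \<bar>T \<pi>\<bar> \<le> B"
proof -
  have "compactin euclideanreal (T ` topspace \<tau>)"
    using compact cont_target by (intro image_compactin[of \<tau>]) (auto simp: compact_space_def)
  then have "bounded (T ` priors)" by (simp add: topspace compact_imp_bounded)
  then show ?thesis by (auto simp: bounded_iff)
qed

lemma chi2_divergence_self: "\<pi> \<in> priors \<Longrightarrow> chi2_divergence (law \<pi>) (law \<pi>) = 0"
  using prob_space_law[of \<pi>] chi2_divergence_density[of "law \<pi>" "law \<pi>" "\<lambda>_. 1"]
  by (simp add: density_1 prob_space.prob_space prob_space.finite_measure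
      finite_measure.integrable_const zero_ereal_def)

lemma
  assumes ne: "priors \<noteq> {}"
  shows chi2_modulus_eq: "chi2_modulus \<Theta> P c h t = ereal (modulus t)"
    and modulus_nonneg: "0 \<le> modulus t"
proof -
  obtain B where B: "\<forall>\<pi>\<in>priors. \<bar>T \<pi>\<bar> \<le> B" using target_bounded by blast
  obtain \<pi> where \<pi>: "\<pi> \<in> priors" using ne by blast
  have "T \<pi>' - T \<pi> \<le> 2 * B" if "\<pi> \<in> priors" "\<pi>' \<in> priors" for \<pi> \<pi>'
    using B that by (smt (verit))
  then have "chi2_modulus \<Theta> P c h t \<le> ereal (2 * B)"
    unfolding chi2_modulus_def by (intro Sup_least) auto
  moreover have "ereal 0 \<le> chi2_modulus \<Theta> P c h t"
    unfolding chi2_modulus_def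
    using \<pi> chi2_divergence_self[OF \<pi>] by (intro Sup_upper) (force simp: zero_ereal_def[symmetric])
  ultimately show "chi2_modulus \<Theta> P c h t = ereal (modulus t)" "0 \<le> modulus t"
    unfolding modulus_def by (cases "chi2_modulus \<Theta> P c h t"; simp)+
qed

lemma target_diff_le_modulus:
  assumes "\<pi> \<in> priors" "\<pi>' \<in> priors" "chi2_divergence (law \<pi>') (law \<pi>) \<le> ereal (t\<^sup>2)"
  shows "T \<pi>' - T \<pi> \<le> modulus t"
proof -
  have "ereal (T \<pi>' - T \<pi>) \<le> chi2_modulus \<Theta> P c h t"
    unfolding chi2_modulus_def using assms by (intro Sup_upper) auto
  moreover have "priors \<noteq> {}" using assms by auto
  ultimately show ?thesis by (simp add: chi2_modulus_eq)
qed

text \<open>Since 0 < \<beta> < 1, the \<beta>-mixture dominates the \<alpha>-mixture with a bounded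
  density, so the divergence between them can be bounded by testing against \<open>F\<close>,
  however \<open>law \<pi>\<close> and \<open>law \<pi>'\<close> are related. The differences
  between the mixtures, of means as well as of T, are \<alpha> - \<beta> times those between the
  components.\<close>

lemma mixture_gap_le_modulus:
  assumes \<pi>: "\<pi> \<in> priors" "\<pi>' \<in> priors"
    and ab: "0 < \<beta>" "\<beta> < 1" "\<beta> \<le> \<alpha>" "\<alpha> \<le> 1" and t: "0 \<le> t"
    and test: "\<And>g. g \<in> F \<Longrightarrow>
      (\<alpha> - \<beta>) * \<bar>mean \<pi> g - mean \<pi>' g\<bar> \<le> t * sd (mix_measure \<beta> \<pi> \<pi>') g"
  shows "(\<alpha> - \<beta>) * (T \<pi> - T \<pi>') \<le> modulus t"
proof -
  let ?A = "mix_measure \<alpha> \<pi> \<pi>'" and ?B = "mix_measure \<beta> \<pi> \<pi>'"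
  have A: "?A \<in> priors" and B: "?B \<in> priors" using mix_in_priors[OF \<pi>] ab by auto
  \<comment> \<open>Any common bound for the ratios of the weights serves; only its finiteness
    matters.\<close>
  define C where "C = 1 / \<beta> + 1 / (1 - \<beta>)"
  have C: "C \<ge> 0" "\<alpha> \<le> C * \<beta>" "1 - \<alpha> \<le> C * (1 - \<beta>)"
  proof -
    have p: "1 / \<beta> > 0" "1 / (1 - \<beta>) > 0" using ab by auto
    then show "C \<ge> 0" by (simp add: C_def)
    have "C * \<beta> = 1 + \<beta> * (1 / (1 - \<beta>))" "C * (1 - \<beta>) = 1 + (1 - \<beta>) * (1 / \<beta>)"
      using ab by (simp_all add: C_def field_simps)
    moreover have "\<beta> * (1 / (1 - \<beta>)) \<ge> 0" "(1 - \<beta>) * (1 / \<beta>) \<ge> 0" using ab by auto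
    ultimately show "\<alpha> \<le> C * \<beta>" "1 - \<alpha> \<le> C * (1 - \<beta>)" using ab by linarith+
  qed
  have "chi2_divergence (law ?A) (law ?B) \<le> ereal (t\<^sup>2)"
  proof (rule chi2_divergence_le_of_dense[where F = F and C = C])
    show "prob_space (law ?B)" "prob_space (law ?A)" using A B prob_space_law by auto
    show "sets (law ?A) = sets (law ?B)" using A B by (simp add: sets_law)
    show "dense_in_L2 F (law ?B)" by (rule dense_F[OF B])
    show "0 \<le> t" by fact
    fix f :: "'b \<Rightarrow> ennreal" assume "f \<in> borel_measurable (law ?B)"
    moreover have s: "sets (law ?B) = sets (law \<pi>)" using B \<pi> by (simp add: sets_law)
    ultimately have f: "f \<in> borel_measurable (law \<pi>)" by (simp cong: measurable_cong_sets)
    have s': "sets (law \<pi>') = sets (law \<pi>)" using \<pi> by (simp add: sets_law)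
    have "(\<integral>\<^sup>+x. f x \<partial>law ?A) \<le>
        ennreal (C * \<beta>) * (\<integral>\<^sup>+x. f x \<partial>law \<pi>) + ennreal (C * (1 - \<beta>)) * (\<integral>\<^sup>+x. f x \<partial>law \<pi>')"
      unfolding law_mix[OF \<pi>] nn_integral_mix_measure[OF s' f]
      using C by (intro add_mono mult_right_mono) (auto intro: ennreal_leI)
    also have "\<dots> = ennreal C * (\<integral>\<^sup>+x. f x \<partial>law ?B)"
      unfolding law_mix[OF \<pi>] nn_integral_mix_measure[OF s' f]
      using C ab by (simp add: ennreal_mult distrib_left mult.assoc)
    finally show "(\<integral>\<^sup>+x. f x \<partial>law ?A) \<le> ennreal C * (\<integral>\<^sup>+x. f x \<partial>law ?B)" .
  next
    fix g assume g: "g \<in> F"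
    have "mean ?A g - mean ?B g = (\<alpha> - \<beta>) * (mean \<pi> g - mean \<pi>' g)"
      using mean_mix[OF \<pi> _ g] ab by (simp add: algebra_simps)
    then have "\<bar>mean ?A g - mean ?B g\<bar> = (\<alpha> - \<beta>) * \<bar>mean \<pi> g - mean \<pi>' g\<bar>"
      using ab by (simp add: abs_mult)
    also have "\<dots> \<le> t * sd ?B g" by (rule test[OF g])
    also have "\<dots> \<le> t * L2_norm (law ?B) g"
      using t by (intro mult_left_mono std_dev_le_L2_norm)
    finally show "\<bar>mean ?A g - mean ?B g\<bar> \<le> t * L2_norm (law ?B) g" .
  qed
  then have "T ?A - T ?B \<le> modulus t" by (rule target_diff_le_modulus[OF B A])
  then show ?thesis using target_mix[OF \<pi>] ab by (simp add: algebra_simps)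
qed

text \<open>For the even mixture the test condition holds for every pair: half the difference of the
  means is the between-component part of the deviation. Hence moving the weight from 1/2 to (1 +
  t)/2 stays within divergence t^2, and it changes T by t/2 times the difference.\<close>

lemma target_range_le_modulus:
  assumes \<pi>: "\<pi> \<in> priors" "\<pi>' \<in> priors" and t: "0 \<le> t" "t \<le> 1"
  shows "t * \<bar>T \<pi> - T \<pi>'\<bar> \<le> 2 * modulus t"
proof -
  have "t * (T \<pi> - T \<pi>') \<le> 2 * modulus t" if \<pi>: "\<pi> \<in> priors" "\<pi>' \<in> priors" for \<pi> \<pi>'
  proof -
    have "((1 + t) / 2 - 1 / 2) * (T \<pi> - T \<pi>') \<le> modulus t"
    proof (rule mixture_gap_le_modulus[OF \<pi>])
      fix g assume g: "g \<in> F"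
      have "(\<bar>mean \<pi> g - mean \<pi>' g\<bar> / 2)\<^sup>2 \<le> (sd (mix_measure (1 / 2) \<pi> \<pi>') g)\<^sup>2"
        using sd_mix_power2[OF \<pi> _ g, of "1 / 2"] by (simp add: power_divide)
      then have "\<bar>mean \<pi> g - mean \<pi>' g\<bar> / 2 \<le> sd (mix_measure (1 / 2) \<pi> \<pi>') g"
        by (rule power2_le_imp_le) (use sd_nonneg[OF g] mix_in_priors[OF \<pi>] in auto)
      then have "t * (\<bar>mean \<pi> g - mean \<pi>' g\<bar> / 2) \<le> t * sd (mix_measure (1 / 2) \<pi> \<pi>') g"
        using t(1) by (rule mult_left_mono)
      then show "((1 + t) / 2 - 1 / 2) * \<bar>mean \<pi> g - mean \<pi>' g\<bar> \<le>
          t * sd (mix_measure (1 / 2) \<pi> \<pi>') g"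
        by (simp add: field_simps)
    qed (use t in auto)
    then show ?thesis by (simp add: field_simps)
  qed
  from this[OF \<pi>] this[OF \<pi>(2,1)] show ?thesis
    by (cases "T \<pi> \<ge> T \<pi>'") (auto simp: abs_if algebra_simps)
qed

end

subsection \<open>Near-optimal linear estimators\<close>

text \<open>After shrinking and division by \<open>d\<close>, the hypothesis confines (A, B) to the
  triangle with corners (0, 0), (m, 0) and (0, w). The claim is that this triangle, moved by t/5 in
  the first direction (the bias paid for shrinking), stays in the unit disc. Convexity of the square
  leaves two corners to check: \<open>m + t / 5 \<le> 1\<close>, thanks to the inflation 1 + t/4,
  and (t/5)^2 + w^2 \<le> 1, thanks to the shrinking.\<close>

lemma shrunken_risk_bound:
  fixes a b t d :: real
  assumes t: "0 < t" "t \<le> 1" and ab: "0 \<le> a" "0 \<le> b" and d: "0 < d"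
    and le: "(1 + t / 4) * a + b \<le> d * (1 + t\<^sup>2 / 20)"
  shows "((1 - t\<^sup>2 / 10) * a + t\<^sup>2 / 10 * (2 * d / t))\<^sup>2 + ((1 - t\<^sup>2 / 10) * b)\<^sup>2 \<le> d\<^sup>2"
proof -
  define A where "A = (1 - t\<^sup>2 / 10) * a / d"
  define B where "B = (1 - t\<^sup>2 / 10) * b / d"
  define w where "w = 1 - t\<^sup>2 / 20"
  \<comment> \<open>The share of the budget \<open>w\<close> that is taken by the bias.\<close>
  define l where "l = (1 + t / 4) * A / w"
  have t2: "t\<^sup>2 \<le> 1" "t\<^sup>2 \<le> t" "0 < t\<^sup>2" using t by (auto simp: power2_eq_square mult_le_one)
  have w: "0 < w" using t2 by (simp add: w_def)
  have nn: "0 \<le> A" "0 \<le> B" using ab d t2 by (auto simp: A_def B_def)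
  have "(1 - t\<^sup>2 / 10) * ((1 + t / 4) * a + b) \<le> (1 - t\<^sup>2 / 10) * (d * (1 + t\<^sup>2 / 20))"
    using le t2 by (intro mult_left_mono) auto
  also have "\<dots> = d * ((1 - t\<^sup>2 / 10) * (1 + t\<^sup>2 / 20))" by simp
  \<comment> \<open>Shrinking by t^2/10 overcompensates the slack t^2/20 of near-optimality and
    leaves t^2/20 to spare.\<close>
  also have "\<dots> \<le> d * w"
    using d by (intro mult_left_mono) (auto simp: w_def algebra_simps)
  finally have "((1 - t\<^sup>2 / 10) * ((1 + t / 4) * a + b)) / d \<le> w"
    using d by (simp add: field_simps)
  then have AB: "(1 + t / 4) * A + B \<le> w"
    by (simp add: A_def B_def add_divide_distrib distrib_left mult.left_commute)
  have l: "0 \<le> l" "l \<le> 1" using nn t w AB by (auto simp: l_def field_simps)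
  have "l * w = (1 + t / 4) * A" using w by (simp add: l_def)
  then have Bl: "B \<le> (1 - l) * w" using AB by (simp add: left_diff_distrib)
  define m where "m = w / (1 + t / 4)"
  have "A = (q * A / w) * (w / q)" if "q \<noteq> 0" for q using that w by simp
  then have Al: "A = l * m" using t by (simp add: l_def m_def)
  have m: "m + t / 5 \<le> 1"
  proof -
    have "w \<le> (1 - t / 5) * (1 + t / 4)"
      using t2 by (simp add: w_def algebra_simps power2_eq_square)
    then have "m \<le> 1 - t / 5" using t by (simp add: m_def divide_le_eq)
    then show ?thesis by simp
  qed
  have m0: "0 \<le> m" using w t by (simp add: m_def)
  have "(A + t / 5)\<^sup>2 \<le> l * (m + t / 5)\<^sup>2 + (1 - l) * (t / 5)\<^sup>2"
  proof -
    have "l * (m + t / 5)\<^sup>2 + (1 - l) * (t / 5)\<^sup>2 - (A + t / 5)\<^sup>2 = l * (1 - l) * m\<^sup>2"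
      by (simp add: Al power2_eq_square field_simps)
    moreover have "0 \<le> l * (1 - l) * m\<^sup>2" using l by auto
    ultimately show ?thesis by linarith
  qed
  also have "\<dots> \<le> l * 1 + (1 - l) * (t\<^sup>2 / 25)"
    using m m0 t l by (intro add_mono mult_left_mono power_le_one) (auto simp: power_divide)
  finally have 1: "(A + t / 5)\<^sup>2 \<le> l + (1 - l) * (t\<^sup>2 / 25)" by simp
  have "B\<^sup>2 \<le> ((1 - l) * w)\<^sup>2" using Bl nn by (intro power_mono) auto
  also have "\<dots> \<le> (1 - l) * w\<^sup>2"
    unfolding power_mult_distrib
  proof (rule mult_right_mono)
    show "(1 - l)\<^sup>2 \<le> 1 - l"
      using l unfolding power2_eq_square by (intro mult_left_le_one_le) auto
  qed simp
  also have "\<dots> \<le> (1 - l) * (1 - t\<^sup>2 / 25)"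
  proof (rule mult_left_mono)
    have "t\<^sup>2 * t\<^sup>2 \<le> t\<^sup>2" using t2 by (intro mult_left_le_one_le) auto
    then show "w\<^sup>2 \<le> 1 - t\<^sup>2 / 25"
      using t2 by (simp add: w_def power2_eq_square algebra_simps)
  qed (use l in auto)
  finally have "(A + t / 5)\<^sup>2 + B\<^sup>2 \<le> 1" using 1 by (simp add: algebra_simps)
  then have "d\<^sup>2 * ((A + t / 5)\<^sup>2 + B\<^sup>2) \<le> d\<^sup>2" by (simp add: mult_left_le)
  moreover have "d * (A + t / 5) = (1 - t\<^sup>2 / 10) * a + t\<^sup>2 / 10 * (2 * d / t)"
    "d * B = (1 - t\<^sup>2 / 10) * b"
    using d t by (simp_all add: A_def B_def power2_eq_square distrib_left)
  ultimately show ?thesis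
    by (metis distrib_left power_mult_distrib)
qed

context compact_experiment
begin

lemma continuous_map_sd:
  assumes g: "g \<in> F"
  shows "continuous_map \<tau> euclideanreal (\<lambda>\<pi>. sd \<pi> g)"
proof -
  have "continuous_map \<tau> euclideanreal (\<lambda>\<pi>. mean \<pi> (\<lambda>x. (g x)\<^sup>2) - (mean \<pi> g)\<^sup>2)"
    by (intro continuous_intros cont_mean cont_square g)
  moreover have "continuous_map euclideanreal euclideanreal sqrt"
    by (simp add: continuous_intros)
  ultimately show ?thesis
    unfolding std_dev_def by (rule continuous_map_compose[unfolded o_def])
qed

text \<open>
  If no test function separates \<open>\<pi>\<close> from \<open>\<pi>'\<close>, then neither does it separate \<open>\<pi>\<close> from a mixture
  with slightly more than half of its mass at \<open>\<pi>'\<close>: the between-component variance of the mixture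
  pays for the inflation factor \<open>1 + t / 4\<close>.
\<close>

lemma inseparable_gap_le_modulus:
  assumes \<pi>: "\<pi> \<in> priors" "\<pi>' \<in> priors" and t: "0 < t" "t \<le> 1"
    and insep: "\<And>g. g \<in> F \<Longrightarrow> (1 + t / 4) * \<bar>mean \<pi> g - mean \<pi>' g\<bar> \<le> t * (sd \<pi> g + sd \<pi>' g)"
  shows "(1 + t / 4) * (T \<pi> - T \<pi>') \<le> 2 * modulus t"
proof -
  define k where "k = t / 4"
  define \<beta> where "\<beta> = (1 - k) / 2"
  have k: "0 < k" "k \<le> 1 / 4" using t by (auto simp: k_def)
  have \<beta>: "0 < \<beta>" "\<beta> < 1" "1 - \<beta> = (1 + k) / 2" using k by (auto simp: \<beta>_def field_simps)
  \<comment> \<open>The case \<alpha> = 1: the prior \<open>\<pi>\<close> itself is compared with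
    the mixture.\<close>
  have "(1 - \<beta>) * (T \<pi> - T \<pi>') \<le> modulus t"
  proof (rule mixture_gap_le_modulus[OF \<pi>])
    fix g assume g: "g \<in> F"
    define s s' where "s = sd \<pi> g" and "s' = sd \<pi>' g"
    define D where "D = \<bar>mean \<pi> g - mean \<pi>' g\<bar>"
    have nn: "0 \<le> s" "0 \<le> s'" "0 \<le> D" using sd_nonneg[OF g] \<pi> by (auto simp: s_def s'_def D_def)
    have "((1 + k) * D)\<^sup>2 \<le> (t * (s + s'))\<^sup>2"
      using insep[OF g] nn k by (intro power_mono) (auto simp: s_def s'_def D_def k_def)
    then have "(1 - k\<^sup>2) * ((1 + k)\<^sup>2 * D\<^sup>2) \<le> (1 - k\<^sup>2) * (t\<^sup>2 * (s + s')\<^sup>2)"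
      using k by (intro mult_left_mono) (auto simp: power_mult_distrib power_le_one)
    also have "\<dots> = t\<^sup>2 * ((1 - k\<^sup>2) * (s + s')\<^sup>2)" by simp
    also have "\<dots> \<le> t\<^sup>2 * (4 * (\<beta> * s\<^sup>2 + (1 - \<beta>) * s'\<^sup>2))"
    proof (rule mult_left_mono)
      \<comment> \<open>A weighted Cauchy-Schwarz inequality whose defect is an explicit square; the
        uneven weights cost the factor 1 - k^2.\<close>
      have "4 * (\<beta> * s\<^sup>2 + (1 - \<beta>) * s'\<^sup>2) = 2 * (1 - k) * s\<^sup>2 + 2 * (1 + k) * s'\<^sup>2"
        unfolding \<beta>(3) by (simp add: \<beta>_def field_simps)
      then have "4 * (\<beta> * s\<^sup>2 + (1 - \<beta>) * s'\<^sup>2) - (1 - k\<^sup>2) * (s + s')\<^sup>2 = ((1 - k) * s - (1 + k) * s')\<^sup>2"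
        by (simp add: power2_eq_square algebra_simps)
      then show "(1 - k\<^sup>2) * (s + s')\<^sup>2 \<le> 4 * (\<beta> * s\<^sup>2 + (1 - \<beta>) * s'\<^sup>2)"
        by (smt (verit) zero_le_power2)
    qed simp
    finally have 1: "(1 - k\<^sup>2) * ((1 + k)\<^sup>2 * D\<^sup>2) \<le> 4 * (t\<^sup>2 * (\<beta> * s\<^sup>2 + (1 - \<beta>) * s'\<^sup>2))"
      by (simp only: mult.left_commute)
    \<comment> \<open>The share k^2 lost above is covered by the between-component variance. As t =
      4 k, this needs only (1 + k)^2 \<le> 16 (1 - k^2), with ample room for k \<le> 1/4.\<close>
    have "k\<^sup>2 * (1 + k)\<^sup>2 \<le> t\<^sup>2 * (1 - k\<^sup>2)"
    proof -
      have "(1 + k)\<^sup>2 \<le> (5 / 4)\<^sup>2" using k by (intro power_mono) auto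
      moreover have "k\<^sup>2 \<le> (1 / 4)\<^sup>2" using k by (intro power_mono) auto
      ultimately have "(1 + k)\<^sup>2 \<le> 16 * (1 - k\<^sup>2)" by (simp add: power2_eq_square)
      then have "k\<^sup>2 * (1 + k)\<^sup>2 \<le> k\<^sup>2 * (16 * (1 - k\<^sup>2))" by (intro mult_left_mono) auto
      also have "\<dots> = t\<^sup>2 * (1 - k\<^sup>2)" by (simp add: k_def power_divide)
      finally show ?thesis .
    qed
    then have "k\<^sup>2 * (1 + k)\<^sup>2 * D\<^sup>2 \<le> t\<^sup>2 * (1 - k\<^sup>2) * D\<^sup>2"
      by (rule mult_right_mono) simp
    with 1 have "(1 + k)\<^sup>2 * D\<^sup>2 \<le> 4 * (t\<^sup>2 * (\<beta> * s\<^sup>2 + (1 - \<beta>) * s'\<^sup>2)) + t\<^sup>2 * (1 - k\<^sup>2) * D\<^sup>2"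
      by (simp add: algebra_simps)
    also have "1 - k\<^sup>2 = 4 * (\<beta> * (1 - \<beta>))"
      unfolding \<beta>(3) by (simp add: \<beta>_def power2_eq_square algebra_simps)
    finally have "(1 + k)\<^sup>2 * D\<^sup>2 \<le> 4 * (t\<^sup>2 * (\<beta> * s\<^sup>2 + (1 - \<beta>) * s'\<^sup>2 + \<beta> * (1 - \<beta>) * D\<^sup>2))"
      by (simp add: algebra_simps)
    moreover have "(sd (mix_measure \<beta> \<pi> \<pi>') g)\<^sup>2 = \<beta> * s\<^sup>2 + (1 - \<beta>) * s'\<^sup>2 + \<beta> * (1 - \<beta>) * D\<^sup>2"
      using sd_mix_power2[OF \<pi> _ g, of \<beta>] \<beta>(1,2) by (simp add: s_def s'_def D_def)
    ultimately have "((1 - \<beta>) * D)\<^sup>2 \<le> (t * sd (mix_measure \<beta> \<pi> \<pi>') g)\<^sup>2"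
      unfolding \<beta>(3) by (simp add: power_mult_distrib power_divide)
    moreover have "0 \<le> sd (mix_measure \<beta> \<pi> \<pi>') g"
      using sd_nonneg[OF g] mix_in_priors[OF \<pi>] \<beta> by auto
    ultimately show "(1 - \<beta>) * \<bar>mean \<pi> g - mean \<pi>' g\<bar> \<le> t * sd (mix_measure \<beta> \<pi> \<pi>') g"
      unfolding D_def using t by (auto intro: power2_le_imp_le)
  qed (use \<beta> t in auto)
  then show ?thesis unfolding \<beta>(3) by (simp add: k_def)
qed

text \<open>For a fixed pair the objective is a constant plus a positively homogeneous function of
  g, so its infimum is either the value at g = 0 or minus infinity. The minimax theorem makes the
  choice of g uniform; its strict hypothesis is the reason for \<open>e\<close>.\<close>

lemma near_optimal_linear_estimator:
  assumes ne: "priors \<noteq> {}" and t: "0 < t" "t \<le> 1" and e: "0 < e"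
  shows "\<exists>g\<in>F. \<forall>\<pi>\<in>priors. (1 + t / 4) * \<bar>T \<pi> - mean \<pi> g\<bar> + t * sd \<pi> g \<le> modulus t + e"
proof -
  define k where "k = 1 + t / 4"
  define \<psi> where "\<psi> \<pi> \<sigma> g = \<sigma> * (k * (T \<pi> - mean \<pi> g)) + t * sd \<pi> g" for \<pi> \<sigma> g
  define \<Phi> where "\<Phi> p g = \<psi> (fst p) 1 g + \<psi> (snd p) (-1) g" for p g
  have k: "k > 0" using t by (simp add: k_def)
  have ts: "topspace (prod_topology \<tau> \<tau>) = priors \<times> priors" by (simp add: topspace)
  have "\<exists>g\<in>F. \<forall>p\<in>topspace (prod_topology \<tau> \<tau>). \<Phi> p g \<le> 2 * (modulus t + e)"
  proof (rule minimax_convexlike)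
    show "compact_space (prod_topology \<tau> \<tau>)" using compact by (simp add: compact_space_prod_topology)
    show "F \<noteq> {}" using const_F by blast
    show "continuous_map (prod_topology \<tau> \<tau>) euclideanreal (\<lambda>p. \<Phi> p g)" if "g \<in> F" for g
    proof -
      have "continuous_map \<tau> euclideanreal (\<lambda>\<pi>. \<psi> \<pi> \<sigma> g)" for \<sigma>
        unfolding \<psi>_def
        by (intro continuous_intros cont_target cont_mean continuous_map_sd that)
      from continuous_map_compose[OF continuous_map_fst this, unfolded o_def]
        continuous_map_compose[OF continuous_map_snd this, unfolded o_def]
      show ?thesis unfolding \<Phi>_def by (intro continuous_intros)
    qed
  next
    fix p q and u :: real
    assume pq: "p \<in> topspace (prod_topology \<tau> \<tau>)" "q \<in> topspace (prod_topology \<tau> \<tau>)" and u: "u \<in> {0..1}"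
    have mix: "u * \<psi> \<pi> \<sigma> g + (1 - u) * \<psi> \<pi>' \<sigma> g \<le> \<psi> (mix_measure u \<pi> \<pi>') \<sigma> g"
      if \<pi>: "\<pi> \<in> priors" "\<pi>' \<in> priors" and g: "g \<in> F" for \<pi> \<pi>' \<sigma> g
    proof -
      have "t * (u * sd \<pi> g + (1 - u) * sd \<pi>' g) \<le> t * sd (mix_measure u \<pi> \<pi>') g"
        using sd_mix_ge[OF \<pi> u g] t by (intro mult_left_mono) auto
      then show ?thesis
        unfolding \<psi>_def target_mix[OF \<pi> u] mean_mix[OF \<pi> u g] by (simp add: algebra_simps)
    qed
    let ?z = "(mix_measure u (fst p) (fst q), mix_measure u (snd p) (snd q))"
    have "?z \<in> priors \<times> priors" using pq u mix_in_priors unfolding ts by auto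
    moreover have "\<forall>g\<in>F. u * \<Phi> p g + (1 - u) * \<Phi> q g \<le> \<Phi> ?z g"
    proof
      fix g assume g: "g \<in> F"
      show "u * \<Phi> p g + (1 - u) * \<Phi> q g \<le> \<Phi> ?z g"
        using mix[OF _ _ g, of "fst p" "fst q" 1] mix[OF _ _ g, of "snd p" "snd q" "-1"] pq
        unfolding ts \<Phi>_def by (auto simp: distrib_left)
    qed
    ultimately show "\<exists>z\<in>topspace (prod_topology \<tau> \<tau>). \<forall>g\<in>F. u * \<Phi> p g + (1 - u) * \<Phi> q g \<le> \<Phi> z g"
      unfolding ts by blast
  next
    fix f g and u :: real assume fg: "f \<in> F" "g \<in> F" and u: "u \<in> {0..1}"
    let ?l = "\<lambda>x. u * f x + (1 - u) * g x"
    have conv: "\<psi> \<pi> \<sigma> ?l \<le> u * \<psi> \<pi> \<sigma> f + (1 - u) * \<psi> \<pi> \<sigma> g" if \<pi>: "\<pi> \<in> priors" for \<pi> \<sigma>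
    proof -
      have m: "mean \<pi> ?l = u * mean \<pi> f + (1 - u) * mean \<pi> g"
        using F_integrable[OF fg(1) \<pi>] F_integrable[OF fg(2) \<pi>] by simp
      have "sd \<pi> ?l \<le> \<bar>u\<bar> * sd \<pi> f + \<bar>1 - u\<bar> * sd \<pi> g"
        by (rule prob_space.std_dev_lincomb[OF prob_space_law[OF \<pi>] F_L2[OF fg(1) \<pi>] F_L2[OF fg(2) \<pi>]])
      then have "t * sd \<pi> ?l \<le> t * (u * sd \<pi> f + (1 - u) * sd \<pi> g)"
        using t u by (intro mult_left_mono) auto
      then show ?thesis unfolding \<psi>_def m by (simp add: algebra_simps)
    qed
    have "\<Phi> p ?l \<le> u * \<Phi> p f + (1 - u) * \<Phi> p g" if "p \<in> priors \<times> priors" for p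
      using conv[of "fst p" 1] conv[of "snd p" "-1"] that unfolding \<Phi>_def by (auto simp: distrib_left)
    then show "\<exists>l\<in>F. \<forall>p\<in>topspace (prod_topology \<tau> \<tau>). \<Phi> p l \<le> u * \<Phi> p f + (1 - u) * \<Phi> p g"
      unfolding ts using F_lincomb[OF fg] by blast
  next
    fix p assume "p \<in> topspace (prod_topology \<tau> \<tau>)"
    then obtain \<pi> \<pi>' where p: "p = (\<pi>, \<pi>')" and \<pi>: "\<pi> \<in> priors" "\<pi>' \<in> priors"
      unfolding ts by auto
    show "\<exists>g\<in>F. \<Phi> p g < 2 * (modulus t + e)"
    proof (cases "\<forall>g\<in>F. k * \<bar>mean \<pi> g - mean \<pi>' g\<bar> \<le> t * (sd \<pi> g + sd \<pi>' g)")
      case True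
      then have "k * (T \<pi> - T \<pi>') \<le> 2 * modulus t"
        using inseparable_gap_le_modulus[OF \<pi> t] by (simp add: k_def)
      moreover have "\<Phi> p (\<lambda>x. 0) = k * (T \<pi> - T \<pi>')"
        by (simp add: \<Phi>_def \<psi>_def p std_dev_def algebra_simps)
      ultimately show ?thesis using const_F[of 0] e by (intro bexI[of _ "\<lambda>x. 0"]) auto
    next
      case False
      then obtain g where g: "g \<in> F" "k * \<bar>mean \<pi> g - mean \<pi>' g\<bar> > t * (sd \<pi> g + sd \<pi>' g)"
        by (auto simp: not_le)
      define \<sigma> where "\<sigma> = (if mean \<pi> g \<ge> mean \<pi>' g then 1 else - 1 :: real)"
      define y where "y = k * \<bar>mean \<pi> g - mean \<pi>' g\<bar> - t * (sd \<pi> g + sd \<pi>' g)"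
      have y: "y > 0" using g by (simp add: y_def)
      \<comment> \<open>Along the multiples of a separating function the objective falls at rate
        \<open>y\<close>; this multiple is large enough to pass below the bound.\<close>
      define r where "r = \<bar>k * (T \<pi> - T \<pi>') - 2 * (modulus t + e)\<bar> / y + 1"
      have r: "r > 0" using y by (auto simp: r_def intro!: add_nonneg_pos)
      have sd: "sd \<rho> (\<lambda>x. r * \<sigma> * g x + 0) = r * sd \<rho> g" if "\<rho> \<in> priors" for \<rho>
        using prob_space.std_dev_add_const[OF prob_space_law[OF that] F_L2[OF g(1) that], of "r * \<sigma>" 0] r
        by (simp add: abs_mult \<sigma>_def)
      have ab: "\<bar>mean \<pi> g - mean \<pi>' g\<bar> = \<sigma> * (mean \<pi> g - mean \<pi>' g)" by (simp add: \<sigma>_def)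
      have "\<Phi> p (\<lambda>x. r * \<sigma> * g x + 0) = k * (T \<pi> - T \<pi>') - r * y"
        unfolding \<Phi>_def \<psi>_def p fst_conv snd_conv sd[OF \<pi>(1)] sd[OF \<pi>(2)] y_def ab
        by (simp add: algebra_simps)
      also have "r * y = \<bar>k * (T \<pi> - T \<pi>') - 2 * (modulus t + e)\<bar> + y"
        using y by (simp add: r_def field_simps)
      finally have "\<Phi> p (\<lambda>x. r * \<sigma> * g x + 0) < 2 * (modulus t + e)" using y by linarith
      then show ?thesis using F_affine[OF g(1)] by blast
    qed
  qed
  then obtain g where g: "g \<in> F" and
    le: "\<And>\<pi> \<pi>'. \<pi> \<in> priors \<Longrightarrow> \<pi>' \<in> priors \<Longrightarrow> \<psi> \<pi> 1 g + \<psi> \<pi>' (-1) g \<le> 2 * (modulus t + e)"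
    unfolding ts \<Phi>_def by fastforce
  \<comment> \<open>From pairs to single priors: the two signed suprema add up to at most
    \<open>2 * (modulus t + e)\<close>, and adding \<open>a\<close> to \<open>g\<close> lowers one
    and raises the other until both are at most half of that.\<close>
  define M where "M = (SUP \<pi>\<in>priors. \<psi> \<pi> 1 g)"
  obtain \<pi>0 where \<pi>0: "\<pi>0 \<in> priors" using ne by blast
  have M: "\<psi> \<pi> 1 g \<le> M" if "\<pi> \<in> priors" for \<pi>
    unfolding M_def
  proof (rule cSUP_upper[OF that])
    show "bdd_above ((\<lambda>\<pi>. \<psi> \<pi> 1 g) ` priors)"
      using le[OF _ \<pi>0] by (intro bdd_aboveI2[of _ _ "2 * (modulus t + e) - \<psi> \<pi>0 (-1) g"]) (simp add: le_diff_eq)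
  qed
  have M': "M \<le> 2 * (modulus t + e) - \<psi> \<pi> (-1) g" if "\<pi> \<in> priors" for \<pi>
    unfolding M_def using le[OF _ that] by (intro cSUP_least ne) (simp add: le_diff_eq)
  define a where "a = (M - (modulus t + e)) / k"
  have ka: "k * a = M - (modulus t + e)" using k by (simp add: a_def)
  have "k * \<bar>T \<pi> - mean \<pi> (\<lambda>x. 1 * g x + a)\<bar> + t * sd \<pi> (\<lambda>x. 1 * g x + a) \<le> modulus t + e"
    if \<pi>: "\<pi> \<in> priors" for \<pi>
  proof -
    interpret L: prob_space "law \<pi>" by (rule prob_space_law[OF \<pi>])
    have s: "sd \<pi> (\<lambda>x. 1 * g x + a) = sd \<pi> g"
      using L.std_dev_add_const[OF F_L2[OF g \<pi>], of 1 a] by simp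
    have m: "mean \<pi> (\<lambda>x. 1 * g x + a) = mean \<pi> g + a"
      using F_integrable[OF g \<pi>] by (simp add: L.prob_space)
    have "k * \<bar>T \<pi> - (mean \<pi> g + a)\<bar> = \<bar>k * (T \<pi> - (mean \<pi> g + a))\<bar>"
      using k by (simp add: abs_mult)
    also have "k * (T \<pi> - (mean \<pi> g + a)) = k * (T \<pi> - mean \<pi> g) - k * a"
      by (simp add: algebra_simps)
    finally have "k * \<bar>T \<pi> - (mean \<pi> g + a)\<bar> = \<bar>k * (T \<pi> - mean \<pi> g) - k * a\<bar>" .
    then show ?thesis
      unfolding s m ka using M[OF \<pi>] M'[OF \<pi>] by (auto simp: \<psi>_def abs_if)
  qed
  then show ?thesis using F_affine[OF g, of 1 a] unfolding k_def by blast
qed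

lemma optimal_linear_estimator:
  assumes ne: "priors \<noteq> {}" and t: "0 < t" "t \<le> 1"
  shows "\<exists>g\<in>F. \<forall>\<pi>\<in>priors. (T \<pi> - mean \<pi> g)\<^sup>2 + (t * sd \<pi> g)\<^sup>2 \<le> (modulus t)\<^sup>2"
proof -
  obtain \<pi>0 where \<pi>0: "\<pi>0 \<in> priors" using ne by blast
  define d where "d = modulus t"
  define m where "m = T \<pi>0"
  have range: "\<bar>T \<pi> - m\<bar> \<le> 2 * d / t" if "\<pi> \<in> priors" for \<pi>
    using target_range_le_modulus[OF that \<pi>0, of t] t by (simp add: d_def m_def field_simps)
  show ?thesis
  proof (cases "d = 0")
    case True
    \<comment> \<open>With modulus zero T is constant on \<Pi> and a constant estimator has no
      error. The other case needs \<open>d > 0\<close>, because the slack granted to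
      \<open>g\<close> is proportional to \<open>d\<close>.\<close>
    then have "T \<pi> = m" if "\<pi> \<in> priors" for \<pi> using range[OF that] by simp
    then show ?thesis
      using prob_space.prob_space[OF prob_space_law]
      by (intro bexI[OF _ const_F[of m]]) (auto simp: std_dev_def)
  next
    case False
    then have d: "d > 0" using modulus_nonneg[OF ne, of t] by (simp add: d_def)
    define s where "s = t\<^sup>2 / 10"
    have s: "0 \<le> s" "s \<le> 1" using t power_le_one[of t 2] by (auto simp: s_def)
    obtain g where g: "g \<in> F"
      and le: "\<And>\<pi>. \<pi> \<in> priors \<Longrightarrow> (1 + t / 4) * \<bar>T \<pi> - mean \<pi> g\<bar> + t * sd \<pi> g \<le> d + d * t\<^sup>2 / 20"
      using near_optimal_linear_estimator[OF ne t, of "d * t\<^sup>2 / 20"] d t by (auto simp: d_def)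
    \<comment> \<open>Shrinking towards a value attained by T keeps the added bias below
      \<open>s\<close> times the range of T.\<close>
    let ?g = "\<lambda>x. (1 - s) * g x + s * m"
    have "(T \<pi> - mean \<pi> ?g)\<^sup>2 + (t * sd \<pi> ?g)\<^sup>2 \<le> d\<^sup>2" if \<pi>: "\<pi> \<in> priors" for \<pi>
    proof -
      interpret L: prob_space "law \<pi>" by (rule prob_space_law[OF \<pi>])
      have sd: "t * sd \<pi> ?g = (1 - s) * (t * sd \<pi> g)"
        using L.std_dev_add_const[OF F_L2[OF g \<pi>], of "1 - s" "s * m"] s by simp
      have "mean \<pi> ?g = (1 - s) * mean \<pi> g + s * m"
        using F_integrable[OF g \<pi>] by (simp add: L.prob_space)
      then have "T \<pi> - mean \<pi> ?g = (1 - s) * (T \<pi> - mean \<pi> g) + s * (T \<pi> - m)"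
        by (simp add: algebra_simps)
      also have "\<bar>\<dots>\<bar> \<le> (1 - s) * \<bar>T \<pi> - mean \<pi> g\<bar> + s * \<bar>T \<pi> - m\<bar>"
        using s by (intro abs_triangle_ineq[THEN order_trans]) (simp add: abs_mult)
      also have "\<dots> \<le> (1 - s) * \<bar>T \<pi> - mean \<pi> g\<bar> + s * (2 * d / t)"
        using range[OF \<pi>] s by (intro add_left_mono mult_left_mono)
      finally have "\<bar>T \<pi> - mean \<pi> ?g\<bar>\<^sup>2 \<le> ((1 - s) * \<bar>T \<pi> - mean \<pi> g\<bar> + s * (2 * d / t))\<^sup>2"
        by (intro power_mono) auto
      then have "(T \<pi> - mean \<pi> ?g)\<^sup>2 + (t * sd \<pi> ?g)\<^sup>2 \<le>
          ((1 - s) * \<bar>T \<pi> - mean \<pi> g\<bar> + s * (2 * d / t))\<^sup>2 + ((1 - s) * (t * sd \<pi> g))\<^sup>2"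
        unfolding sd by simp
      also have "\<dots> \<le> d\<^sup>2"
        unfolding s_def using le[OF \<pi>] sd_nonneg[OF g \<pi>] t d
        by (intro shrunken_risk_bound) (auto simp: algebra_simps)
      finally show ?thesis .
    qed
    then show ?thesis using F_affine[OF g, of "1 - s" "s * m"] by (auto simp: d_def)
  qed
qed

end

subsection \<open>Sums of independent variables\<close>

text \<open>The locale \<open>product_prob_space\<close> asks for a probability measure at every
  index, while the laws of the observations are given only on \<open>I\<close>; the remaining
  factors are filled with a point mass.\<close>

lemma product_prob_space_extend:
  assumes "\<And>i. i \<in> I \<Longrightarrow> prob_space (M i)"
  shows "\<exists>N. product_prob_space N \<and> (\<forall>i\<in>I. N i = M i) \<and> PiM I N = PiM I M"
proof -
  define N where "N i = (if i \<in> I then M i else return (count_space UNIV) undefined)" for i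
  have "product_prob_space N"
    using assms by (intro product_prob_spaceI) (auto simp: N_def intro!: prob_space_return)
  moreover have "PiM I N = PiM I M" by (intro PiM_cong) (auto simp: N_def)
  ultimately show ?thesis by (intro exI[of _ N]) (simp add: N_def)
qed

lemma (in prob_space) nn_integral_shift_square:
  assumes g: "g \<in> L2_functions M"
  shows "(\<integral>\<^sup>+x. ennreal ((b + g x)\<^sup>2) \<partial>M) = ennreal ((b + expectation g)\<^sup>2 + (std_dev M g)\<^sup>2)"
proof -
  have e: "(b + g x)\<^sup>2 = (g x)\<^sup>2 + 2 * b * g x + b\<^sup>2" for x
    by (simp add: power2_eq_square algebra_simps)
  have i: "integrable M g" "integrable M (\<lambda>x. (g x)\<^sup>2)"
    using g L2_functions_integrable[OF g] by (auto simp: L2_functions_def)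
  have "integrable M (\<lambda>x. (b + g x)\<^sup>2)" unfolding e using i by simp
  then have "(\<integral>\<^sup>+x. ennreal ((b + g x)\<^sup>2) \<partial>M) = ennreal (\<integral>x. (b + g x)\<^sup>2 \<partial>M)"
    by (intro nn_integral_eq_integral) auto
  also have "(\<integral>x. (b + g x)\<^sup>2 \<partial>M) = (b + expectation g)\<^sup>2 + (std_dev M g)\<^sup>2"
    unfolding e std_dev_power2[OF g] using i
    by (simp add: prob_space power2_eq_square algebra_simps)
  finally show ?thesis .
qed

text \<open>Squared bias plus variance, as an extended integral, so that finiteness is part of the
  claim. The induction keeps \<open>b\<close> arbitrary because integrating out one coordinate
  shifts it by a mean.\<close>

lemma nn_integral_PiM_sum_square:
  assumes "finite I" and M: "\<And>i. i \<in> I \<Longrightarrow> prob_space (M i)"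
    and g: "\<And>i. i \<in> I \<Longrightarrow> g i \<in> L2_functions (M i)"
  shows "(\<integral>\<^sup>+x. ennreal (((\<Sum>i\<in>I. g i (x i)) - b)\<^sup>2) \<partial>PiM I M) =
    ennreal (((\<Sum>i\<in>I. \<integral>y. g i y \<partial>M i) - b)\<^sup>2 + (\<Sum>i\<in>I. (std_dev (M i) (g i))\<^sup>2))"
proof -
  obtain N where N: "product_prob_space N" "\<And>i. i \<in> I \<Longrightarrow> N i = M i" "PiM I N = PiM I M"
    using product_prob_space_extend[of I M, OF M] by auto
  interpret product_prob_space N by (rule N(1))
  have "(\<integral>\<^sup>+x. ennreal (((\<Sum>i\<in>I. g i (x i)) - b)\<^sup>2) \<partial>PiM I N) =
      ennreal (((\<Sum>i\<in>I. \<integral>y. g i y \<partial>N i) - b)\<^sup>2 + (\<Sum>i\<in>I. (std_dev (N i) (g i))\<^sup>2))"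
    if "\<And>i. i \<in> I \<Longrightarrow> g i \<in> L2_functions (N i)"
    using \<open>finite I\<close> that
  proof (induction I arbitrary: b rule: finite_induct)
    case empty
    then show ?case by (simp add: PiM_empty nn_integral_count_space_finite)
  next
    case (insert k I)
    have [measurable]: "g i \<in> borel_measurable (N i)" if "i \<in> insert k I" for i
      using insert.prems[OF that] by (simp add: L2_functions_def)
    have [measurable]: "(\<lambda>x. \<Sum>i\<in>J. g i (x i)) \<in> borel_measurable (PiM J N)" if "J \<subseteq> insert k I" for J
      using that by (intro borel_measurable_sum) (auto intro!: measurable_PiM_component_rev)
    have eq: "(\<Sum>i\<in>insert k I. g i ((x(k := y)) i)) - b = ((\<Sum>i\<in>I. g i (x i)) - b) + g k y" for x y
      using insert(1,2) by (simp add: sum.insert) (intro sum.cong, auto)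
    have "(\<integral>\<^sup>+x. ennreal (((\<Sum>i\<in>insert k I. g i (x i)) - b)\<^sup>2) \<partial>PiM (insert k I) N) =
        (\<integral>\<^sup>+x. (\<integral>\<^sup>+y. ennreal ((((\<Sum>i\<in>I. g i (x i)) - b) + g k y)\<^sup>2) \<partial>N k) \<partial>PiM I N)"
      unfolding eq[symmetric] using insert(1,2) by (intro product_nn_integral_insert) auto
    also have "\<dots> = (\<integral>\<^sup>+x. ennreal (((\<Sum>i\<in>I. g i (x i)) - (b - (\<integral>y. g k y \<partial>N k)))\<^sup>2 +
        (std_dev (N k) (g k))\<^sup>2) \<partial>PiM I N)"
      by (intro nn_integral_cong, subst M.nn_integral_shift_square)
        (auto simp: insert.prems algebra_simps)
    also have "\<dots> = (\<integral>\<^sup>+x. ennreal (((\<Sum>i\<in>I. g i (x i)) - (b - (\<integral>y. g k y \<partial>N k)))\<^sup>2) \<partial>PiM I N) +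
        ennreal ((std_dev (N k) (g k))\<^sup>2)"
      using prob_space.emeasure_space_1[OF prob_space_PiM[of I N, OF M.prob_space_axioms]]
      by (simp add: nn_integral_add)
    also have "\<dots> = ennreal (((\<Sum>i\<in>I. \<integral>y. g i y \<partial>N i) - (b - (\<integral>y. g k y \<partial>N k)))\<^sup>2 +
        (\<Sum>i\<in>I. (std_dev (N i) (g i))\<^sup>2)) + ennreal ((std_dev (N k) (g k))\<^sup>2)"
      using insert.IH insert.prems by simp
    finally show ?case
      using insert(1,2) by (simp add: sum_nonneg algebra_simps flip: ennreal_plus)
  qed
  then show ?thesis using N g by simp
qed

lemma emeasure_PiM_PiE:
  assumes "finite I" and M: "\<And>i. i \<in> I \<Longrightarrow> prob_space (M i)" and A: "\<And>i. i \<in> I \<Longrightarrow> A i \<in> sets (M i)"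
  shows "emeasure (PiM I M) (PiE I A) = (\<Prod>i\<in>I. emeasure (M i) (A i))"
proof -
  obtain N where N: "product_prob_space N" "\<And>i. i \<in> I \<Longrightarrow> N i = M i" "PiM I N = PiM I M"
    using product_prob_space_extend[of I M, OF M] by auto
  interpret product_prob_space N by (rule N(1))
  show ?thesis using emeasure_PiM[OF assms(1), of A] A N by simp
qed

subsection \<open>Products of kernels\<close>

text \<open>Boxes form an intersection-stable generator, and on a box the product measure is a
  finite product of functions that are measurable in one coordinate each.\<close>

lemma measurable_PiM_kernel:
  assumes I: "finite I" and P: "P \<in> S \<rightarrow>\<^sub>M prob_algebra N"
  shows "(\<lambda>\<theta>. PiM I (\<lambda>i. P (\<theta> i))) \<in> PiM I (\<lambda>_. S) \<rightarrow>\<^sub>M subprob_algebra (PiM I (\<lambda>_. N))"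
proof (rule measurable_subprob_algebra_generated[OF sets_PiM Int_stable_prod_algebra
      prod_algebra_sets_into_space])
  have P': "prob_space (P (\<theta> i)) \<and> sets (P (\<theta> i)) = sets N"
    if "\<theta> \<in> space (PiM I (\<lambda>_. S))" "i \<in> I" for \<theta> i
    using measurable_space[OF P, of "\<theta> i"] that
    by (auto simp: space_prob_algebra space_PiM PiE_iff)
  fix \<theta> assume \<theta>: "\<theta> \<in> space (PiM I (\<lambda>_. S))"
  show "subprob_space (PiM I (\<lambda>i. P (\<theta> i)))"
    using P'[OF \<theta>] by (intro prob_space_imp_subprob_space prob_space_PiM) auto
  show "sets (PiM I (\<lambda>i. P (\<theta> i))) = sets (PiM I (\<lambda>_. N))"
    using P'[OF \<theta>] by (intro sets_PiM_cong) auto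
next
  have P': "prob_space (P (\<theta> i)) \<and> sets (P (\<theta> i)) = sets N"
    if "\<theta> \<in> space (PiM I (\<lambda>_. S))" "i \<in> I" for \<theta> i
    using measurable_space[OF P, of "\<theta> i"] that
    by (auto simp: space_prob_algebra space_PiM PiE_iff)
  have box: "(\<lambda>\<theta>. emeasure (PiM I (\<lambda>i. P (\<theta> i))) (PiE I A)) \<in> borel_measurable (PiM I (\<lambda>_. S))"
    if A: "\<And>i. i \<in> I \<Longrightarrow> A i \<in> sets N" for A
  proof (rule measurable_cong[THEN iffD2])
    show "emeasure (PiM I (\<lambda>i. P (\<theta> i))) (PiE I A) = (\<Prod>i\<in>I. emeasure (P (\<theta> i)) (A i))"
      if "\<theta> \<in> space (PiM I (\<lambda>_. S))" for \<theta>
      using P'[OF that] A I by (intro emeasure_PiM_PiE) auto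
    have "(\<lambda>s. emeasure (P s) (A i)) \<in> borel_measurable S" if "i \<in> I" for i
      using measurable_compose[OF measurable_prob_algebraD[OF P]
          measurable_emeasure_subprob_algebra[OF A[OF that]]] .
    then show "(\<lambda>\<theta>. \<Prod>i\<in>I. emeasure (P (\<theta> i)) (A i)) \<in> borel_measurable (PiM I (\<lambda>_. S))"
      by (intro borel_measurable_prod_ennreal measurable_PiM_component_rev)
  qed
  show "(\<lambda>\<theta>. emeasure (PiM I (\<lambda>i. P (\<theta> i))) (\<Pi>\<^sub>E i\<in>I. space N)) \<in> borel_measurable (PiM I (\<lambda>_. S))"
    by (intro box) auto
  fix A assume "A \<in> prod_algebra I (\<lambda>_. N)"
  then show "(\<lambda>\<theta>. emeasure (PiM I (\<lambda>i. P (\<theta> i))) A) \<in> borel_measurable (PiM I (\<lambda>_. S))"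
    using box I by (auto simp: prod_algebra_eq_finite Pi_iff)
qed

text \<open>On boxes this is Fubini. It reduces the average over independent parameters to a testing
  problem between products of mixtures.\<close>

lemma bind_PiM_kernel:
  assumes I: "finite I" and P: "P \<in> S \<rightarrow>\<^sub>M prob_algebra N" and \<pi>: "\<pi> \<in> space (prob_algebra S)"
  shows "PiM I (\<lambda>_. \<pi>) \<bind> (\<lambda>\<theta>. PiM I (\<lambda>i. P (\<theta> i))) = PiM I (\<lambda>_. \<pi> \<bind> P)"
proof -
  have \<pi>p: "prob_space \<pi>" and s: "sets \<pi> = sets S" using \<pi> by (auto simp: space_prob_algebra)
  interpret \<pi>: prob_space \<pi> by fact
  interpret p: product_prob_space "\<lambda>_. \<pi>" by unfold_locales
  interpret L: prob_space "\<pi> \<bind> P" by (rule prob_space_bind'[OF \<pi> P])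
  interpret l: product_prob_space "\<lambda>_. \<pi> \<bind> P" by unfold_locales
  have sp: "space (PiM I (\<lambda>_. \<pi>)) = space (PiM I (\<lambda>_. S))"
    using sets_eq_imp_space_eq[OF s] by (simp add: space_PiM)
  have sPi: "sets (PiM I (\<lambda>_. \<pi>)) = sets (PiM I (\<lambda>_. S))" using s by (intro sets_PiM_cong) auto
  have K: "(\<lambda>\<theta>. PiM I (\<lambda>i. P (\<theta> i))) \<in> PiM I (\<lambda>_. \<pi>) \<rightarrow>\<^sub>M subprob_algebra (PiM I (\<lambda>_. N))"
    using measurable_PiM_kernel[OF I P] sPi by (simp cong: measurable_cong_sets)
  have P\<pi>: "P \<in> \<pi> \<rightarrow>\<^sub>M subprob_algebra N"
    using measurable_prob_algebraD[OF P] s by (simp cong: measurable_cong_sets)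
  have ne: "space (PiM I (\<lambda>_. \<pi>)) \<noteq> {}" by (rule prob_space.not_empty) (intro prob_space_PiM \<pi>p)
  have sN: "sets (\<pi> \<bind> P) = sets N" by (rule sets_bind'[OF \<pi> P])
  show ?thesis
  proof (rule l.PiM_eqI[OF I])
    show "sets (PiM I (\<lambda>_. \<pi>) \<bind> (\<lambda>\<theta>. PiM I (\<lambda>i. P (\<theta> i)))) = sets (PiM I (\<lambda>_. \<pi> \<bind> P))"
      unfolding sets_bind_measurable[OF K ne] using sN by (intro sets_PiM_cong) auto
    fix A assume "\<And>i. i \<in> I \<Longrightarrow> A i \<in> sets (\<pi> \<bind> P)"
    then have A: "\<And>i. i \<in> I \<Longrightarrow> A i \<in> sets N" using sN by simp
    have P': "prob_space (P (\<theta> i)) \<and> sets (P (\<theta> i)) = sets N"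
      if "\<theta> \<in> space (PiM I (\<lambda>_. S))" "i \<in> I" for \<theta> i
      using measurable_space[OF P, of "\<theta> i"] that
      by (auto simp: space_prob_algebra space_PiM PiE_iff)
    have "emeasure (PiM I (\<lambda>_. \<pi>) \<bind> (\<lambda>\<theta>. PiM I (\<lambda>i. P (\<theta> i)))) (PiE I A) =
        (\<integral>\<^sup>+\<theta>. emeasure (PiM I (\<lambda>i. P (\<theta> i))) (PiE I A) \<partial>PiM I (\<lambda>_. \<pi>))"
      using A I by (intro emeasure_bind[OF ne K]) auto
    also have "\<dots> = (\<integral>\<^sup>+\<theta>. (\<Prod>i\<in>I. emeasure (P (\<theta> i)) (A i)) \<partial>PiM I (\<lambda>_. \<pi>))"
      using P' A I sp by (intro nn_integral_cong emeasure_PiM_PiE) auto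
    also have "\<dots> = (\<Prod>i\<in>I. \<integral>\<^sup>+s. emeasure (P s) (A i) \<partial>\<pi>)"
      using I measurable_compose[OF P\<pi> measurable_emeasure_subprob_algebra] A
      by (intro p.product_nn_integral_prod) auto
    also have "\<dots> = (\<Prod>i\<in>I. emeasure (\<pi> \<bind> P) (A i))"
      using \<pi>.not_empty P\<pi> A by (intro prod.cong refl emeasure_bind[symmetric]) auto
    finally show "emeasure (PiM I (\<lambda>_. \<pi>) \<bind> (\<lambda>\<theta>. PiM I (\<lambda>i. P (\<theta> i)))) (PiE I A) =
        (\<Prod>i\<in>I. emeasure (\<pi> \<bind> P) (A i))" .
  qed
qed

subsection \<open>Chi-squared bounds for mixtures and products\<close>

text \<open>A common component contracts the divergence by the factor u. With k = dQ/dM, b = dB/dM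
  and E = D - 1 the new density is 1 + u k E, and u k \<le> 1 because u k + (1 - u) b = 1. Hence (u
  k E)^2 \<le> u k E^2, whose integral under M is u times that of E^2 under Q.\<close>

lemma chi2_mix_measure:
  assumes Q: "prob_space Q" and N: "prob_space N" and B: "prob_space B"
    and sets: "sets N = sets Q" "sets B = sets Q"
    and D: "D \<in> borel_measurable Q" "\<And>x. 0 \<le> D x" "N = density Q (\<lambda>x. ennreal (D x))"
    and sq: "integrable Q (\<lambda>x. (D x)\<^sup>2)" and u: "0 < u" "u < 1"
    and M: "M = mix_measure u Q B"
  obtains D' where "D' \<in> borel_measurable M" "\<And>x. 0 \<le> D' x"
    "mix_measure u N B = density M (\<lambda>x. ennreal (D' x))"
    "integrable M (\<lambda>x. (D' x)\<^sup>2)" "(\<integral>x. (D' x)\<^sup>2 \<partial>M) \<le> 1 + u * ((\<integral>x. (D x)\<^sup>2 \<partial>Q) - 1)"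
proof -
  interpret Q: prob_space Q by fact
  interpret N: prob_space N by fact
  interpret B: prob_space B by fact
  have sM: "sets M = sets Q" by (simp add: M)
  have eM: "emeasure M A = ennreal u * emeasure Q A + ennreal (1 - u) * emeasure B A"
    if "A \<in> sets Q" for A
    unfolding M using sets that by (intro emeasure_mix_measure) auto
  interpret M: prob_space M
  proof
    show "emeasure M (space M) = 1"
      using eM[of "space M"] sets_eq_imp_space_eq[OF sM] sets_eq_imp_space_eq[OF sets(2)] u
        Q.emeasure_space_1 B.emeasure_space_1 sM
      by (simp flip: ennreal_plus)
  qed
  have ac: "absolutely_continuous M Q" "absolutely_continuous M B"
    unfolding absolutely_continuous_def using eM sM sets u by (auto simp: null_sets_def)
  obtain k where k: "k \<in> borel_measurable M" "AE x in M. RN_deriv M Q x = ennreal (k x)" "\<And>x. 0 \<le> k x"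
    using M.real_RN_deriv[OF Q.finite_measure_axioms ac(1) sM[symmetric]] by metis
  obtain b where b: "b \<in> borel_measurable M" "AE x in M. RN_deriv M B x = ennreal (b x)" "\<And>x. 0 \<le> b x"
    using M.real_RN_deriv[OF B.finite_measure_axioms ac(2)] sM sets by metis
  note [measurable] = k(1) b(1)
  have eQ: "Q = density M (\<lambda>x. ennreal (k x))"
    using M.density_RN_deriv[OF ac(1)] sM density_cong[OF _ _ k(2)] by auto
  have eB: "B = density M (\<lambda>x. ennreal (b x))"
    using M.density_RN_deriv[OF ac(2)] sM sets density_cong[OF _ _ b(2)] by auto
  have [measurable]: "D \<in> borel_measurable M" using D(1) sM by (simp cong: measurable_cong_sets)
  have sum1: "AE x in M. u * k x + (1 - u) * b x = 1"
  proof -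
    have "density M (\<lambda>x. ennreal (u * k x + (1 - u) * b x)) = density M (\<lambda>x. ennreal 1)"
    proof (rule measure_eqI)
      fix A assume "A \<in> sets (density M (\<lambda>x. ennreal (u * k x + (1 - u) * b x)))"
      then have A[measurable]: "A \<in> sets M" by simp
      have "emeasure (density M (\<lambda>x. ennreal (u * k x + (1 - u) * b x))) A =
          (\<integral>\<^sup>+x. ennreal u * (ennreal (k x) * indicator A x) + ennreal (1 - u) * (ennreal (b x) * indicator A x) \<partial>M)"
        using u k(3) b(3)
        by (subst emeasure_density) (auto intro!: nn_integral_cong simp: ennreal_mult distrib_right mult.assoc)
      also have "\<dots> = ennreal u * emeasure (density M (\<lambda>x. ennreal (k x))) A +
          ennreal (1 - u) * emeasure (density M (\<lambda>x. ennreal (b x))) A"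
        by (simp add: nn_integral_add nn_integral_cmult emeasure_density)
      also have "\<dots> = emeasure M A" using eM[of A] A sM by (simp flip: eQ eB)
      also have "\<dots> = emeasure (density M (\<lambda>x. ennreal 1)) A" by (simp add: density_1)
      finally show "emeasure (density M (\<lambda>x. ennreal (u * k x + (1 - u) * b x))) A = \<dots>" .
    qed simp
    then have "AE x in M. ennreal (u * k x + (1 - u) * b x) = ennreal 1"
      by (intro M.density_unique) auto
    then show ?thesis
    proof eventually_elim
      fix x assume "ennreal (u * k x + (1 - u) * b x) = ennreal 1"
      moreover have "0 \<le> u * k x + (1 - u) * b x" using u k(3) b(3) by simp
      ultimately show "u * k x + (1 - u) * b x = 1" by (simp only: ennreal_inj zero_le_one)
    qed
  qed
  define D' where "D' x = u * (k x * D x) + (1 - u) * b x" for x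
  have D'm: "D' \<in> borel_measurable M" unfolding D'_def by measurable
  have D'0: "0 \<le> D' x" for x using u k(3) b(3) D(2) by (simp add: D'_def)
  have eq: "mix_measure u N B = density M (\<lambda>x. ennreal (D' x))"
  proof (rule measure_eqI)
    show "sets (mix_measure u N B) = sets (density M (\<lambda>x. ennreal (D' x)))" using sets sM by simp
    fix A assume "A \<in> sets (mix_measure u N B)"
    then have A[measurable]: "A \<in> sets M" and AN: "A \<in> sets N" and AQ: "A \<in> sets Q" using sets sM by auto
    have N': "emeasure N A = (\<integral>\<^sup>+x. ennreal (k x) * (ennreal (D x) * indicator A x) \<partial>M)"
    proof -
      have "emeasure N A = (\<integral>\<^sup>+x. ennreal (D x) * indicator A x \<partial>Q)"
        unfolding D(3) using D(1) AQ by (subst emeasure_density) auto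
      also have "\<dots> = (\<integral>\<^sup>+x. ennreal (k x) * (ennreal (D x) * indicator A x) \<partial>M)"
        by (subst eQ) (simp add: nn_integral_density)
      finally show ?thesis .
    qed
    have "emeasure (density M (\<lambda>x. ennreal (D' x))) A =
        (\<integral>\<^sup>+x. ennreal u * (ennreal (k x) * (ennreal (D x) * indicator A x)) +
          ennreal (1 - u) * (ennreal (b x) * indicator A x) \<partial>M)"
      using u k(3) b(3) D(2)
      by (subst emeasure_density)
        (auto intro!: nn_integral_cong D'm simp: D'_def ennreal_mult distrib_right mult.assoc)
    also have "\<dots> = ennreal u * emeasure N A + ennreal (1 - u) * emeasure B A"
      by (subst eB) (simp add: nn_integral_add nn_integral_cmult emeasure_density N')
    also have "\<dots> = emeasure (mix_measure u N B) A"
      using sets AN by (simp add: emeasure_mix_measure)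
    finally show "emeasure (mix_measure u N B) A = emeasure (density M (\<lambda>x. ennreal (D' x))) A" ..
  qed
  define E where "E x = D x - 1" for x
  note D1 = integral_density_eq_1[OF N D]
  have E2: "(E x)\<^sup>2 = (D x)\<^sup>2 - 2 * D x + 1" for x by (simp add: E_def power2_eq_square algebra_simps)
  have E: "integrable Q E" "integrable Q (\<lambda>x. (E x)\<^sup>2)" "(\<integral>x. E x \<partial>Q) = 0"
    "(\<integral>x. (E x)\<^sup>2 \<partial>Q) = (\<integral>x. (D x)\<^sup>2 \<partial>Q) - 1"
    unfolding E2 using D1 sq by (simp_all add: E_def[abs_def] Q.prob_space)
  have [measurable]: "E \<in> borel_measurable M" unfolding E_def by measurable
  have tr: "integrable M (\<lambda>x. k x * f x)" "(\<integral>x. k x * f x \<partial>M) = (\<integral>x. f x \<partial>Q)"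
    if "integrable Q f" "f \<in> borel_measurable M" for f :: "_ \<Rightarrow> real"
  proof -
    show "integrable M (\<lambda>x. k x * f x)"
      using that k(3) integrable_density[of f M k] eQ by simp
    show "(\<integral>x. k x * f x \<partial>M) = (\<integral>x. f x \<partial>Q)"
      using that k(3) integral_density[of f M k] eQ by simp
  qed
  note trE = tr[OF E(1)] and trE2 = tr[OF E(2)]
  have D'E: "AE x in M. D' x = 1 + u * (k x * E x)"
    using sum1 by eventually_elim (simp add: D'_def E_def algebra_simps)
  have "AE x in M. (D' x)\<^sup>2 \<le> 1 + 2 * u * (k x * E x) + u * (k x * (E x)\<^sup>2)"
    using sum1 D'E
  proof eventually_elim
    fix x assume 1: "u * k x + (1 - u) * b x = 1" and 2: "D' x = 1 + u * (k x * E x)"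
    have uk: "u * k x \<le> 1" "0 \<le> u * k x"
      using 1 u b(3)[of x] k(3)[of x] by (smt (verit) mult_nonneg_nonneg, simp)
    have "(u * k x) * (u * k x) \<le> u * k x" using uk by (intro mult_left_le_one_le) auto
    then have "(u * k x) * (u * k x) * (E x)\<^sup>2 \<le> u * k x * (E x)\<^sup>2" by (rule mult_right_mono) simp
    then show "(D' x)\<^sup>2 \<le> 1 + 2 * u * (k x * E x) + u * (k x * (E x)\<^sup>2)"
      unfolding 2 by (simp add: power2_eq_square algebra_simps)
  qed
  moreover have i: "integrable M (\<lambda>x. 1 + 2 * u * (k x * E x) + u * (k x * (E x)\<^sup>2))"
    using trE trE2 by auto
  ultimately have sq': "integrable M (\<lambda>x. (D' x)\<^sup>2)"
    using D'm by (intro Bochner_Integration.integrable_bound[OF i]) auto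
  have "(\<integral>x. (D' x)\<^sup>2 \<partial>M) \<le> (\<integral>x. 1 + 2 * u * (k x * E x) + u * (k x * (E x)\<^sup>2) \<partial>M)"
    by (intro integral_mono_AE sq' i) fact
  also have "\<dots> = 1 + u * ((\<integral>x. (D x)\<^sup>2 \<partial>Q) - 1)"
    using trE trE2 E by (simp add: M.prob_space)
  finally show ?thesis using that D'm D'0 eq sq' by blast
qed

text \<open>The density of the products is the product of the densities, so one plus the divergence
  is multiplicative. Cauchy-Schwarz is applied to the centred density and the indicator of
  \<open>A\<close> minus 1/2; the latter has absolute value 1/2 everywhere, whence the division by
  2.\<close>

lemma measure_PiM_diff_le:
  assumes I: "finite I" and Q: "prob_space Q" and N: "prob_space N"
    and D: "D \<in> borel_measurable Q" "\<And>x. 0 \<le> D x" "N = density Q (\<lambda>x. ennreal (D x))"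
    and sq: "integrable Q (\<lambda>x. (D x)\<^sup>2)" and A: "A \<in> sets (PiM I (\<lambda>_. Q))"
  shows "\<bar>measure (PiM I (\<lambda>_. N)) A - measure (PiM I (\<lambda>_. Q)) A\<bar> \<le>
    sqrt ((\<integral>x. (D x)\<^sup>2 \<partial>Q) ^ card I - 1) / 2"
proof -
  interpret Q: prob_space Q by fact
  interpret N: prob_space N by fact
  let ?Q = "PiM I (\<lambda>_. Q)" and ?N = "PiM I (\<lambda>_. N)"
  interpret PQ: prob_space ?Q by (intro prob_space_PiM Q)
  interpret PN: prob_space ?N by (intro prob_space_PiM N)
  interpret q: product_prob_space "\<lambda>_. Q" by unfold_locales
  interpret n: product_prob_space "\<lambda>_. N" by unfold_locales
  define E where "E x = (\<Prod>i\<in>I. D (x i))" for x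
  note [measurable] = D(1) and A[measurable]
  have Em[measurable]: "E \<in> borel_measurable ?Q"
    unfolding E_def by (intro borel_measurable_prod) (auto intro!: measurable_PiM_component_rev D(1))
  have E0: "0 \<le> E x" for x using D(2) by (simp add: E_def prod_nonneg)
  have eq: "?N = density ?Q (\<lambda>x. ennreal (E x))"
  proof (rule n.PiM_eqI[OF I, symmetric])
    show "sets (density ?Q (\<lambda>x. ennreal (E x))) = sets ?N"
      using D(3) by (simp cong: sets_PiM_cong)
    fix B assume "\<And>i. i \<in> I \<Longrightarrow> B i \<in> sets N"
    then have B: "\<And>i. i \<in> I \<Longrightarrow> B i \<in> sets Q" using D(3) by simp
    have "emeasure (density ?Q (\<lambda>x. ennreal (E x))) (PiE I B) =
        (\<integral>\<^sup>+x. (\<Prod>i\<in>I. ennreal (D (x i)) * indicator (B i) (x i)) \<partial>?Q)"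
    proof (subst emeasure_density)
      show "PiE I B \<in> sets ?Q" using B I by auto
      show "(\<integral>\<^sup>+x. ennreal (E x) * indicator (PiE I B) x \<partial>?Q) =
          (\<integral>\<^sup>+x. (\<Prod>i\<in>I. ennreal (D (x i)) * indicator (B i) (x i)) \<partial>?Q)"
      proof (rule nn_integral_cong)
        fix x assume x: "x \<in> space ?Q"
        have "(\<Prod>i\<in>I. indicator (B i) (x i) :: ennreal) = indicator (PiE I B) x"
          using I x by (auto simp: indicator_def PiE_iff space_PiM prod_eq_1_iff prod_zero_iff split: if_splits)
        then show "ennreal (E x) * indicator (PiE I B) x =
            (\<Prod>i\<in>I. ennreal (D (x i)) * indicator (B i) (x i))"
          using D(2) by (simp add: prod.distrib E_def prod_ennreal)
      qed
    qed simp
    also have "\<dots> = (\<Prod>i\<in>I. \<integral>\<^sup>+y. ennreal (D y) * indicator (B i) y \<partial>Q)"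
      using B by (intro q.product_nn_integral_prod I) auto
    also have "\<dots> = (\<Prod>i\<in>I. emeasure N (B i))"
      using B unfolding D(3) by (intro prod.cong) (auto simp: emeasure_density)
    finally show "emeasure (density ?Q (\<lambda>x. ennreal (E x))) (PiE I B) = (\<Prod>i\<in>I. emeasure N (B i))" .
  qed
  have E2: "(\<lambda>x. (E x)\<^sup>2) = (\<lambda>x. \<Prod>i\<in>I. (D (x i))\<^sup>2)" by (simp add: E_def prod_power_distrib)
  have sqE: "integrable ?Q (\<lambda>x. (E x)\<^sup>2)"
    unfolding E2 using sq by (intro q.product_integrable_prod I)
  have iE2: "(\<integral>x. (E x)\<^sup>2 \<partial>?Q) = (\<integral>x. (D x)\<^sup>2 \<partial>Q) ^ card I"
    unfolding E2 using sq I by (subst q.product_integral_prod) auto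
  have EL: "E \<in> L2_functions ?Q" using sqE by (simp add: L2_functions_def)
  note E1 = integral_density_eq_1[OF PN.prob_space_axioms Em E0 eq]
  let ?f = "\<lambda>x. 1 * E x + (- 1) * 1" and ?g = "\<lambda>x. 1 * indicator A x + (- 1 / 2) * 1 :: real"
  have IL: "(\<lambda>x. indicator A x :: real) \<in> L2_functions ?Q"
    by (auto simp: L2_functions_def indicator_def power2_eq_square if_distrib cong: if_cong
        intro!: PQ.integrable_const_bound[where B = 1])
  have fL: "?f \<in> L2_functions ?Q" and gL: "?g \<in> L2_functions ?Q"
    by (intro L2_functions_lincomb EL IL PQ.const_L2_functions)+
  have "measure ?N A = (\<integral>x. indicator A x \<partial>?N)"
    using D(3) A PN.emeasure_finite[of A] by (simp add: cong: sets_PiM_cong)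
  also have "\<dots> = (\<integral>x. E x * indicator A x \<partial>?Q)"
    unfolding eq using E0 by (subst integral_density) auto
  finally have NA: "measure ?N A = (\<integral>x. E x * indicator A x \<partial>?Q)" .
  have iEA: "integrable ?Q (\<lambda>x. E x * indicator A x)"
    by (rule L2_functions_mult_integrable[OF EL IL])
  have "(\<integral>x. ?f x * ?g x \<partial>?Q) =
      (\<integral>x. E x * indicator A x - indicator A x - (1 / 2) * E x + 1 / 2 \<partial>?Q)"
    by (intro Bochner_Integration.integral_cong) (auto simp: field_simps)
  also have "\<dots> = measure ?N A - measure ?Q A"
    using iEA E1 PQ.L2_functions_integrable[OF IL] by (simp add: NA PQ.prob_space)
  finally have "\<bar>measure ?N A - measure ?Q A\<bar> \<le> L2_norm ?Q ?f * L2_norm ?Q ?g"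
    using L2_Cauchy_Schwarz[OF fL gL] by simp
  moreover have "L2_norm ?Q ?g = 1 / 2"
  proof -
    have "(\<lambda>x. (?g x)\<^sup>2) = (\<lambda>x. 1 / 4)" by (auto simp: indicator_def power2_eq_square)
    then show ?thesis by (simp add: L2_norm_def PQ.prob_space real_sqrt_divide del: add_uminus_conv_diff)
  qed
  moreover have "L2_norm ?Q ?f = sqrt ((\<integral>x. (D x)\<^sup>2 \<partial>Q) ^ card I - 1)"
    unfolding L2_norm_def integral_square_lincomb[OF EL PQ.const_L2_functions[of 1]]
    using E1 by (simp add: iE2 PQ.prob_space)
  ultimately show ?thesis by (simp only: times_divide_eq_right mult_1_right)
qed

subsection \<open>Risk of linear estimators\<close>

context compact_experiment
begin

lemma kernel_prob:
  assumes "s \<in> space \<Theta>"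
  shows "prob_space (P s)" "sets (P s) = sets \<X>"
  using measurable_space[OF kernel assms] by (auto simp: space_prob_algebra)

lemma sets_empirical_measure: "sets (empirical_measure \<Theta> n \<theta>) = sets \<Theta>"
  by (simp add: empirical_measure_def sets.sets_measure_of_eq)

lemma nn_integral_empirical_law:
  assumes n: "0 < n" and \<theta>: "\<theta> \<in> {..<n} \<rightarrow> space \<Theta>" and f: "f \<in> borel_measurable \<X>"
  shows "(\<integral>\<^sup>+x. f x \<partial>law (empirical_measure \<Theta> n \<theta>)) =
    ennreal (1 / real n) * (\<Sum>i<n. \<integral>\<^sup>+x. f x \<partial>P (\<theta> i))"
proof -
  have P: "P \<in> \<Theta> \<rightarrow>\<^sub>M subprob_algebra \<X>" using measurable_prob_algebraD[OF kernel] .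
  then have P': "P \<in> empirical_measure \<Theta> n \<theta> \<rightarrow>\<^sub>M subprob_algebra \<X>"
    using sets_empirical_measure[of n \<theta>] by (simp cong: measurable_cong_sets)
  have k: "(\<lambda>s. \<integral>\<^sup>+x. f x \<partial>P s) \<in> borel_measurable \<Theta>"
    using measurable_compose[OF P nn_integral_measurable_subprob_algebra[OF f]] .
  have m: "\<theta> \<in> uniform_count_measure {..<n} \<rightarrow>\<^sub>M \<Theta>"
    using \<theta> by (auto simp: measurable_def sets_uniform_count_measure space_uniform_count_measure)
  have "(\<integral>\<^sup>+x. f x \<partial>law (empirical_measure \<Theta> n \<theta>)) =
      (\<integral>\<^sup>+s. \<integral>\<^sup>+x. f x \<partial>P s \<partial>empirical_measure \<Theta> n \<theta>)"
    by (rule nn_integral_bind[OF f P'])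
  also have "\<dots> = (\<integral>\<^sup>+i. \<integral>\<^sup>+x. f x \<partial>P (\<theta> i) \<partial>uniform_count_measure {..<n})"
    unfolding empirical_measure_eq_distr[OF n \<theta>] by (rule nn_integral_distr[OF m]) (simp add: k)
  also have "\<dots> = (\<Sum>i<n. ennreal (1 / real n) * (\<integral>\<^sup>+x. f x \<partial>P (\<theta> i)))"
    unfolding uniform_count_measure_def by (subst nn_integral_point_measure_finite) (auto simp: mult.commute)
  finally show ?thesis by (simp add: sum_distrib_left)
qed

lemma
  fixes f :: "'b \<Rightarrow> real"
  assumes n: "0 < n" and \<theta>: "\<theta> \<in> {..<n} \<rightarrow> space \<Theta>" and \<pi>: "empirical_measure \<Theta> n \<theta> \<in> priors"
    and f: "integrable (law (empirical_measure \<Theta> n \<theta>)) f"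
  shows integrable_empirical_component: "i < n \<Longrightarrow> integrable (P (\<theta> i)) f"
    and mean_empirical: "mean (empirical_measure \<Theta> n \<theta>) f = (\<Sum>i<n. \<integral>x. f x \<partial>P (\<theta> i)) / real n"
proof -
  let ?\<pi> = "empirical_measure \<Theta> n \<theta>"
  have fX: "f \<in> borel_measurable \<X>"
    using borel_measurable_integrable[OF f] sets_law[OF \<pi>] by (simp cong: measurable_cong_sets)
  have fP: "f \<in> borel_measurable (P (\<theta> i))" if "i < n" for i
  proof -
    have "sets (P (\<theta> i)) = sets \<X>" using kernel_prob(2) \<theta> that by auto
    then show ?thesis using fX by (simp cong: measurable_cong_sets)
  qed
  have int: "integrable (P (\<theta> i)) f" if "i < n" for i
  proof -
    have "(\<integral>\<^sup>+x. ennreal \<bar>f x\<bar> \<partial>law ?\<pi>) < \<infinity>"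
      using f by (simp add: integrable_iff_bounded)
    then have "(\<Sum>i<n. \<integral>\<^sup>+x. ennreal \<bar>f x\<bar> \<partial>P (\<theta> i)) < \<infinity>"
      using n fX by (auto simp: nn_integral_empirical_law[OF n \<theta>] ennreal_mult_less_top)
    then show ?thesis
      using that fP[OF that] by (simp add: integrable_iff_bounded)
  qed
  then show "i < n \<Longrightarrow> integrable (P (\<theta> i)) f" .
  \<comment> \<open>The formula for extended integrals transfers only to nonnegative functions;
    \<open>f\<close> is afterwards the difference of f + |f| and |f|.\<close>
  have pos: "mean ?\<pi> k = (\<Sum>i<n. \<integral>x. k x \<partial>P (\<theta> i)) / real n"
    if k: "integrable (law ?\<pi>) k" "\<And>x. 0 \<le> k x" "\<And>i. i < n \<Longrightarrow> integrable (P (\<theta> i)) k"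
    for k :: "'b \<Rightarrow> real"
  proof -
    have kX: "k \<in> borel_measurable \<X>"
      using borel_measurable_integrable[OF k(1)] sets_law[OF \<pi>] by (simp cong: measurable_cong_sets)
    have "ennreal (mean ?\<pi> k) = (\<integral>\<^sup>+x. ennreal (k x) \<partial>law ?\<pi>)"
      using k by (simp add: nn_integral_eq_integral)
    also have "\<dots> = ennreal (1 / real n) * (\<Sum>i<n. \<integral>\<^sup>+x. ennreal (k x) \<partial>P (\<theta> i))"
      using kX by (intro nn_integral_empirical_law[OF n \<theta>]) simp
    also have "\<dots> = ennreal (1 / real n) * (\<Sum>i<n. ennreal (\<integral>x. k x \<partial>P (\<theta> i)))"
      using k by (simp add: nn_integral_eq_integral)
    also have "\<dots> = ennreal ((\<Sum>i<n. \<integral>x. k x \<partial>P (\<theta> i)) / real n)"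
      using k by (simp add: sum_ennreal ennreal_mult[symmetric] sum_nonneg)
    finally show ?thesis
      using k by (subst (asm) ennreal_inj) (auto intro!: divide_nonneg_nonneg sum_nonneg)
  qed
  have "mean ?\<pi> (\<lambda>x. f x + \<bar>f x\<bar>) = (\<Sum>i<n. \<integral>x. f x + \<bar>f x\<bar> \<partial>P (\<theta> i)) / real n"
    using f int by (intro pos) auto
  moreover have "mean ?\<pi> (\<lambda>x. \<bar>f x\<bar>) = (\<Sum>i<n. \<integral>x. \<bar>f x\<bar> \<partial>P (\<theta> i)) / real n"
    using f int by (intro pos) auto
  ultimately show "mean ?\<pi> f = (\<Sum>i<n. \<integral>x. f x \<partial>P (\<theta> i)) / real n"
    using f int by (simp add: sum.distrib add_divide_distrib)
qed

text \<open>For fixed parameters n times the variance is the average of the component variances. The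
  variance under the mixture contains in addition the spread of the component means, so it is at
  least as large.\<close>

lemma quadratic_risk_linear_le:
  assumes n: "0 < n" and \<theta>: "\<theta> \<in> parameter_vectors \<Theta> c n" and g: "g \<in> F"
    and \<pi>: "\<pi> = empirical_measure \<Theta> n \<theta>"
  shows "quadratic_risk \<Theta> P h n (\<lambda>x. (1 / real n) * (\<Sum>i<n. g (x i))) \<theta> \<le>
    ennreal ((T \<pi> - mean \<pi> g)\<^sup>2 + (1 / sqrt (real n) * sd \<pi> g)\<^sup>2)"
proof -
  have \<theta>': "\<theta> \<in> {..<n} \<rightarrow> space \<Theta>" and p: "empirical_measure \<Theta> n \<theta> \<in> priors"
    using \<theta> by (auto simp: parameter_vectors_def)
  have p': "\<pi> \<in> priors" using p \<pi> by simp
  have prob: "prob_space (P (\<theta> i))" if "i < n" for i using kernel_prob \<theta>' that by auto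
  have L: "g \<in> L2_functions (law \<pi>)" by (rule F_L2[OF g p'])
  have i1: "integrable (law (empirical_measure \<Theta> n \<theta>)) g"
    and i2: "integrable (law (empirical_measure \<Theta> n \<theta>)) (\<lambda>x. (g x)\<^sup>2)"
    using L F_integrable[OF g p] by (auto simp: L2_functions_def \<pi>)
  note c1 = integrable_empirical_component[OF n \<theta>' p i1]
  note c2 = integrable_empirical_component[OF n \<theta>' p i2]
  note m1 = mean_empirical[OF n \<theta>' p i1, folded \<pi>]
  note m2 = mean_empirical[OF n \<theta>' p i2, folded \<pi>]
  have Li: "g \<in> L2_functions (P (\<theta> i))" if "i < n" for i
    using c1[OF that] c2[OF that] by (auto simp: L2_functions_def)
  define a where "a i = (\<integral>x. g x \<partial>P (\<theta> i))" for i
  define b where "b i = (\<integral>x. (g x)\<^sup>2 \<partial>P (\<theta> i))" for i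
  have sd: "(std_dev (P (\<theta> i)) (\<lambda>y. 1 / real n * g y))\<^sup>2 = (b i - (a i)\<^sup>2) / (real n)\<^sup>2" if "i < n" for i
    using prob_space.std_dev_add_const[OF prob[OF that] Li[OF that], of "1 / real n" 0]
      prob_space.std_dev_power2[OF prob[OF that] Li[OF that]]
    by (simp add: power_mult_distrib power_divide a_def b_def)
  have "quadratic_risk \<Theta> P h n (\<lambda>x. (1 / real n) * (\<Sum>i<n. g (x i))) \<theta> =
      (\<integral>\<^sup>+x. ennreal (((\<Sum>i<n. 1 / real n * g (x i)) - T \<pi>)\<^sup>2) \<partial>PiM {..<n} (\<lambda>i. P (\<theta> i)))"
    by (simp add: quadratic_risk_def \<pi> sum_distrib_left)
  also have "\<dots> = ennreal (((\<Sum>i<n. \<integral>y. 1 / real n * g y \<partial>P (\<theta> i)) - T \<pi>)\<^sup>2 +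
      (\<Sum>i<n. (std_dev (P (\<theta> i)) (\<lambda>y. 1 / real n * g y))\<^sup>2))"
  proof (rule nn_integral_PiM_sum_square)
    show "(\<lambda>y. 1 / real n * g y) \<in> L2_functions (P (\<theta> i))" if "i \<in> {..<n}" for i
      using L2_functions_lincomb[OF Li[of i] Li[of i], of "1 / real n" 0] that by simp
  qed (use prob in auto)
  also have "(\<Sum>i<n. \<integral>y. 1 / real n * g y \<partial>P (\<theta> i)) = mean \<pi> g"
    by (simp add: m1 sum_divide_distrib)
  also have "(\<Sum>i<n. (std_dev (P (\<theta> i)) (\<lambda>y. 1 / real n * g y))\<^sup>2) =
      (\<Sum>i<n. (b i - (a i)\<^sup>2) / (real n)\<^sup>2)"
    by (intro sum.cong refl sd) simp
  also have "\<dots> = ((\<Sum>i<n. b i) - (\<Sum>i<n. (a i)\<^sup>2)) / (real n)\<^sup>2"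
    by (simp add: sum_subtractf flip: sum_divide_distrib)
  also have "\<dots> \<le> (1 / sqrt (real n) * sd \<pi> g)\<^sup>2"
  proof -
    have "(\<Sum>i<n. a i)\<^sup>2 \<le> real n * (\<Sum>i<n. (a i)\<^sup>2)"
      using sum_squared_le_sum_of_squares[of a "{..<n}"] by (simp add: mult.commute)
    then have "((\<Sum>i<n. a i) / real n)\<^sup>2 \<le> (\<Sum>i<n. (a i)\<^sup>2) / real n"
      using n by (simp add: power_divide power2_eq_square field_simps)
    then have "((\<Sum>i<n. b i) / real n - (\<Sum>i<n. (a i)\<^sup>2) / real n) / real n \<le> (sd \<pi> g)\<^sup>2 / real n"
      unfolding sd_power2[OF g p'] m1 m2 a_def[symmetric] b_def[symmetric]
      by (intro divide_right_mono) auto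
    then show ?thesis
      by (simp add: power_mult_distrib power_divide power2_eq_square diff_divide_distrib)
  qed
  finally show ?thesis by (simp add: power2_commute[of "mean \<pi> g"] ennreal_leI)
qed

lemma linear_estimator_measurable:
  assumes "g \<in> borel_measurable \<X>"
  shows "(\<lambda>x. (1 / real n) * (\<Sum>i<n. g (x i))) \<in> estimators \<X> n"
  unfolding estimators_def
  by (intro borel_measurable_times borel_measurable_const borel_measurable_sum
      measurable_PiM_component_rev assms)

lemma linear_estimator_upper_bound:
  assumes n: "1 \<le> n"
  shows "\<exists>g\<in>F. (\<lambda>x. (1 / real n) * (\<Sum>i<n. g (x i))) \<in> estimators \<X> n \<and>
    enn2ereal (worst_case_risk \<Theta> P c h n (\<lambda>x. (1 / real n) * (\<Sum>i<n. g (x i))))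
      \<le> (chi2_modulus \<Theta> P c h (1 / sqrt (real n)))\<^sup>2"
proof (cases "priors = {}")
  case True
  then have "parameter_vectors \<Theta> c n = {}" by (auto simp: parameter_vectors_def)
  \<comment> \<open>Without priors the supremum is minus infinity, whose square is plus infinity, so
    the bound is trivial.\<close>
  moreover have "(chi2_modulus \<Theta> P c h (1 / sqrt (real n)))\<^sup>2 = \<infinity>"
    using True by (simp add: chi2_modulus_def bot_ereal_def power2_eq_square)
  ultimately show ?thesis
    using const_F[of 0] linear_estimator_measurable[of "\<lambda>x. 0" n]
    by (intro bexI[of _ "\<lambda>x. 0"]) (auto simp: worst_case_risk_def)
next
  case False
  let ?t = "1 / sqrt (real n)"
  obtain g where g: "g \<in> F"
    and le: "\<And>\<pi>. \<pi> \<in> priors \<Longrightarrow> (T \<pi> - mean \<pi> g)\<^sup>2 + (?t * sd \<pi> g)\<^sup>2 \<le> (modulus ?t)\<^sup>2"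
    using optimal_linear_estimator[OF False, of ?t] n by auto
  obtain \<pi> where \<pi>: "\<pi> \<in> priors" using False by blast
  have "g \<in> borel_measurable \<X>"
    using F_L2[OF g \<pi>] sets_law[OF \<pi>] by (simp add: L2_functions_def cong: measurable_cong_sets)
  then have e: "(\<lambda>x. (1 / real n) * (\<Sum>i<n. g (x i))) \<in> estimators \<X> n"
    by (rule linear_estimator_measurable)
  have "worst_case_risk \<Theta> P c h n (\<lambda>x. (1 / real n) * (\<Sum>i<n. g (x i))) \<le> ennreal ((modulus ?t)\<^sup>2)"
    unfolding worst_case_risk_def
  proof (rule SUP_least)
    fix \<theta> assume \<theta>: "\<theta> \<in> parameter_vectors \<Theta> c n"
    then have p: "empirical_measure \<Theta> n \<theta> \<in> priors" by (simp add: parameter_vectors_def)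
    show "quadratic_risk \<Theta> P h n (\<lambda>x. (1 / real n) * (\<Sum>i<n. g (x i))) \<theta> \<le> ennreal ((modulus ?t)\<^sup>2)"
      using n by (intro order_trans[OF quadratic_risk_linear_le[OF _ \<theta> g refl] ennreal_leI[OF le[OF p]]]) simp
  qed
  then have "enn2ereal (worst_case_risk \<Theta> P c h n (\<lambda>x. (1 / real n) * (\<Sum>i<n. g (x i)))) \<le>
      enn2ereal (ennreal ((modulus ?t)\<^sup>2))"
    by (simp add: less_eq_ennreal.rep_eq)
  also have "\<dots> = (chi2_modulus \<Theta> P c h ?t)\<^sup>2"
    by (simp add: chi2_modulus_eq[OF False])
  finally show ?thesis using g e by blast
qed

end

subsection \<open>The lower bound\<close>

text \<open>\<open>target\<close> is a mere default value as long as integrability is open, but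
  square integrability of \<open>h\<close> minus any constant passes to \<open>h\<close>, after
  which the variance is the usual one.\<close>

lemma L2_functions_of_prior_variance:
  assumes "prob_space \<pi>" and h: "h \<in> borel_measurable \<pi>" and fin: "prior_variance h \<pi> < \<infinity>"
  shows "h \<in> L2_functions \<pi>" "prior_variance h \<pi> = ennreal ((std_dev \<pi> h)\<^sup>2)"
proof -
  interpret prob_space \<pi> by fact
  have "(\<lambda>x. h x - target h \<pi>) \<in> L2_functions \<pi>"
    using fin h by (auto simp: L2_functions_def prior_variance_def integrable_iff_bounded)
  from L2_functions_lincomb[OF this const_L2_functions[of "target h \<pi>"], of 1 1]
  show L: "h \<in> L2_functions \<pi>" by simp
  show "prior_variance h \<pi> = ennreal ((std_dev \<pi> h)\<^sup>2)"
    using nn_integral_shift_square[OF L, of "- target h \<pi>"] by (simp add: prior_variance_def target_def)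
qed

context compact_experiment
begin

context
  fixes \<theta>\<^sub>0 :: 'a
  assumes c_nonneg: "\<And>s. s \<in> space \<Theta> \<Longrightarrow> 0 \<le> c s"
    and \<theta>0: "\<theta>\<^sub>0 \<in> space \<Theta>" "c \<theta>\<^sub>0 = 0"
    and max_var: "max_prior_variance \<Theta> c h < \<infinity>"
begin

lemma return_in_priors: "return \<Theta> \<theta>\<^sub>0 \<in> priors"
  using \<theta>0 c_measurable prob_space_return[OF \<theta>0(1)]
  by (auto simp: prior_set_def space_prob_algebra integral_return
      integrable_iff_bounded nn_integral_return)

text \<open>The point mass adds nothing to the mean of \<open>c\<close>, which drops to at most 1/4.
  This slack is what lets independent draws meet the constraint with good probability.\<close>

abbreviation diluted :: "'a measure \<Rightarrow> 'a measure" where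
  "diluted \<pi> \<equiv> mix_measure (1 / 4) \<pi> (return \<Theta> \<theta>\<^sub>0)"

lemma diluted_in_priors: "\<pi> \<in> priors \<Longrightarrow> diluted \<pi> \<in> priors"
  by (intro mix_in_priors return_in_priors) auto

lemma nn_integral_constraint_diluted:
  assumes \<pi>: "\<pi> \<in> priors"
  shows "(\<integral>\<^sup>+s. ennreal (c s) \<partial>diluted \<pi>) \<le> ennreal (1 / 4)"
proof -
  have s: "sets \<pi> = sets \<Theta>" by (rule sets_prior[OF \<pi>])
  have cm: "(\<lambda>s. ennreal (c s)) \<in> borel_measurable \<pi>"
    using c_measurable s by (simp cong: measurable_cong_sets)
  have i: "integrable \<pi> c" "(\<integral>s. c s \<partial>\<pi>) \<le> 1" using \<pi> by (auto simp: prior_set_def)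
  have "AE s in \<pi>. 0 \<le> c s"
    using c_nonneg sets_eq_imp_space_eq[OF s] by (intro AE_I2) auto
  then have "(\<integral>\<^sup>+s. ennreal (c s) \<partial>\<pi>) = ennreal (\<integral>s. c s \<partial>\<pi>)"
    by (intro nn_integral_eq_integral i)
  also have "\<dots> \<le> ennreal 1" by (intro ennreal_leI i)
  finally have "(\<integral>\<^sup>+s. ennreal (c s) \<partial>\<pi>) \<le> 1" by simp
  moreover have "(\<integral>\<^sup>+s. ennreal (c s) \<partial>return \<Theta> \<theta>\<^sub>0) = 0"
    using \<theta>0 c_measurable by (simp add: nn_integral_return)
  ultimately show ?thesis
    using s cm by (subst nn_integral_mix_measure) (auto intro: mult_left_le)
qed

text \<open>
  The integrated risk over the diluted prior, where parameters violating the constraint are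
  charged to the average of \<open>c\<close> (Markov), and \<open>|x + y|\<^sup>2 \<le> 3 |x|\<^sup>2 + (3 / 2) |y|\<^sup>2\<close> separates the
  fluctuation of the target.
\<close>

lemma testing_error_le_risk:
  assumes n: "1 \<le> n" and \<pi>: "\<pi> \<in> priors" and B: "B \<in> sets (PiM {..<n} (\<lambda>_. \<X>))"
    and Th: "Th \<in> estimators \<X> n" and R: "0 \<le> R"
    and risk: "\<And>\<theta>. \<theta> \<in> parameter_vectors \<Theta> c n \<Longrightarrow> quadratic_risk \<Theta> P h n Th \<theta> \<le> ennreal R"
    and far: "\<And>x. x \<in> B \<Longrightarrow> L \<le> \<bar>Th x - T (diluted \<pi>)\<bar>" and L: "0 \<le> L"
  shows "L\<^sup>2 * measure (PiM {..<n} (\<lambda>_. law (diluted \<pi>))) B \<le>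
    3 * R + 3 / 2 * (enn2real (max_prior_variance \<Theta> c h) / real n) + L\<^sup>2 / 4"
proof -
  let ?I = "{..<n}" and ?\<rho> = "diluted \<pi>"
  let ?K = "\<lambda>\<theta>. PiM ?I (\<lambda>i. P (\<theta> i))"
  let ?V = "enn2real (max_prior_variance \<Theta> c h)"
  have \<rho>: "?\<rho> \<in> priors" by (rule diluted_in_priors[OF \<pi>])
  interpret \<rho>: prob_space ?\<rho> by (rule prob_space_prior[OF \<rho>])
  have s\<rho>: "sets ?\<rho> = sets \<Theta>" by (rule sets_prior[OF \<rho>])
  note sp\<rho> = sets_eq_imp_space_eq[OF s\<rho>]
  let ?M = "PiM ?I (\<lambda>_. ?\<rho>)"
  interpret M: prob_space ?M by (intro prob_space_PiM \<rho>.prob_space_axioms)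
  have sM: "sets ?M = sets (PiM ?I (\<lambda>_. \<Theta>))" using s\<rho> by (intro sets_PiM_cong) auto
  have spM: "space ?M = (?I \<rightarrow>\<^sub>E space \<Theta>)" using sets_eq_imp_space_eq[OF sM] by (simp add: space_PiM)
  have K: "?K \<in> ?M \<rightarrow>\<^sub>M subprob_algebra (PiM ?I (\<lambda>_. \<X>))"
    using measurable_PiM_kernel[OF _ kernel, of ?I] sM by (simp cong: measurable_cong_sets)
  have h\<rho>: "h \<in> borel_measurable ?\<rho>" and c\<rho>: "c \<in> borel_measurable ?\<rho>"
    using h_measurable c_measurable s\<rho> by (simp_all cong: measurable_cong_sets)
  have var_le: "prior_variance h ?\<rho> \<le> max_prior_variance \<Theta> c h"
    unfolding max_prior_variance_def by (rule SUP_upper[OF \<rho>])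
  then have "prior_variance h ?\<rho> < \<infinity>" using max_var by (rule le_less_trans)
  note hL = L2_functions_of_prior_variance[OF \<rho>.prob_space_axioms h\<rho> this]
  have sd: "(std_dev ?\<rho> h)\<^sup>2 \<le> ?V"
    using enn2real_mono[OF var_le] max_var by (simp add: hL(2))
  let ?avg = "\<lambda>\<theta>. (\<Sum>i<n. 1 / real n * h (\<theta> i)) - T ?\<rho>"
  have avg_m[measurable]: "?avg \<in> borel_measurable ?M"
    by (intro borel_measurable_diff borel_measurable_sum borel_measurable_times borel_measurable_const
        measurable_PiM_component_rev h\<rho>) auto
  have cm[measurable]: "(\<lambda>\<theta>. ennreal (c (\<theta> i) / real n)) \<in> borel_measurable ?M" if "i \<in> ?I" for i
    using that c\<rho> by (intro measurable_compose[OF _ measurable_ennreal] borel_measurable_divide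
        measurable_PiM_component_rev borel_measurable_const) auto
  have pointwise: "ennreal (L\<^sup>2) * emeasure (?K \<theta>) B \<le>
      ennreal (3 * R) + ennreal (3 / 2) * ennreal ((?avg \<theta>)\<^sup>2) +
      ennreal (L\<^sup>2) * (\<Sum>i<n. ennreal (c (\<theta> i) / real n))" if \<theta>: "\<theta> \<in> space ?M" for \<theta>
  proof -
    have \<theta>': "\<theta> \<in> ?I \<rightarrow>\<^sub>E space \<Theta>" "\<theta> \<in> ?I \<rightarrow> space \<Theta>" using \<theta> spM by auto
    have prob: "prob_space (P (\<theta> i))" "sets (P (\<theta> i)) = sets \<X>" if "i < n" for i
      using kernel_prob \<theta>' that by auto
    interpret K: prob_space "?K \<theta>" using prob by (intro prob_space_PiM) auto
    have sK: "sets (?K \<theta>) = sets (PiM ?I (\<lambda>_. \<X>))" using prob by (intro sets_PiM_cong) auto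
    have BK[measurable]: "B \<in> sets (?K \<theta>)" using B sK by simp
    have Tm[measurable]: "Th \<in> borel_measurable (?K \<theta>)"
      using Th sK unfolding estimators_def by (simp cong: measurable_cong_sets)
    show ?thesis
    proof (cases "(\<Sum>i<n. c (\<theta> i)) / real n \<le> 1")
      case True
      then have pv: "\<theta> \<in> parameter_vectors \<Theta> c n"
        using n \<theta>' empirical_measure_in_prior_set_iff[OF _ \<theta>'(2) c_measurable]
        by (simp add: parameter_vectors_def)
      define m where "m = T (empirical_measure \<Theta> n \<theta>)"
      have m: "m - T ?\<rho> = ?avg \<theta>"
        using n target_empirical_measure[OF _ \<theta>'(2) h_measurable]
        by (simp add: m_def sum_divide_distrib)
      have "ennreal (L\<^sup>2) * emeasure (?K \<theta>) B = (\<integral>\<^sup>+x. ennreal (L\<^sup>2) * indicator B x \<partial>?K \<theta>)"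
        by (simp add: nn_integral_cmult_indicator)
      also have "\<dots> \<le> (\<integral>\<^sup>+x. ennreal 3 * ennreal (\<bar>Th x - m\<bar>\<^sup>2) +
          ennreal (3 / 2) * ennreal ((?avg \<theta>)\<^sup>2) \<partial>?K \<theta>)"
      proof (rule nn_integral_mono)
        fix x
        have "L\<^sup>2 \<le> 3 * \<bar>Th x - m\<bar>\<^sup>2 + 3 / 2 * (?avg \<theta>)\<^sup>2" if "x \<in> B"
        proof -
          have "L\<^sup>2 \<le> \<bar>Th x - T ?\<rho>\<bar>\<^sup>2" using far[OF that] L by (intro power_mono)
          also have "\<bar>Th x - T ?\<rho>\<bar>\<^sup>2 = ((Th x - m) + ?avg \<theta>)\<^sup>2" unfolding m[symmetric] by simp
          \<comment> \<open>The weights 3 and 3/2 have reciprocals with sum 1; their ratio 2 becomes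
            the denominator in K_V / (2 n).\<close>
          also have "\<dots> \<le> 3 * (Th x - m)\<^sup>2 + 3 / 2 * (?avg \<theta>)\<^sup>2"
          proof -
            have "0 \<le> (2 * a - b)\<^sup>2 / 2" for a b :: real by simp
            moreover have "3 * a\<^sup>2 + 3 / 2 * b\<^sup>2 - (a + b)\<^sup>2 = (2 * a - b)\<^sup>2 / 2" for a b :: real
              by (simp add: power2_eq_square field_simps)
            ultimately have "(a + b)\<^sup>2 \<le> 3 * a\<^sup>2 + 3 / 2 * b\<^sup>2" for a b :: real
              by (metis diff_ge_0_iff_ge)
            then show ?thesis .
          qed
          finally show ?thesis by simp
        qed
        then have "ennreal (L\<^sup>2) * indicator B x \<le> ennreal (3 * \<bar>Th x - m\<bar>\<^sup>2 + 3 / 2 * (?avg \<theta>)\<^sup>2)"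
          by (auto simp only: indicator_simps mult_1_right mult_zero_right zero_le intro!: ennreal_leI split: split_indicator)
        also have "\<dots> = ennreal (3 * \<bar>Th x - m\<bar>\<^sup>2) + ennreal (3 / 2 * (?avg \<theta>)\<^sup>2)"
          by (intro ennreal_plus) auto
        also have "ennreal (3 * \<bar>Th x - m\<bar>\<^sup>2) = ennreal 3 * ennreal (\<bar>Th x - m\<bar>\<^sup>2)"
          by (intro ennreal_mult) auto
        also have "ennreal (3 / 2 * (?avg \<theta>)\<^sup>2) = ennreal (3 / 2) * ennreal ((?avg \<theta>)\<^sup>2)"
          by (intro ennreal_mult) auto
        finally show "ennreal (L\<^sup>2) * indicator B x \<le>
            ennreal 3 * ennreal (\<bar>Th x - m\<bar>\<^sup>2) + ennreal (3 / 2) * ennreal ((?avg \<theta>)\<^sup>2)" .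
      qed
      also have "\<dots> = ennreal 3 * quadratic_risk \<Theta> P h n Th \<theta> + ennreal (3 / 2) * ennreal ((?avg \<theta>)\<^sup>2)"
        by (simp add: nn_integral_add nn_integral_cmult K.emeasure_space_1 quadratic_risk_def m_def)
      also have "\<dots> \<le> ennreal 3 * ennreal R + ennreal (3 / 2) * ennreal ((?avg \<theta>)\<^sup>2)"
        by (intro add_mono mult_left_mono risk[OF pv]) auto
      also have "ennreal 3 * ennreal R = ennreal (3 * R)" using R by (simp add: ennreal_mult)
      finally show ?thesis by (rule order_trans) (simp add: add_increasing2)
    next
      case False
      have nn: "0 \<le> c (\<theta> i) / real n" if "i < n" for i
        using \<theta>'(2) that by (intro divide_nonneg_nonneg c_nonneg) auto
      have "1 \<le> ennreal (\<Sum>i<n. c (\<theta> i) / real n)"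
        using False by (simp add: sum_divide_distrib)
      also have "\<dots> = (\<Sum>i<n. ennreal (c (\<theta> i) / real n))"
        using nn by (intro sum_ennreal[symmetric]) auto
      finally have "emeasure (?K \<theta>) B \<le> (\<Sum>i<n. ennreal (c (\<theta> i) / real n))"
        using K.measure_le_1[of B] order_trans by blast
      then have "ennreal (L\<^sup>2) * emeasure (?K \<theta>) B \<le> ennreal (L\<^sup>2) * (\<Sum>i<n. ennreal (c (\<theta> i) / real n))"
        by (rule mult_left_mono) simp
      then show ?thesis by (rule order_trans) (simp add: add_increasing)
    qed
  qed
  \<comment> \<open>The target at the empirical distribution of independent draws is an unbiased
    average of n terms, so it fluctuates with variance of order 1/n.\<close>
  have e1: "(\<integral>\<^sup>+\<theta>. ennreal ((?avg \<theta>)\<^sup>2) \<partial>?M) = ennreal ((std_dev ?\<rho> h)\<^sup>2 / real n)"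
  proof -
    have "(\<integral>\<^sup>+\<theta>. ennreal ((?avg \<theta>)\<^sup>2) \<partial>?M) =
        ennreal (((\<Sum>i<n. \<integral>s. 1 / real n * h s \<partial>?\<rho>) - T ?\<rho>)\<^sup>2 +
          (\<Sum>i<n. (std_dev ?\<rho> (\<lambda>s. 1 / real n * h s))\<^sup>2))"
    proof (rule nn_integral_PiM_sum_square)
      show "(\<lambda>s. 1 / real n * h s) \<in> L2_functions ?\<rho>"
        using L2_functions_lincomb[OF hL(1) hL(1), of "1 / real n" 0] by simp
    qed (use \<rho>.prob_space_axioms in auto)
    also have "(\<Sum>i<n. \<integral>s. 1 / real n * h s \<partial>?\<rho>) = T ?\<rho>"
      using n by (simp add: target_def)
    also have "(\<Sum>i<n. (std_dev ?\<rho> (\<lambda>s. 1 / real n * h s))\<^sup>2) = (std_dev ?\<rho> h)\<^sup>2 / real n"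
      using n \<rho>.std_dev_add_const[OF hL(1), of "1 / real n" 0]
      by (simp add: power_divide power2_eq_square)
    finally show ?thesis by simp
  qed
  have e2: "(\<Sum>i<n. \<integral>\<^sup>+\<theta>. ennreal (c (\<theta> i) / real n) \<partial>?M) \<le> ennreal (1 / 4)"
  proof -
    have "(\<integral>\<^sup>+\<theta>. ennreal (c (\<theta> i) / real n) \<partial>?M) = (\<integral>\<^sup>+s. ennreal (c s / real n) \<partial>?\<rho>)" if "i < n" for i
    proof -
      have "(\<integral>\<^sup>+s. ennreal (c s / real n) \<partial>distr ?M ?\<rho> (\<lambda>\<omega>. \<omega> i)) =
          (\<integral>\<^sup>+\<theta>. ennreal (c (\<theta> i) / real n) \<partial>?M)"
        using that c\<rho> by (intro nn_integral_distr) auto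
      then show ?thesis
        using that \<rho>.prob_space_axioms by (subst (asm) distr_PiM_component) auto
    qed
    then have "(\<Sum>i<n. \<integral>\<^sup>+\<theta>. ennreal (c (\<theta> i) / real n) \<partial>?M) =
        ennreal (real n) * (\<integral>\<^sup>+s. ennreal (c s / real n) \<partial>?\<rho>)"
      by (simp add: ennreal_of_nat_eq_real_of_nat)
    also have "\<dots> = (\<integral>\<^sup>+s. ennreal (real n) * ennreal (c s / real n) \<partial>?\<rho>)"
      using c\<rho> by (subst nn_integral_cmult) auto
    also have "\<dots> = (\<integral>\<^sup>+s. ennreal (c s) \<partial>?\<rho>)"
      using n c_nonneg sp\<rho> by (intro nn_integral_cong) (simp flip: ennreal_mult)
    also have "\<dots> \<le> ennreal (1 / 4)" by (rule nn_integral_constraint_diluted[OF \<pi>])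
    finally show ?thesis .
  qed
  have law: "PiM ?I (\<lambda>_. law ?\<rho>) = ?M \<bind> ?K"
    by (rule bind_PiM_kernel[symmetric, OF _ kernel prior_in_prob_algebra[OF \<rho>]]) simp
  interpret LL: prob_space "PiM ?I (\<lambda>_. law ?\<rho>)" by (intro prob_space_PiM prob_space_law[OF \<rho>])
  have KB: "(\<lambda>\<theta>. emeasure (?K \<theta>) B) \<in> borel_measurable ?M"
    using measurable_compose[OF K measurable_emeasure_subprob_algebra[OF B]] .
  have "ennreal (L\<^sup>2 * measure (PiM ?I (\<lambda>_. law ?\<rho>)) B) = ennreal (L\<^sup>2) * emeasure (?M \<bind> ?K) B"
    by (simp add: ennreal_mult LL.emeasure_eq_measure law[symmetric])
  also have "\<dots> = ennreal (L\<^sup>2) * (\<integral>\<^sup>+\<theta>. emeasure (?K \<theta>) B \<partial>?M)"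
    by (subst emeasure_bind[OF M.not_empty K B]) simp
  also have "\<dots> = (\<integral>\<^sup>+\<theta>. ennreal (L\<^sup>2) * emeasure (?K \<theta>) B \<partial>?M)"
    by (rule nn_integral_cmult[symmetric, OF KB])
  also have "\<dots> \<le> (\<integral>\<^sup>+\<theta>. ennreal (3 * R) + ennreal (3 / 2) * ennreal ((?avg \<theta>)\<^sup>2) +
      ennreal (L\<^sup>2) * (\<Sum>i<n. ennreal (c (\<theta> i) / real n)) \<partial>?M)"
    by (intro nn_integral_mono pointwise)
  also have "\<dots> = ennreal (3 * R) + ennreal (3 / 2) * ennreal ((std_dev ?\<rho> h)\<^sup>2 / real n) +
      ennreal (L\<^sup>2) * (\<Sum>i<n. \<integral>\<^sup>+\<theta>. ennreal (c (\<theta> i) / real n) \<partial>?M)"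
  proof -
    have split: "(\<integral>\<^sup>+\<theta>. a + b * u \<theta> + d * w \<theta> \<partial>?M) = a + b * (\<integral>\<^sup>+\<theta>. u \<theta> \<partial>?M) + d * (\<integral>\<^sup>+\<theta>. w \<theta> \<partial>?M)"
      if "u \<in> borel_measurable ?M" "w \<in> borel_measurable ?M" for a b d :: ennreal and u w
      using that by (simp add: nn_integral_add nn_integral_cmult M.emeasure_space_1)
    have "(\<lambda>\<theta>. ennreal ((?avg \<theta>)\<^sup>2)) \<in> borel_measurable ?M"
      by (rule measurable_compose[OF borel_measurable_power[OF avg_m] measurable_ennreal])
    moreover have "(\<lambda>\<theta>. \<Sum>i<n. ennreal (c (\<theta> i) / real n)) \<in> borel_measurable ?M"
      by (intro borel_measurable_sum cm)
    moreover have "(\<integral>\<^sup>+\<theta>. (\<Sum>i<n. ennreal (c (\<theta> i) / real n)) \<partial>?M) =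
        (\<Sum>i<n. \<integral>\<^sup>+\<theta>. ennreal (c (\<theta> i) / real n) \<partial>?M)"
      by (intro nn_integral_sum cm)
    ultimately show ?thesis by (simp only: split e1)
  qed
  also have "\<dots> \<le> ennreal (3 * R) + ennreal (3 / 2) * ennreal (?V / real n) + ennreal (L\<^sup>2) * ennreal (1 / 4)"
    using sd e2 by (intro add_mono mult_left_mono ennreal_leI divide_right_mono) auto
  also have "\<dots> = ennreal (3 * R + 3 / 2 * (?V / real n) + L\<^sup>2 / 4)"
    using R by (simp add: ennreal_mult[symmetric] ennreal_plus[symmetric] del: ennreal_plus)
  finally show ?thesis
    using R by (subst (asm) ennreal_le_iff) auto
qed

text \<open>Cutting \<open>Th\<close> at the midpoint of the two diluted targets gives a test. Its
  error probabilities add up to at least 1 - 7/25, and constraint violations account for at most 1/4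
  of each, leaving 11/50. With gap 8 L and division by 6 the constant is 11/19200, which exceeds
  1/2400.\<close>

lemma two_point_bound:
  assumes n: "1 \<le> n" and \<pi>: "\<pi> \<in> priors" "\<pi>' \<in> priors"
    and chi: "chi2_divergence (law \<pi>') (law \<pi>) \<le> ereal ((1 / sqrt (real n))\<^sup>2)"
    and le: "T \<pi> \<le> T \<pi>'"
    and Th: "Th \<in> estimators \<X> n" and R: "0 \<le> R"
    and risk: "\<And>\<theta>. \<theta> \<in> parameter_vectors \<Theta> c n \<Longrightarrow> quadratic_risk \<Theta> P h n Th \<theta> \<le> ennreal R"
  shows "(T \<pi>' - T \<pi>)\<^sup>2 / 2400 \<le> R + enn2real (max_prior_variance \<Theta> c h) / (2 * real n)"
proof -
  let ?I = "{..<n}" and ?X = "PiM {..<n} (\<lambda>_. \<X>)"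
  let ?V = "enn2real (max_prior_variance \<Theta> c h)"
  \<comment> \<open>A factor 4 for the dilution and a factor 2 for the cut at the midpoint.\<close>
  define L where "L = (T \<pi>' - T \<pi>) / 8"
  have L: "0 \<le> L" using le by (simp add: L_def)
  note \<rho> = diluted_in_priors[OF \<pi>(1)] and \<rho>' = diluted_in_priors[OF \<pi>(2)]
  have gap: "T (diluted \<pi>') - T (diluted \<pi>) = 2 * L"
    using target_mix[OF \<pi>(1) return_in_priors, of "1 / 4"] target_mix[OF \<pi>(2) return_in_priors, of "1 / 4"]
    by (simp add: L_def)
  define A where "A = {x \<in> space ?X. T (diluted \<pi>) + L \<le> Th x}"
  have A: "A \<in> sets ?X" using Th unfolding A_def estimators_def by measurable
  let ?m = "measure (PiM ?I (\<lambda>_. law (diluted \<pi>)))" and ?m' = "measure (PiM ?I (\<lambda>_. law (diluted \<pi>')))"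
  have sl: "sets (PiM ?I (\<lambda>_. law (diluted \<pi>))) = sets ?X" "sets (PiM ?I (\<lambda>_. law (diluted \<pi>'))) = sets ?X"
    using sets_law[OF \<rho>] sets_law[OF \<rho>'] by (auto intro!: sets_PiM_cong)
  have 1: "L\<^sup>2 * ?m A \<le> 3 * R + 3 / 2 * (?V / real n) + L\<^sup>2 / 4"
    by (rule testing_error_le_risk[OF n \<pi>(1) A Th R risk _ L]) (auto simp: A_def)
  have 2: "L\<^sup>2 * ?m' (space ?X - A) \<le> 3 * R + 3 / 2 * (?V / real n) + L\<^sup>2 / 4"
    using A gap by (intro testing_error_le_risk[OF n \<pi>(2) _ Th R risk _ L]) (auto simp: A_def)
  interpret L': prob_space "PiM ?I (\<lambda>_. law (diluted \<pi>'))" by (intro prob_space_PiM prob_space_law[OF \<rho>'])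
  have compl: "?m' (space ?X - A) = 1 - ?m' A"
    using L'.prob_compl[of A] A sl sets_eq_imp_space_eq[OF sl(2)] by simp
  have sets: "sets (law \<pi>') = sets (law \<pi>)" "sets (law (return \<Theta> \<theta>\<^sub>0)) = sets (law \<pi>)"
    using \<pi> return_in_priors by (simp_all add: sets_law)
  obtain D where D: "D \<in> borel_measurable (law \<pi>)" "\<And>x. 0 \<le> D x"
      "law \<pi>' = density (law \<pi>) (\<lambda>x. ennreal (D x))"
      "integrable (law \<pi>) (\<lambda>x. (D x)\<^sup>2)" "(\<integral>x. (D x)\<^sup>2 \<partial>law \<pi>) \<le> 1 + (1 / sqrt (real n))\<^sup>2"
    using chi2_divergence_leE[OF prob_space_law[OF \<pi>(1)] prob_space_law[OF \<pi>(2)] sets(1) chi] by blast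
  obtain D' where D': "D' \<in> borel_measurable (law (diluted \<pi>))" "\<And>x. 0 \<le> D' x"
      "law (diluted \<pi>') = density (law (diluted \<pi>)) (\<lambda>x. ennreal (D' x))"
      "integrable (law (diluted \<pi>)) (\<lambda>x. (D' x)\<^sup>2)"
      "(\<integral>x. (D' x)\<^sup>2 \<partial>law (diluted \<pi>)) \<le> 1 + 1 / 4 * ((\<integral>x. (D x)\<^sup>2 \<partial>law \<pi>) - 1)"
    using chi2_mix_measure[OF prob_space_law[OF \<pi>(1)] prob_space_law[OF \<pi>(2)]
        prob_space_law[OF return_in_priors] sets D(1-4) _ _ law_mix[OF \<pi>(1) return_in_priors], of "1 / 4"]
    unfolding law_mix[OF \<pi>(2) return_in_priors] by auto
  let ?J = "\<integral>x. (D' x)\<^sup>2 \<partial>law (diluted \<pi>)"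
  have "A \<in> sets (PiM ?I (\<lambda>_. law (diluted \<pi>)))" using A sl by simp
  from measure_PiM_diff_le[OF _ prob_space_law[OF \<rho>] prob_space_law[OF \<rho>'] D'(1-4) this]
  have diff: "\<bar>?m' A - ?m A\<bar> \<le> sqrt (?J ^ n - 1) / 2" by simp
  have "?J \<le> 1 + 1 / (4 * real n)"
  proof -
    have "(\<integral>x. (D x)\<^sup>2 \<partial>law \<pi>) \<le> 1 + 1 / real n" using D(5) by (simp add: power_divide)
    then have "1 / 4 * ((\<integral>x. (D x)\<^sup>2 \<partial>law \<pi>) - 1) \<le> 1 / 4 * (1 / real n)"
      by (intro mult_left_mono) auto
    with D'(5) have "?J \<le> 1 + 1 / 4 * (1 / real n)" by linarith
    then show ?thesis by simp
  qed
  also have "\<dots> \<le> exp (1 / (4 * real n))" by (rule exp_ge_add_one_self)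
  finally have "?J ^ n \<le> exp (1 / (4 * real n)) ^ n" by (intro power_mono) auto
  also have "\<dots> = exp (1 / 4)" using n by (simp flip: exp_of_nat_mult)
  also have "\<dots> \<le> 1 + 1 / 4 + (1 / 4)\<^sup>2" by (intro exp_bound) auto
  \<comment> \<open>14/25 is a rational upper bound for the square root of 1/4 + 1/16.\<close>
  finally have "?J ^ n - 1 \<le> (14 / 25)\<^sup>2" by (simp add: power2_eq_square)
  then have "sqrt (?J ^ n - 1) \<le> sqrt ((14 / 25)\<^sup>2)" by (rule real_sqrt_le_mono)
  then have "sqrt (?J ^ n - 1) \<le> 14 / 25" by simp
  then have "?m' A - ?m A \<le> 7 / 25" using diff by linarith
  then have "L\<^sup>2 * (?m' A - ?m A) \<le> L\<^sup>2 * (7 / 25)" by (rule mult_left_mono) simp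
  with 1 2 have "L\<^sup>2 * (11 / 50) \<le> 6 * R + 3 * (?V / real n)"
    unfolding compl by (simp add: algebra_simps)
  then have "(T \<pi>' - T \<pi>)\<^sup>2 * (11 / 3200) \<le> 6 * R + 3 * (?V / real n)"
    by (simp add: L_def power_divide)
  moreover have "0 \<le> (T \<pi>' - T \<pi>)\<^sup>2" by simp
  moreover have "?V / (2 * real n) = ?V / real n / 2" by simp
  ultimately show ?thesis by linarith
qed

lemma minimax_lower_bound:
  assumes n: "1 \<le> n"
  shows "ereal (1 / 2400) * (chi2_modulus \<Theta> P c h (1 / sqrt (real n)))\<^sup>2
      - enn2ereal (max_prior_variance \<Theta> c h) / ereal (2 * real n)
    \<le> enn2ereal (minimax_risk_det \<Theta> \<X> P c h n)"
proof -
  let ?t = "1 / sqrt (real n)" and ?V = "enn2real (max_prior_variance \<Theta> c h)"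
  have ne: "priors \<noteq> {}" using return_in_priors by auto
  define v where "v = (modulus ?t)\<^sup>2 / 2400 - ?V / (2 * real n)"
  have V: "enn2ereal (max_prior_variance \<Theta> c h) = ereal ?V"
    using max_var by (cases "max_prior_variance \<Theta> c h") auto
  have "ereal (1 / 2400) * (chi2_modulus \<Theta> P c h ?t)\<^sup>2
      - enn2ereal (max_prior_variance \<Theta> c h) / ereal (2 * real n) = ereal v"
    using n by (simp add: chi2_modulus_eq[OF ne] V v_def)
  \<comment> \<open>A negative \<open>v\<close> is truncated to 0, which is still a lower bound for
    a risk.\<close>
  also have "\<dots> \<le> enn2ereal (ennreal v)"
    by (cases "0 \<le> v") (auto simp: ennreal_neg zero_ennreal.rep_eq)
  also have "ennreal v \<le> minimax_risk_det \<Theta> \<X> P c h n"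
    unfolding minimax_risk_det_def
  proof (rule INF_greatest)
    fix Th assume Th: "Th \<in> estimators \<X> n"
    show "ennreal v \<le> worst_case_risk \<Theta> P c h n Th"
    proof (cases "worst_case_risk \<Theta> P c h n Th")
      case top
      then show ?thesis by simp
    next
      case (real R)
      have risk: "quadratic_risk \<Theta> P h n Th \<theta> \<le> ennreal R" if "\<theta> \<in> parameter_vectors \<Theta> c n" for \<theta>
        using SUP_upper[OF that, of "quadratic_risk \<Theta> P h n Th"] real by (simp add: worst_case_risk_def)
      \<comment> \<open>The two-point bound solved for the gap: every admissible pair has gap at
        most \<open>sqrt B\<close>, hence so has the supremum.\<close>
      define B where "B = 2400 * (R + ?V / (2 * real n))"
      have B: "0 \<le> B" using real by (simp add: B_def)
      have "T \<pi>' - T \<pi> \<le> sqrt B"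
        if \<pi>: "\<pi> \<in> priors" "\<pi>' \<in> priors" and chi: "chi2_divergence (law \<pi>') (law \<pi>) \<le> ereal (?t\<^sup>2)" for \<pi> \<pi>'
      proof (cases "T \<pi> \<le> T \<pi>'")
        case True
        have "(T \<pi>' - T \<pi>)\<^sup>2 \<le> B"
          using two_point_bound[OF n \<pi> chi True Th _ risk] real by (simp add: B_def)
        then show ?thesis by (rule real_le_rsqrt)
      next
        case False
        then show ?thesis using real_sqrt_ge_zero[OF B] by linarith
      qed
      then have "chi2_modulus \<Theta> P c h ?t \<le> ereal (sqrt B)"
        unfolding chi2_modulus_def by (intro Sup_least) auto
      then have "modulus ?t \<le> sqrt B" by (simp add: chi2_modulus_eq[OF ne])
      then have "(modulus ?t)\<^sup>2 \<le> (sqrt B)\<^sup>2" using modulus_nonneg[OF ne] by (rule power_mono)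
      then have "v \<le> R" using B by (simp add: v_def B_def)
      then show ?thesis using real by (simp add: ennreal_leI)
    qed
  qed
  finally show ?thesis by (simp add: less_eq_ennreal.rep_eq)
qed

end

end

theorem theorem9:
  fixes \<Theta> :: "'a measure" and \<X> :: "'b measure"
    and P :: "'a \<Rightarrow> 'b measure"
    and c h :: "'a \<Rightarrow> real"
    and F :: "('b \<Rightarrow> real) set"
    and \<tau> :: "'a measure topology"
  assumes kernel: "P \<in> \<Theta> \<rightarrow>\<^sub>M prob_algebra \<X>"
    and c_measurable: "c \<in> borel_measurable \<Theta>"
    and h_measurable: "h \<in> borel_measurable \<Theta>"
    and h_integrable: "\<And>\<pi>. \<pi> \<in> prior_set \<Theta> c \<Longrightarrow> integrable \<pi> h"
    and A1: "affine_functional_on (prior_set \<Theta> c) (target h)"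
    and A2: "convex_measures (prior_set \<Theta> c)"
    and A3: "function_space F"
      "\<And>a. (\<lambda>x. a) \<in> F"
      "\<And>\<pi>. \<pi> \<in> prior_set \<Theta> c \<Longrightarrow> dense_in_L2 F (\<pi> \<bind> P)"
    and A4: "topspace \<tau> = prior_set \<Theta> c"
      "compact_space \<tau>"
      "continuous_map \<tau> euclideanreal (target h)"
      "\<And>f. f \<in> F \<Longrightarrow> continuous_map \<tau> euclideanreal (\<lambda>\<pi>. \<integral>x. f x \<partial>(\<pi> \<bind> P))"
      "\<And>f. f \<in> F \<Longrightarrow> continuous_map \<tau> euclideanreal (\<lambda>\<pi>. \<integral>x. (f x)\<^sup>2 \<partial>(\<pi> \<bind> P))"
  shows "(\<forall>n\<ge>1.
            enn2ereal (minimax_risk_det \<Theta> \<X> P c h n)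
              \<le> (chi2_modulus \<Theta> P c h (1 / sqrt (real n)))\<^sup>2 \<and>
            (\<exists>g\<in>F. (\<lambda>x. (1 / real n) * (\<Sum>i<n. g (x i))) \<in> estimators \<X> n \<and>
               enn2ereal (worst_case_risk \<Theta> P c h n (\<lambda>x. (1 / real n) * (\<Sum>i<n. g (x i))))
                 \<le> (chi2_modulus \<Theta> P c h (1 / sqrt (real n)))\<^sup>2))
       \<and> (max_prior_variance \<Theta> c h < \<infinity> \<and>
          (\<forall>\<theta>\<in>space \<Theta>. 0 \<le> c \<theta>) \<and> (\<exists>\<theta>\<^sub>0\<in>space \<Theta>. c \<theta>\<^sub>0 = 0) \<longrightarrow>
          (\<forall>n\<ge>1.
            ereal (1 / 2400) * (chi2_modulus \<Theta> P c h (1 / sqrt (real n)))\<^sup>2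
              - enn2ereal (max_prior_variance \<Theta> c h) / ereal (2 * real n)
              \<le> enn2ereal (minimax_risk_det \<Theta> \<X> P c h n)))"
proof -
  interpret compact_experiment \<Theta> \<X> P c h F \<tau>
    by unfold_locales (fact assms)+
  show ?thesis
  proof (intro conjI allI impI)
    fix n :: nat assume n: "1 \<le> n"
    show up: "\<exists>g\<in>F. (\<lambda>x. (1 / real n) * (\<Sum>i<n. g (x i))) \<in> estimators \<X> n \<and>
        enn2ereal (worst_case_risk \<Theta> P c h n (\<lambda>x. (1 / real n) * (\<Sum>i<n. g (x i))))
          \<le> (chi2_modulus \<Theta> P c h (1 / sqrt (real n)))\<^sup>2"
      by (rule linear_estimator_upper_bound[OF n])
    then obtain g where
      g: "(\<lambda>x. (1 / real n) * (\<Sum>i<n. g (x i))) \<in> estimators \<X> n"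
        "enn2ereal (worst_case_risk \<Theta> P c h n (\<lambda>x. (1 / real n) * (\<Sum>i<n. g (x i))))
          \<le> (chi2_modulus \<Theta> P c h (1 / sqrt (real n)))\<^sup>2" by blast
    have "minimax_risk_det \<Theta> \<X> P c h n \<le>
        worst_case_risk \<Theta> P c h n (\<lambda>x. (1 / real n) * (\<Sum>i<n. g (x i)))"
      unfolding minimax_risk_det_def by (rule INF_lower[OF g(1)])
    then show "enn2ereal (minimax_risk_det \<Theta> \<X> P c h n) \<le>
        (chi2_modulus \<Theta> P c h (1 / sqrt (real n)))\<^sup>2"
      using g(2) by (auto simp: less_eq_ennreal.rep_eq intro: order_trans)
  next
    fix n :: nat
    assume A: "max_prior_variance \<Theta> c h < \<infinity> \<and>
        (\<forall>\<theta>\<in>space \<Theta>. 0 \<le> c \<theta>) \<and> (\<exists>\<theta>\<^sub>0\<in>space \<Theta>. c \<theta>\<^sub>0 = 0)" and n: "1 \<le> n"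
    then obtain \<theta>\<^sub>0 where "\<theta>\<^sub>0 \<in> space \<Theta>" "c \<theta>\<^sub>0 = 0" by blast
    then show "ereal (1 / 2400) * (chi2_modulus \<Theta> P c h (1 / sqrt (real n)))\<^sup>2
        - enn2ereal (max_prior_variance \<Theta> c h) / ereal (2 * real n)
        \<le> enn2ereal (minimax_risk_det \<Theta> \<X> P c h n)"
      using A n by (intro minimax_lower_bound) auto
  qed
qed

end
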